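(* Let $N\ge 3$ and let $S_{\lambda_*}$ be the Friedrichs extension of $-\Delta+\frac{\lambda_*}{|x|^2}$ in $L^2(\mathbb{R}^N)$ with $\lambda_*=-\big(\frac{N-2}{2}\big)^2$. If $g\in C_0^\infty(\mathbb{R}^N\setminus\{0\})$ is radially symmetric and satisfies $$\int_{\mathbb{R}^N}g(x)|x|^{-\frac{N-2}{2}}\,dx\neq 0,$$ then there exists a constant $C\ge 1$ such that $$C^{-1}(\log t)^{1/2}\le \|W_{S_{\lambda_*}}(t)g\|_{L^2(\mathbb{R}^N)}\le C(\log t)^{1/2},\quad t\ge 2.$$
   Context: $S_{\lambda_*}$ is the Friedrichs extension of the minimal realization $\big(-\Delta+\frac{\lambda_*}{|x|^2}\big)\big|_{C_0^\infty(\mathbb{R}^N\setminus\{0\})}$ (that is, $\Omega=\mathbb{R}^N\setminus\{0\}$, and $L^2(\Omega)$ is identified with $L^2(\mathbb{R}^N)$), which is nonnegative by the Hardy inequality. $W_{S_{\lambda_*}}(\cdot)g$ denotes the solution $w$ of $\partial_t^2w-\Delta w+\frac{\lambda_*}{|x|^2}w=0$ in $(\mathbb{R}^N\setminus\{0\})\times(0,\infty)$ with $(w,\partial_tw)(\cdot,0)=(0,g)$, understood as the unique solution in $L^2(\mathbb{R}^N)$ of $w''(t)+S_{\lambda_*}w(t)=0$, $w(0)=0$, $w'(0)=g$; equivalently, $W_{S_{\lambda_*}}(t)g=\phi_t(S_{\lambda_*})g$ by functional calculus with $\phi_t(\mu)=\sin(t\sqrt\mu)/\sqrt\mu$ for $\mu>0$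 and $\phi_t(0)=t$. *)

theory Defs
  imports "HOL-Analysis.Analysis"
begin

section \<open>The complex Hilbert space of square-integrable functions\<close>

definition square_integrable :: "('a::euclidean_space \<Rightarrow> complex) \<Rightarrow> bool" where
  "square_integrable f \<longleftrightarrow> f \<in> borel_measurable lborel \<and> integrable lborel (\<lambda>x. (cmod (f x))\<^sup>2)"

lemma square_integrable_0: "square_integrable (\<lambda>_. 0)"
  by (simp add: square_integrable_def)

lemma borel_measurable_cnj [measurable]: "cnj \<in> borel_measurable borel"
  by (intro borel_measurable_continuous_onI continuous_intros)

lemma square_integrable_mult_cnj:
  assumes "square_integrable f" "square_integrable g"
  shows "integrable lborel (\<lambda>x. f x * cnj (g x))"
proof (rule Bochner_Integration.integrable_bound)
  show "integrable lborel (\<lambda>x. (cmod (f x))\<^sup>2 + (cmod (g x))\<^sup>2)"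
    using assms by (simp add: square_integrable_def)
  have [measurable]: "f \<in> borel_measurable lborel" "g \<in> borel_measurable lborel"
    using assms by (auto simp: square_integrable_def)
  show "(\<lambda>x. f x * cnj (g x)) \<in> borel_measurable lborel"
    by measurable
  have "cmod (f x) * cmod (g x) \<le> (cmod (f x))\<^sup>2 + (cmod (g x))\<^sup>2" for x
    using sum_squares_bound[of "cmod (f x)" "cmod (g x)"]
      mult_nonneg_nonneg[OF norm_ge_zero norm_ge_zero, of "f x" "g x"] by linarith
  then show "AE x in lborel. norm (f x * cnj (g x)) \<le> norm ((cmod (f x))\<^sup>2 + (cmod (g x))\<^sup>2)"
    by (simp add: norm_mult)
qed

lemma square_integrable_add:
  assumes "square_integrable f" "square_integrable g"
  shows "square_integrable (\<lambda>x. f x + g x)"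
proof -
  have [measurable]: "f \<in> borel_measurable lborel" "g \<in> borel_measurable lborel"
    using assms by (auto simp: square_integrable_def)
  have "integrable lborel (\<lambda>x. (cmod (f x + g x))\<^sup>2)"
  proof (rule Bochner_Integration.integrable_bound)
    show "integrable lborel (\<lambda>x. 2 * (cmod (f x))\<^sup>2 + 2 * (cmod (g x))\<^sup>2)"
      using assms by (simp add: square_integrable_def)
    have "(cmod (f x + g x))\<^sup>2 \<le> 2 * (cmod (f x))\<^sup>2 + 2 * (cmod (g x))\<^sup>2" for x
    proof -
      have "(cmod (f x + g x))\<^sup>2 \<le> (cmod (f x) + cmod (g x))\<^sup>2"
        by (intro power_mono norm_triangle_ineq norm_ge_zero)
      also have "\<dots> \<le> 2 * (cmod (f x))\<^sup>2 + 2 * (cmod (g x))\<^sup>2"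
        using sum_squares_bound[of "cmod (f x)" "cmod (g x)"] by (simp add: power2_sum)
      finally show ?thesis .
    qed
    then show "AE x in lborel. norm ((cmod (f x + g x))\<^sup>2)
        \<le> norm (2 * (cmod (f x))\<^sup>2 + 2 * (cmod (g x))\<^sup>2)"
      by simp
  qed measurable
  then show ?thesis
    by (simp add: square_integrable_def)
qed

lemma square_integrable_cmult:
  assumes "square_integrable f"
  shows "square_integrable (\<lambda>x. c * f x)"
  using assms by (auto simp: square_integrable_def norm_mult power_mult_distrib)

definition l2_rel :: "('a::euclidean_space \<Rightarrow> complex) \<Rightarrow> ('a \<Rightarrow> complex) \<Rightarrow> bool" where
  "l2_rel f g \<longleftrightarrow> square_integrable f \<and> square_integrable g \<and> (AE x in lborel. f x = g x)"

lemma part_equivp_l2_rel: "part_equivp l2_rel"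
proof (rule part_equivpI)
  show "\<exists>f :: 'a \<Rightarrow> complex. l2_rel f f"
    using square_integrable_0 by (auto simp: l2_rel_def)
  show "symp (l2_rel :: ('a \<Rightarrow> complex) \<Rightarrow> _)"
    by (rule sympI) (auto simp: l2_rel_def)
  show "transp (l2_rel :: ('a \<Rightarrow> complex) \<Rightarrow> _)"
    by (rule transpI) (auto simp: l2_rel_def)
qed

text \<open>
  For square-integrable \<open>f\<close>, the class of \<open>f\<close> is \<open>abs_l2 f\<close>; the value of \<open>abs_l2\<close> on other
  functions is meaningless.
\<close>

quotient_type (overloaded) 'a l2 = "'a::euclidean_space \<Rightarrow> complex" / partial: l2_rel
  by (rule part_equivp_l2_rel)

lift_definition l2_cinner :: "'a::euclidean_space l2 \<Rightarrow> 'a l2 \<Rightarrow> complex"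
  is "\<lambda>f g. LINT x|lborel. f x * cnj (g x)"
proof -
  fix f f' g g' :: "'a \<Rightarrow> complex"
  assume "l2_rel f f'" "l2_rel g g'"
  then have [measurable]: "f \<in> borel_measurable lborel" "f' \<in> borel_measurable lborel"
      "g \<in> borel_measurable lborel" "g' \<in> borel_measurable lborel"
    and ae: "AE x in lborel. f x = f' x" "AE x in lborel. g x = g' x"
    by (auto simp: l2_rel_def square_integrable_def)
  show "(LINT x|lborel. f x * cnj (g x)) = (LINT x|lborel. f' x * cnj (g' x))"
  proof (rule integral_cong_AE)
    show "AE x in lborel. f x * cnj (g x) = f' x * cnj (g' x)"
      using ae by eventually_elim simp
  qed measurable
qed

instantiation l2 :: (euclidean_space) real_vector
begin

lift_definition zero_l2 :: "'a l2" is "\<lambda>_. 0"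
  by (simp add: l2_rel_def square_integrable_0)

lift_definition plus_l2 :: "'a l2 \<Rightarrow> 'a l2 \<Rightarrow> 'a l2" is "\<lambda>f g x. f x + g x"
  unfolding l2_rel_def
proof (intro conjI; (elim conjE)?)
  fix f f' g g' :: "'a \<Rightarrow> complex"
  assume "AE x in lborel. f x = f' x" "AE x in lborel. g x = g' x"
  then show "AE x in lborel. f x + g x = f' x + g' x"
    by eventually_elim simp
qed (rule square_integrable_add; assumption)+

lift_definition uminus_l2 :: "'a l2 \<Rightarrow> 'a l2" is "\<lambda>f x. - f x"
  using square_integrable_cmult[of _ "-1"] by (auto simp: l2_rel_def)

definition minus_l2 :: "'a l2 \<Rightarrow> 'a l2 \<Rightarrow> 'a l2" where
  "minus_l2 u v = u + (- v)"

lift_definition scaleR_l2 :: "real \<Rightarrow> 'a l2 \<Rightarrow> 'a l2" is "\<lambda>r f x. complex_of_real r * f x"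
  by (auto simp: l2_rel_def square_integrable_cmult)

instance
proof
  fix u v w :: "'a l2" and a b :: real
  show "u + v + w = u + (v + w)"
    by transfer (auto simp: l2_rel_def algebra_simps intro!: square_integrable_add)
  show "u + v = v + u"
    by transfer (auto simp: l2_rel_def algebra_simps intro!: square_integrable_add)
  show "0 + u = u"
    by transfer (auto simp: l2_rel_def)
  show "- u + u = 0"
    by transfer (auto simp: l2_rel_def square_integrable_0)
  show "u - v = u + - v"
    by (rule minus_l2_def)
  show "a *\<^sub>R (u + v) = a *\<^sub>R u + a *\<^sub>R v"
    by transfer (auto simp: l2_rel_def distrib_left
        intro!: square_integrable_add square_integrable_cmult)
  show "(a + b) *\<^sub>R u = a *\<^sub>R u + b *\<^sub>R u"
    by transfer (auto simp: l2_rel_def distrib_right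
        intro!: square_integrable_add square_integrable_cmult)
  show "a *\<^sub>R b *\<^sub>R u = (a * b) *\<^sub>R u"
    by transfer (auto simp: l2_rel_def mult.assoc
        intro!: square_integrable_cmult)
  show "1 *\<^sub>R u = u"
    by transfer (auto simp: l2_rel_def)
qed

end

instantiation l2 :: (euclidean_space) real_inner
begin

definition inner_l2 :: "'a l2 \<Rightarrow> 'a l2 \<Rightarrow> real" where
  "inner_l2 u v = Re (l2_cinner u v)"

definition norm_l2 :: "'a l2 \<Rightarrow> real" where
  "norm_l2 u = sqrt (inner u u)"

definition sgn_l2 :: "'a l2 \<Rightarrow> 'a l2" where
  "sgn_l2 u = u /\<^sub>R norm u"

definition dist_l2 :: "'a l2 \<Rightarrow> 'a l2 \<Rightarrow> real" where
  "dist_l2 u v = norm (u - v)"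

definition uniformity_l2 :: "('a l2 \<times> 'a l2) filter" where
  "uniformity_l2 = (INF e\<in>{0 <..}. principal {(x, y). dist x y < e})"

definition open_l2 :: "'a l2 set \<Rightarrow> bool" where
  "open_l2 U = (\<forall>x\<in>U. eventually (\<lambda>(x', y). x' = x \<longrightarrow> y \<in> U) uniformity)"

instance
proof
  fix u v w :: "'a l2" and a :: real and U :: "'a l2 set"
  show "sgn u = u /\<^sub>R norm u"
    by (rule sgn_l2_def)
  show "dist u v = norm (u - v)"
    by (rule dist_l2_def)
  show "uniformity = (INF e\<in>{0 <..}. principal {(x, y :: 'a l2). dist x y < e})"
    by (rule uniformity_l2_def)
  show "open U = (\<forall>x\<in>U. eventually (\<lambda>(x', y). x' = x \<longrightarrow> y \<in> U) uniformity)"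
    by (rule open_l2_def)
  show "norm u = sqrt (inner u u)"
    by (rule norm_l2_def)
  show "inner u v = inner v u"
    unfolding inner_l2_def
  proof transfer
    fix f g :: "'a \<Rightarrow> complex"
    have "(LINT x|lborel. g x * cnj (f x)) = (LINT x|lborel. cnj (f x * cnj (g x)))"
      by (simp add: mult.commute)
    also have "\<dots> = cnj (LINT x|lborel. f x * cnj (g x))"
      by (rule Bochner_Integration.integral_cnj)
    finally show "Re (LINT x|lborel. f x * cnj (g x)) = Re (LINT x|lborel. g x * cnj (f x))"
      by simp
  qed
  show "inner (u + v) w = inner u w + inner v w"
    unfolding inner_l2_def
    by transfer (simp add: l2_rel_def distrib_right square_integrable_mult_cnj)
  show "inner (a *\<^sub>R u) v = a * inner u v"
    unfolding inner_l2_def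
    by transfer (simp add: l2_rel_def mult.assoc)
  have sq: "(LINT x|lborel. f x * cnj (f x)) = complex_of_real (LINT x|lborel. (cmod (f x))\<^sup>2)"
    for f :: "'a \<Rightarrow> complex"
    by (simp only: complex_norm_square[symmetric] integral_complex_of_real)
  show "0 \<le> inner u u"
    unfolding inner_l2_def by transfer (simp add: sq)
  show "inner u u = 0 \<longleftrightarrow> u = 0"
    unfolding inner_l2_def
  proof transfer
    fix f :: "'a \<Rightarrow> complex"
    assume "l2_rel f f"
    then have f: "square_integrable f"
      by (simp add: l2_rel_def)
    have "Re (LINT x|lborel. f x * cnj (f x)) = 0 \<longleftrightarrow> (LINT x|lborel. (cmod (f x))\<^sup>2) = 0"
      by (simp add: sq)
    also have "\<dots> \<longleftrightarrow> (AE x in lborel. (cmod (f x))\<^sup>2 = 0)"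
      using f by (intro integral_nonneg_eq_0_iff_AE) (auto simp: square_integrable_def)
    also have "\<dots> \<longleftrightarrow> l2_rel f (\<lambda>_. 0)"
      using f by (simp add: l2_rel_def square_integrable_0)
    finally show "Re (LINT x|lborel. f x * cnj (f x)) = 0 \<longleftrightarrow> l2_rel f (\<lambda>_. 0)" .
  qed
qed

end

lemma norm_abs_l2:
  assumes "square_integrable f"
  shows "norm (abs_l2 f) = sqrt (LINT x|lborel. (cmod (f x))\<^sup>2)"
proof -
  have "l2_rel f f"
    using assms by (simp add: l2_rel_def)
  then have "l2_cinner (abs_l2 f) (abs_l2 f) = (LINT x|lborel. f x * cnj (f x))"
    by (simp add: l2_cinner.abs_eq)
  also have "\<dots> = complex_of_real (LINT x|lborel. (cmod (f x))\<^sup>2)"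
    by (simp only: complex_norm_square[symmetric] integral_complex_of_real)
  finally show ?thesis
    by (simp add: norm_l2_def inner_l2_def)
qed


section \<open>Test functions and the minimal realization\<close>

definition partial_deriv :: "'a::euclidean_space \<Rightarrow> ('a \<Rightarrow> complex) \<Rightarrow> 'a \<Rightarrow> complex" where
  "partial_deriv e f x = frechet_derivative f (at x) e"

fun C_k :: "nat \<Rightarrow> ('a::euclidean_space \<Rightarrow> complex) \<Rightarrow> bool" where
  "C_k 0 f \<longleftrightarrow> continuous_on UNIV f"
| "C_k (Suc k) f \<longleftrightarrow>
     (\<forall>x. f differentiable (at x)) \<and> (\<forall>e\<in>Basis. C_k k (partial_deriv e f))"

definition laplacian :: "('a::euclidean_space \<Rightarrow> complex) \<Rightarrow> 'a \<Rightarrow> complex" where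
  "laplacian f x = (\<Sum>e\<in>Basis. partial_deriv e (partial_deriv e f) x)"

text \<open>A function on \<open>\<Omega>\<close> with compact support in \<open>\<Omega>\<close> is identified with its extension by \<open>0\<close>.\<close>

definition test_functions :: "'a::euclidean_space set \<Rightarrow> ('a \<Rightarrow> complex) set" where
  "test_functions \<Omega> = {f. (\<forall>k. C_k k f) \<and>
     compact (closure {x. f x \<noteq> 0}) \<and> closure {x. f x \<noteq> 0} \<subseteq> \<Omega>}"

definition hardy_op :: "real \<Rightarrow> ('a::euclidean_space \<Rightarrow> complex) \<Rightarrow> 'a \<Rightarrow> complex" where
  "hardy_op c f x = - laplacian f x + complex_of_real (c / (norm x)\<^sup>2) * f x"

lemma continuous_compact_support_square_integrable:
  fixes f :: "'a::euclidean_space \<Rightarrow> complex"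
  assumes f: "continuous_on UNIV f" and K: "compact K" and supp: "\<And>x. x \<notin> K \<Longrightarrow> f x = 0"
  shows "square_integrable f"
proof -
  have "integrable lborel (\<lambda>x. indicator K x *\<^sub>R (cmod (f x))\<^sup>2)"
    using K by (intro borel_integrable_compact continuous_intros continuous_on_subset[OF f]) auto
  moreover have "(\<lambda>x. indicator K x *\<^sub>R (cmod (f x))\<^sup>2) = (\<lambda>x. (cmod (f x))\<^sup>2)"
  proof
    show "indicator K x *\<^sub>R (cmod (f x))\<^sup>2 = (cmod (f x))\<^sup>2" for x
      using supp[of x] by (cases "x \<in> K") auto
  qed
  ultimately show ?thesis
    using f by (simp add: square_integrable_def borel_measurable_continuous_onI)
qed

lemma square_integrable_test_function:
  assumes "f \<in> test_functions \<Omega>"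
  shows "square_integrable f"
proof (rule continuous_compact_support_square_integrable)
  have "C_k 0 f"
    using assms unfolding test_functions_def by blast
  then show "continuous_on UNIV f"
    by simp
  show "compact (closure {x. f x \<noteq> 0})"
    using assms by (simp add: test_functions_def)
  show "f x = 0" if "x \<notin> closure {x. f x \<noteq> 0}" for x
    using that closure_subset[of "{x. f x \<noteq> 0}"] by auto
qed

lemma partial_deriv_eq_0:
  assumes "open U" "x \<in> U" and "\<And>y. y \<in> U \<Longrightarrow> f y = 0"
  shows "partial_deriv e f x = 0"
proof -
  have "(f has_derivative (\<lambda>_. 0)) (at x)"
    by (rule has_derivative_transform_within_open[of "\<lambda>_. 0"]) (use assms in auto)
  then show ?thesis
    unfolding partial_deriv_def by (metis frechet_derivative_at)
qed

lemma square_integrable_hardy_op: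
  fixes f :: "'a::euclidean_space \<Rightarrow> complex"
  assumes f: "f \<in> test_functions (UNIV - {0})"
  shows "square_integrable (hardy_op c f)"
proof (rule continuous_compact_support_square_integrable)
  define K where "K = closure {x. f x \<noteq> 0}"
  have out: "f x = 0" if "x \<in> - K" for x
    using that closure_subset[of "{x. f x \<noteq> 0}"] by (auto simp: K_def)
  have "open (- K)"
    by (simp add: K_def open_Compl)
  have lap0: "laplacian f x = 0" if "x \<in> - K" for x
    unfolding laplacian_def
    by (intro sum.neutral ballI partial_deriv_eq_0[OF \<open>open (- K)\<close> that])
       (rule partial_deriv_eq_0[OF \<open>open (- K)\<close> _ out])
  show "compact K"
    using f by (simp add: test_functions_def K_def)
  show "hardy_op c f x = 0" if "x \<notin> K" for x
    using that lap0 out by (simp add: hardy_op_def)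
  have "C_k 0 f" "C_k 2 f"
    using f unfolding test_functions_def by blast+
  then have cf: "continuous_on UNIV f" and cl: "continuous_on UNIV (laplacian f)"
    unfolding laplacian_def by (auto simp: numeral_2_eq_2 intro!: continuous_on_sum)
  have c1: "continuous_on (UNIV - {0}) (hardy_op c f)"
    unfolding hardy_op_def
    by (intro continuous_intros continuous_on_subset[OF cl] continuous_on_subset[OF cf]) auto
  have c2: "continuous_on (- K) (hardy_op c f)"
    by (rule continuous_on_eq[of _ "\<lambda>_. 0"]) (use lap0 out in \<open>auto simp: hardy_op_def\<close>)
  have "0 \<in> - K"
    using f by (auto simp: test_functions_def K_def)
  then have "UNIV = (UNIV - {0}) \<union> - K"
    by auto
  then show "continuous_on UNIV (hardy_op c f)"
    using continuous_on_open_Un[OF open_delete[OF open_UNIV] \<open>open (- K)\<close> c1 c2] by simp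
qed

text \<open>Unbounded operators are represented by their graphs.\<close>

definition hardy_minimal :: "real \<Rightarrow> ('a::euclidean_space l2 \<times> 'a l2) set" where
  "hardy_minimal c = {(abs_l2 f, abs_l2 (hardy_op c f)) | f. f \<in> test_functions (UNIV - {0})}"


section \<open>Friedrichs extension\<close>

text \<open>
  Let \<open>T\<close> be a densely defined nonnegative symmetric operator with quadratic form
  \<open>q[u] = \<langle>T u, u\<rangle>\<close> on \<open>D(T)\<close>. The form domain consists of the \<open>L\<^sup>2\<close> limits of \<open>q\<close>-Cauchy sequences
  in \<open>D(T)\<close>, and the closed form is the limit of \<open>\<langle>T u\<^sub>n, v\<^sub>n\<rangle>\<close> along such sequences. The Friedrichs
  extension is the self-adjoint operator associated with the closed form.
\<close>

definition form_approx ::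
  "('a::euclidean_space l2 \<times> 'a l2) set \<Rightarrow> (nat \<Rightarrow> 'a l2 \<times> 'a l2) \<Rightarrow> 'a l2 \<Rightarrow> bool" where
  "form_approx T s u \<longleftrightarrow> range s \<subseteq> T \<and> (\<lambda>n. fst (s n)) \<longlonglongrightarrow> u \<and>
     (\<forall>\<epsilon>>0. \<exists>M. \<forall>m\<ge>M. \<forall>n\<ge>M.
        cmod (l2_cinner (snd (s m) - snd (s n)) (fst (s m) - fst (s n))) < \<epsilon>)"

definition form_domain :: "('a::euclidean_space l2 \<times> 'a l2) set \<Rightarrow> 'a l2 set" where
  "form_domain T = {u. \<exists>s. form_approx T s u}"

definition closed_form ::
  "('a::euclidean_space l2 \<times> 'a l2) set \<Rightarrow> 'a l2 \<Rightarrow> 'a l2 \<Rightarrow> complex" where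
  "closed_form T u v = (THE c. \<forall>s s'. form_approx T s u \<longrightarrow> form_approx T s' v \<longrightarrow>
     (\<lambda>n. l2_cinner (snd (s n)) (fst (s' n))) \<longlonglongrightarrow> c)"

definition friedrichs ::
  "('a::euclidean_space l2 \<times> 'a l2) set \<Rightarrow> ('a l2 \<times> 'a l2) set" where
  "friedrichs T = {(u, f). u \<in> form_domain T \<and>
     (\<forall>v\<in>form_domain T. closed_form T u v = l2_cinner f v)}"


section \<open>The wave equation\<close>

text \<open>
  Classical solutions, twice continuously differentiable from \<open>[0, \<infinity>)\<close> into \<open>L\<^sup>2\<close> with values in
  the domain of \<open>S\<close>, of \<open>w'' + S w = 0\<close>, \<open>w 0 = 0\<close>, \<open>w' 0 = g\<close>. For nonnegative self-adjoint \<open>S\<close>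
  and \<open>g\<close> in the domain of \<open>S\<close> there is exactly one, namely \<open>sin (t \<surd>S) / \<surd>S\<close> applied to \<open>g\<close>.
\<close>

definition wave_solution ::
  "('a::euclidean_space l2 \<times> 'a l2) set \<Rightarrow> 'a l2 \<Rightarrow> (real \<Rightarrow> 'a l2) \<Rightarrow> bool" where
  "wave_solution S g w \<longleftrightarrow> w 0 = 0 \<and>
     (\<exists>w' w''. w' 0 = g \<and> continuous_on {0..} w'' \<and>
        (\<forall>t\<ge>0. (w has_vector_derivative w' t) (at t within {0..}) \<and>
                (w' has_vector_derivative w'' t) (at t within {0..}) \<and>
                (w t, - w'' t) \<in> S))"

definition wave_propagator ::
  "('a::euclidean_space l2 \<times> 'a l2) set \<Rightarrow> real \<Rightarrow> 'a l2 \<Rightarrow> 'a l2" where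
  "wave_propagator S t g = (THE u. \<exists>w. wave_solution S g w \<and> u = w t)"

end

(*
For radial data, w = |x|^(-(N-2)/2) v(|x|,t) turns the critical wave equation into the radial wave
equation v_tt = v_rr + v_r/r of the plane. Its solution with v = 0, r v_t = H at time 0 (H extended to
an odd function) is the ring average (1/pi) int_0^pi p(t + r cos a) da of the Abel transform
p(t) = int_0^(pi/2) H(t sin b) db, by Archimedes' theorem on the sphere. It has finite propagation
speed, and logarithmic cutoffs at the origin put it into the form domain, so it is the solution for
the Friedrichs extension.

Symmetry of the operator makes <w(t+s), w'(t-s)> + <w'(t+s), w(t-s)> independent of s, whence
d/dt |w(t)|^2 = Re <w(2t), g>. As p(t) = M/t + O(1/t^2) with M proportional to the integral of
g |x|^(-(N-2)/2), the right-hand side is c/t + O(1/t^2) with c > 0, so |w(t)|^2 ~ c log t. The same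
identity gives uniqueness, and shows that a zero of w at some t > 0 would make w periodic, so that
|w(t)|^2 / log t is bounded below for all t >= 2.
*)
theory Submission
  imports Defs
begin

section \<open>Friedrichs extensions of form-bounded operators\<close>

text \<open>The closed form and the propagator are definite descriptions, so well-definedness has to
  be earned before anything can be computed. For the form this is closability. The ground state
  substitution prepares it: after integration by parts the form is a sum of squares of modified
  gradients, which gives nonnegativity and a Cauchy-Schwarz bound at once. For the propagator
  symmetry is enough, so spectral calculus never enters.

  Two obstacles shape the explicit solution. The Abel transform has no compact support, so the
  compact support of its ring averages in \<open>r\<close> is a cancellation that the formula does
  not show; a weighted energy argument supplies it. And the plane wave need not vanish at
  \<open>r = 0\<close>, so the lifted wave may keep the singularity of the ground state, which
  cutoffs at a fixed scale would not approximate in energy. The step function in the logarithmic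
  cutoffs is the primitive of \<open>H\<close> divided by its mass: the nonvanishing mass that
  drives the growth also normalizes it.

  No decay uniform in space is required, because pairing with the initial velocity sees only the
  radii in its support.\<close>

text \<open>The classes form a real vector space here, so multiplication by the imaginary unit is
  introduced by hand. It carries the real Cauchy-Schwarz inequality over to imaginary parts of
  \<open>l2_cinner\<close>.\<close>

lift_definition imult_l2 :: "'a::euclidean_space l2 \<Rightarrow> 'a l2" is "\<lambda>f x. \<i> * f x"
  by (auto simp: l2_rel_def square_integrable_cmult)

lemma l2_cinner_commute: "l2_cinner u v = cnj (l2_cinner v u)"
proof transfer
  fix f g :: "'a \<Rightarrow> complex"
  have "(LINT x|lborel. f x * cnj (g x)) = (LINT x|lborel. cnj (g x * cnj (f x)))"
    by (simp add: mult.commute)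
  then show "(LINT x|lborel. f x * cnj (g x)) = cnj (LINT x|lborel. g x * cnj (f x))"
    by (simp only: Bochner_Integration.integral_cnj)
qed

lemma l2_cinner_add_left: "l2_cinner (u + v) w = l2_cinner u w + l2_cinner v w"
  by transfer (simp add: l2_rel_def distrib_right square_integrable_mult_cnj)

lemma l2_cinner_scaleR_left: "l2_cinner (a *\<^sub>R u) w = a *\<^sub>R l2_cinner u w"
  by transfer (simp add: l2_rel_def mult.assoc scaleR_conv_of_real)

lemma l2_cinner_imult_left: "l2_cinner (imult_l2 u) w = \<i> * l2_cinner u w"
  by transfer (simp add: l2_rel_def mult.assoc)

lemma l2_cinner_add_right: "l2_cinner w (u + v) = l2_cinner w u + l2_cinner w v"
  by (metis complex_cnj_add l2_cinner_add_left l2_cinner_commute)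

lemma l2_cinner_scaleR_right: "l2_cinner w (a *\<^sub>R u) = a *\<^sub>R l2_cinner w u"
  by (metis complex_cnj_scaleR l2_cinner_commute l2_cinner_scaleR_left)

lemma norm_imult_l2: "norm (imult_l2 u) = norm u"
proof -
  have "l2_cinner (imult_l2 u) (imult_l2 u) = \<i> * cnj (\<i> * l2_cinner u u)"
    by (metis l2_cinner_commute l2_cinner_imult_left)
  also have "\<dots> = l2_cinner u u"
    by (metis complex_cnj_cnj complex_cnj_i complex_cnj_mult i_squared l2_cinner_commute
        mult.assoc mult_minus_left mult_minus_right mult_1 minus_minus)
  finally show ?thesis
    by (simp add: norm_l2_def inner_l2_def)
qed

text \<open>The real Cauchy-Schwarz inequality is applied to \<open>u\<close> and to
  \<open>imult_l2 u\<close>; adding the bounds for real and imaginary part produces the factor 2.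
  The same 2 is later the form constant of the Hardy operator.\<close>

lemma cmod_l2_cinner_le: "cmod (l2_cinner u v) \<le> norm u * norm v * 2"
proof -
  have re: "\<bar>Re (l2_cinner a b)\<bar> \<le> norm a * norm b" for a b :: "'a l2"
    using Cauchy_Schwarz_ineq2[of a b] by (simp add: inner_l2_def)
  have "Re (l2_cinner (imult_l2 u) v) = - Im (l2_cinner u v)"
    by (simp add: l2_cinner_imult_left)
  then have "\<bar>Im (l2_cinner u v)\<bar> \<le> norm u * norm v"
    using re[of "imult_l2 u" v] by (simp add: norm_imult_l2)
  then show ?thesis
    using re[of u v] cmod_le[of "l2_cinner u v"] by linarith
qed

lemma bounded_bilinear_l2_cinner: "bounded_bilinear l2_cinner"
  using cmod_l2_cinner_le
  by unfold_locales
     (auto simp: l2_cinner_add_left l2_cinner_add_right l2_cinner_scaleR_left l2_cinner_scaleR_right)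

interpretation l2_cinner: bounded_bilinear l2_cinner
  by (rule bounded_bilinear_l2_cinner)

section \<open>Closed forms of symmetric operators with a Cauchy-Schwarz bound\<close>

text \<open>Closure of the graph under differences is what sequences approximating a vector require.
  \<open>form_bound\<close> is Cauchy-Schwarz for the form up to the constant \<open>C\<close>,
  which leaves room for nonsharp estimates; it is the way in which nonnegativity of the operator
  enters.\<close>

locale bounded_symmetric_form =
  fixes T :: "('a::euclidean_space l2 \<times> 'a l2) set" and C :: real
  assumes C_nonneg: "0 \<le> C"
    and T_diff: "\<And>p q. p \<in> T \<Longrightarrow> q \<in> T \<Longrightarrow> p - q \<in> T"
    and T_sym: "\<And>p q. p \<in> T \<Longrightarrow> q \<in> T \<Longrightarrow>
      l2_cinner (snd p) (fst q) = cnj (l2_cinner (snd q) (fst p))"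
    and form_bound: "\<And>p q. p \<in> T \<Longrightarrow> q \<in> T \<Longrightarrow> cmod (l2_cinner (snd p) (fst q)) \<le>
      C * (sqrt (cmod (l2_cinner (snd p) (fst p))) * sqrt (cmod (l2_cinner (snd q) (fst q))))"
begin

definition form :: "'a l2 \<times> 'a l2 \<Rightarrow> 'a l2 \<times> 'a l2 \<Rightarrow> complex" where
  "form p q = l2_cinner (snd p) (fst q)"

definition qform :: "'a l2 \<times> 'a l2 \<Rightarrow> real" where
  "qform p = cmod (form p p)"

lemma form_diff_left: "form (p - q) r = form p r - form q r"
  and form_diff_right: "form r (p - q) = form r p - form r q"
  by (simp_all add: form_def l2_cinner.diff_left l2_cinner.diff_right)

lemma qform_nonneg [simp]: "0 \<le> qform p"
  by (simp add: qform_def)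

lemma form_le:
  assumes "p \<in> T" "q \<in> T" "qform p \<le> a" "qform q \<le> b"
  shows "cmod (form p q) \<le> C * (sqrt a * sqrt b)"
proof -
  have "cmod (form p q) \<le> C * (sqrt (qform p) * sqrt (qform q))"
    using form_bound[OF assms(1,2)] by (simp add: form_def qform_def)
  also have "\<dots> \<le> C * (sqrt a * sqrt b)"
    using assms qform_nonneg[of p] qform_nonneg[of q]
    by (intro mult_left_mono[OF _ C_nonneg] mult_mono) (auto simp del: qform_nonneg)
  finally show ?thesis .
qed

text \<open>The cross terms are absorbed by the form bound and the arithmetic-geometric mean
  inequality. This replaces the triangle inequality for the form norm.\<close>

lemma qform_diff_le:
  assumes "p \<in> T" "q \<in> T"
  shows "qform (p - q) \<le> (1 + C) * (qform p + qform q)"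
proof -
  have am: "2 * (sqrt (qform p) * sqrt (qform q)) \<le> qform p + qform q"
    using sum_squares_bound[of "sqrt (qform p)" "sqrt (qform q)"] by simp
  have "qform (p - q) = cmod (form p p - form p q - (form q p - form q q))"
    by (simp add: qform_def form_diff_left form_diff_right algebra_simps)
  also have "\<dots> \<le> cmod (form p p) + cmod (form p q) + (cmod (form q p) + cmod (form q q))"
    by (meson add_mono norm_triangle_ineq4 order_trans)
  also have "\<dots> \<le> qform p + qform q + C * (2 * (sqrt (qform p) * sqrt (qform q)))"
    using form_le[OF assms order_refl order_refl] form_le[OF assms(2,1) order_refl order_refl]
    by (simp add: qform_def algebra_simps)
  also have "\<dots> \<le> qform p + qform q + C * (qform p + qform q)"
    using mult_left_mono[OF am C_nonneg] by simp
  finally show ?thesis by (simp add: algebra_simps)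
qed

lemma form_approx_iff:
  "form_approx T s u \<longleftrightarrow> (\<forall>n. s n \<in> T) \<and> (\<lambda>n. fst (s n)) \<longlonglongrightarrow> u \<and>
     (\<forall>\<epsilon>>0. \<exists>M. \<forall>m\<ge>M. \<forall>n\<ge>M. qform (s m - s n) < \<epsilon>)"
  by (auto simp: form_approx_def qform_def form_def)

lemma form_approx_diff:
  assumes s: "form_approx T s u" and r: "form_approx T r v"
  shows "form_approx T (\<lambda>n. s n - r n) (u - v)"
  unfolding form_approx_iff
proof (intro conjI allI impI)
  show "s n - r n \<in> T" for n
    using s r T_diff by (auto simp: form_approx_iff)
  show "(\<lambda>n. fst (s n - r n)) \<longlonglongrightarrow> u - v"
    using s r by (auto simp: form_approx_iff intro!: tendsto_diff)
  fix \<epsilon> :: real assume "\<epsilon> > 0"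
  then have d: "\<epsilon> / (2 * (1 + C)) > 0"
    using C_nonneg by (intro divide_pos_pos) auto
  obtain M where M: "\<And>m n. m \<ge> M \<Longrightarrow> n \<ge> M \<Longrightarrow> qform (s m - s n) < \<epsilon> / (2 * (1 + C))"
    using s d unfolding form_approx_iff by meson
  obtain M' where M': "\<And>m n. m \<ge> M' \<Longrightarrow> n \<ge> M' \<Longrightarrow> qform (r m - r n) < \<epsilon> / (2 * (1 + C))"
    using r d unfolding form_approx_iff by meson
  have "qform (s m - r m - (s n - r n)) < \<epsilon>" if "m \<ge> max M M'" "n \<ge> max M M'" for m n
  proof -
    have "s m - r m - (s n - r n) = (s m - s n) - (r m - r n)"
      by simp
    moreover have "qform ((s m - s n) - (r m - r n)) \<le> (1 + C) * (qform (s m - s n) + qform (r m - r n))"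
      using s r by (intro qform_diff_le T_diff) (auto simp: form_approx_iff)
    ultimately have "qform (s m - r m - (s n - r n)) \<le> (1 + C) * (qform (s m - s n) + qform (r m - r n))"
      by metis
    also have "\<dots> < (1 + C) * (\<epsilon> / (2 * (1 + C)) + \<epsilon> / (2 * (1 + C)))"
      using that C_nonneg by (intro mult_strict_left_mono add_strict_mono M M') auto
    also have "\<dots> = \<epsilon>"
    proof -
      have "K * (\<epsilon> / (2 * K) + \<epsilon> / (2 * K)) = \<epsilon>" if "K > 0" for K
        using that by (simp add: field_simps)
      from this[of "1 + C"] C_nonneg show ?thesis
        by linarith
    qed
    finally show ?thesis .
  qed
  then show "\<exists>M. \<forall>m\<ge>M. \<forall>n\<ge>M. qform (s m - r m - (s n - r n)) < \<epsilon>"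
    by blast
qed

lemma form_approx_bounded:
  assumes s: "form_approx T s u"
  obtains B M where "0 \<le> B" "\<And>n. n \<ge> M \<Longrightarrow> qform (s n) \<le> B"
proof -
  obtain M where M: "\<And>m n. m \<ge> M \<Longrightarrow> n \<ge> M \<Longrightarrow> qform (s m - s n) < 1"
    using s unfolding form_approx_iff by (meson zero_less_one)
  have sT: "s n \<in> T" for n
    using s by (auto simp: form_approx_iff)
  \<comment> \<open>This is \<open>- s M\<close>, written so that closure under differences puts it
    into \<open>T\<close>.\<close>
  define z where "z = s M - s M - s M"
  have z: "z \<in> T" "z = - s M"
    unfolding z_def by (intro T_diff sT) simp
  have "qform (s n) \<le> (1 + C) * (1 + qform z)" if "n \<ge> M" for n
  proof -
    have "qform (s n) = qform ((s n - s M) - z)"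
      by (simp add: z(2))
    also have "\<dots> \<le> (1 + C) * (qform (s n - s M) + qform z)"
      by (intro qform_diff_le T_diff sT z)
    also have "\<dots> \<le> (1 + C) * (1 + qform z)"
      using M[OF that order_refl] C_nonneg by (intro mult_left_mono add_mono) auto
    finally show ?thesis .
  qed
  moreover have "0 \<le> (1 + C) * (1 + qform z)"
    using C_nonneg by (intro mult_nonneg_nonneg) auto
  ultimately show thesis
    using that by blast
qed

text \<open>The threshold \<open>M\<close> is uniform over all \<open>q\<close> with energy at most
  \<open>B\<close>. This uniformity permits interchanging the limits in the two indices
  below.\<close>

lemma form_approx_small:
  assumes s: "form_approx T s u" and B: "0 \<le> B" and "\<epsilon> > 0"
  obtains M where "\<And>m n q. m \<ge> M \<Longrightarrow> n \<ge> M \<Longrightarrow> q \<in> T \<Longrightarrow> qform q \<le> B \<Longrightarrow>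
    cmod (form (s m - s n) q) < \<epsilon> \<and> cmod (form q (s m - s n)) < \<epsilon>"
proof -
  \<comment> \<open>Chosen so that \<open>C * sqrt B * sqrt \<delta> < \<epsilon>\<close>; the
    summand 1 keeps the denominator positive when \<open>C\<close> or \<open>B\<close> is
    zero.\<close>
  define \<delta> where "\<delta> = (\<epsilon> / (C * sqrt B + 1))\<^sup>2"
  have pos: "C * sqrt B + 1 > 0"
    using C_nonneg B by (simp add: add_nonneg_pos)
  then have "\<delta> > 0"
    using \<open>\<epsilon> > 0\<close> by (simp add: \<delta>_def)
  then obtain M where M: "\<And>m n. m \<ge> M \<Longrightarrow> n \<ge> M \<Longrightarrow> qform (s m - s n) < \<delta>"
    using s unfolding form_approx_iff by meson
  have "sqrt \<delta> = \<epsilon> / (C * sqrt B + 1)"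
    using pos \<open>\<epsilon> > 0\<close> by (simp add: \<delta>_def)
  then have "sqrt \<delta> + C * (sqrt B * sqrt \<delta>) = \<epsilon>"
    using pos by (simp add: field_simps)
  then have "C * (sqrt B * sqrt \<delta>) < \<epsilon>"
    using real_sqrt_gt_zero[OF \<open>\<delta> > 0\<close>] by linarith
  moreover have "s n \<in> T" for n
    using s by (auto simp: form_approx_iff)
  ultimately show thesis
    using that[of M] form_le[OF _ T_diff _ less_imp_le[OF M]] form_le[OF T_diff _ less_imp_le[OF M]]
    by (smt (verit) mult.commute)
qed

text \<open>This is closability. For fixed \<open>n\<close>, \<open>form (z n) (z k)\<close> tends
  to 0 in \<open>k\<close>, because its second argument enters only through the norm limit 0; hence
  \<open>form (z n) (z n)\<close> is the limit of \<open>form (z n) (z n - z k)\<close>, which is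
  small uniformly in \<open>k\<close>.\<close>

lemma qform_null:
  assumes z: "form_approx T z 0"
  shows "(\<lambda>n. form (z n) (z n)) \<longlonglongrightarrow> 0"
proof (rule LIMSEQ_I)
  fix \<epsilon> :: real assume "\<epsilon> > 0"
  obtain B N where B: "0 \<le> B" "\<And>n. n \<ge> N \<Longrightarrow> qform (z n) \<le> B"
    using form_approx_bounded[OF z] by blast
  obtain M where M: "\<And>m n q. m \<ge> M \<Longrightarrow> n \<ge> M \<Longrightarrow> q \<in> T \<Longrightarrow> qform q \<le> B \<Longrightarrow>
      cmod (form (z m - z n) q) < \<epsilon> / 2 \<and> cmod (form q (z m - z n)) < \<epsilon> / 2"
    using form_approx_small[OF z B(1), of "\<epsilon> / 2"] \<open>\<epsilon> > 0\<close> by auto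
  have zT: "z n \<in> T" for n
    using z by (auto simp: form_approx_iff)
  have "cmod (form (z n) (z n)) \<le> \<epsilon> / 2" if n: "n \<ge> max M N" for n
  proof (rule tendsto_upperbound)
    have "(\<lambda>k. form (z n) (z k)) \<longlonglongrightarrow> l2_cinner (snd (z n)) 0"
      using z unfolding form_approx_iff form_def by (intro l2_cinner.tendsto tendsto_const) auto
    then have "(\<lambda>k. form (z n) (z k)) \<longlonglongrightarrow> 0"
      by (simp add: l2_cinner.zero_right)
    then have "(\<lambda>k. cmod (form (z n) (z n) - form (z n) (z k))) \<longlonglongrightarrow> cmod (form (z n) (z n) - 0)"
      by (intro tendsto_intros)
    then show "(\<lambda>k. cmod (form (z n) (z n) - form (z n) (z k))) \<longlonglongrightarrow> cmod (form (z n) (z n))"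
      by simp
    show "\<forall>\<^sub>F k in sequentially. cmod (form (z n) (z n) - form (z n) (z k)) \<le> \<epsilon> / 2"
    proof (rule eventually_sequentiallyI)
      fix k assume "M \<le> k"
      then show "cmod (form (z n) (z n) - form (z n) (z k)) \<le> \<epsilon> / 2"
        using M[of n k "z n"] n zT B by (auto simp: form_diff_right)
    qed
  qed simp
  then have "\<forall>n\<ge>max M N. norm (form (z n) (z n) - 0) < \<epsilon>"
    using \<open>\<epsilon> > 0\<close> by (metis diff_zero field_sum_of_halves less_add_same_cancel1 half_gt_zero order_le_less_trans)
  then show "\<exists>no. \<forall>n\<ge>no. norm (form (z n) (z n) - 0) < \<epsilon>"
    by blast
qed

lemma form_null_left:
  assumes z: "form_approx T z 0" and s: "form_approx T s v"
  shows "(\<lambda>n. form (z n) (s n)) \<longlonglongrightarrow> 0" "(\<lambda>n. form (s n) (z n)) \<longlonglongrightarrow> 0"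
proof -
  obtain B N where B: "0 \<le> B" "\<And>n. n \<ge> N \<Longrightarrow> qform (s n) \<le> B"
    using form_approx_bounded[OF s] by blast
  have T: "z n \<in> T" "s n \<in> T" for n
    using z s by (auto simp: form_approx_iff)
  have "(\<lambda>n. C * (sqrt (cmod (form (z n) (z n))) * sqrt B)) \<longlonglongrightarrow> C * (sqrt (cmod 0) * sqrt B)"
    by (intro tendsto_intros qform_null z)
  then have lim: "(\<lambda>n. C * (sqrt (qform (z n)) * sqrt B)) \<longlonglongrightarrow> 0"
    by (simp add: qform_def)
  show "(\<lambda>n. form (z n) (s n)) \<longlonglongrightarrow> 0"
  proof (rule Lim_null_comparison[OF _ lim])
    show "\<forall>\<^sub>F n in sequentially. cmod (form (z n) (s n)) \<le> C * (sqrt (qform (z n)) * sqrt B)"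
      by (rule eventually_sequentiallyI[of N]) (intro form_le T B order_refl)
  qed
  show "(\<lambda>n. form (s n) (z n)) \<longlonglongrightarrow> 0"
  proof (rule Lim_null_comparison[OF _ lim])
    show "\<forall>\<^sub>F n in sequentially. cmod (form (s n) (z n)) \<le> C * (sqrt (qform (z n)) * sqrt B)"
    proof (rule eventually_sequentiallyI[of N])
      fix n assume "N \<le> n"
      then have "cmod (form (s n) (z n)) \<le> C * (sqrt B * sqrt (qform (z n)))"
        by (intro form_le T B order_refl)
      then show "cmod (form (s n) (z n)) \<le> C * (sqrt (qform (z n)) * sqrt B)"
        by (simp add: mult.commute)
    qed
  qed
qed

text \<open>Replacing either approximating sequence changes the form values by a null sequence, so a
  single pair of sequences settles the definite description.\<close>

lemma closed_form_eqI:
  assumes s: "form_approx T s u" and s': "form_approx T s' v"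
    and lim: "(\<lambda>n. form (s n) (s' n)) \<longlonglongrightarrow> c"
  shows "closed_form T u v = c"
  unfolding closed_form_def
proof (rule the_equality)
  show "\<forall>s s'. form_approx T s u \<longrightarrow> form_approx T s' v \<longrightarrow>
     (\<lambda>n. l2_cinner (snd (s n)) (fst (s' n))) \<longlonglongrightarrow> c"
  proof (intro allI impI)
    fix r r' assume r: "form_approx T r u" and r': "form_approx T r' v"
    have 1: "(\<lambda>n. form (r n - s n) (r' n)) \<longlonglongrightarrow> 0"
      using form_null_left(1)[OF _ r'] form_approx_diff[OF r s] by simp
    have 2: "(\<lambda>n. form (s n) (r' n - s' n)) \<longlonglongrightarrow> 0"
      using form_null_left(2)[OF _ s] form_approx_diff[OF r' s'] by simp
    have "(\<lambda>n. form (r n - s n) (r' n) + form (s n) (r' n - s' n) + form (s n) (s' n)) \<longlonglongrightarrow> 0 + 0 + c"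
      by (intro tendsto_add 1 2 lim)
    then show "(\<lambda>n. l2_cinner (snd (r n)) (fst (r' n))) \<longlonglongrightarrow> c"
      by (simp add: form_diff_left form_diff_right) (simp add: form_def)
  qed
  show "c' = c" if "\<forall>s s'. form_approx T s u \<longrightarrow> form_approx T s' v \<longrightarrow>
     (\<lambda>n. l2_cinner (snd (s n)) (fst (s' n))) \<longlonglongrightarrow> c'" for c'
    using that s s' lim LIMSEQ_unique unfolding form_def by blast
qed

lemma closed_form_lim:
  assumes s: "form_approx T s u" and s': "form_approx T s' v"
  shows "(\<lambda>n. form (s n) (s' n)) \<longlonglongrightarrow> closed_form T u v"
proof -
  obtain B N where B: "0 \<le> B" "\<And>n. n \<ge> N \<Longrightarrow> qform (s n) \<le> B"
    using form_approx_bounded[OF s] by blast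
  obtain B' N' where B': "0 \<le> B'" "\<And>n. n \<ge> N' \<Longrightarrow> qform (s' n) \<le> B'"
    using form_approx_bounded[OF s'] by blast
  have T: "s n \<in> T" "s' n \<in> T" for n
    using s s' by (auto simp: form_approx_iff)
  have "Cauchy (\<lambda>n. form (s n) (s' n))"
  proof (rule CauchyI)
    fix \<epsilon> :: real assume "\<epsilon> > 0"
    then have e: "\<epsilon> / 2 > 0" by simp
    obtain M where M: "\<And>m n q. m \<ge> M \<Longrightarrow> n \<ge> M \<Longrightarrow> q \<in> T \<Longrightarrow> qform q \<le> B' \<Longrightarrow>
      cmod (form (s m - s n) q) < \<epsilon> / 2 \<and> cmod (form q (s m - s n)) < \<epsilon> / 2"
      using form_approx_small[OF s B'(1) e] by blast
    obtain M' where M': "\<And>m n q. m \<ge> M' \<Longrightarrow> n \<ge> M' \<Longrightarrow> q \<in> T \<Longrightarrow> qform q \<le> B \<Longrightarrow>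
      cmod (form (s' m - s' n) q) < \<epsilon> / 2 \<and> cmod (form q (s' m - s' n)) < \<epsilon> / 2"
      using form_approx_small[OF s' B(1) e] by blast
    have "norm (form (s m) (s' m) - form (s n) (s' n)) < \<epsilon>"
      if "m \<ge> max (max M M') (max N N')" "n \<ge> max (max M M') (max N N')" for m n
    proof -
      have "form (s m) (s' m) - form (s n) (s' n) = form (s m - s n) (s' m) + form (s n) (s' m - s' n)"
        by (simp add: form_diff_left form_diff_right)
      moreover have "cmod (form (s m - s n) (s' m)) < \<epsilon> / 2"
        using M[of m n "s' m"] that T B' by auto
      moreover have "cmod (form (s n) (s' m - s' n)) < \<epsilon> / 2"
        using M'[of m n "s n"] that T B by auto
      ultimately show ?thesis
        by (smt (verit) norm_triangle_ineq field_sum_of_halves)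
    qed
    then show "\<exists>M. \<forall>m\<ge>M. \<forall>n\<ge>M. norm (form (s m) (s' m) - form (s n) (s' n)) < \<epsilon>"
      by blast
  qed
  then obtain c where "(\<lambda>n. form (s n) (s' n)) \<longlonglongrightarrow> c"
    by (auto simp: Cauchy_convergent_iff convergent_def)
  with closed_form_eqI[OF s s' this] show ?thesis
    by simp
qed

lemma closed_form_commute:
  assumes "u \<in> form_domain T" "v \<in> form_domain T"
  shows "closed_form T u v = cnj (closed_form T v u)"
proof -
  obtain s s' where s: "form_approx T s u" and s': "form_approx T s' v"
    using assms by (auto simp: form_domain_def)
  have "form (s n) (s' n) = cnj (form (s' n) (s n))" for n
    using s s' T_sym[of "s n" "s' n"] by (auto simp: form_approx_iff form_def)
  then have "(\<lambda>n. form (s n) (s' n)) \<longlonglongrightarrow> cnj (closed_form T v u)"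
    using tendsto_cnj[OF closed_form_lim[OF s' s]] by simp
  then show ?thesis
    by (rule closed_form_eqI[OF s s'])
qed

text \<open>Of the self-adjointness of the extension, symmetry is the part on which uniqueness and
  the growth identity for waves rest.\<close>

lemma friedrichs_symmetric:
  assumes "(u, f) \<in> friedrichs T" "(v, h) \<in> friedrichs T"
  shows "l2_cinner f v = cnj (l2_cinner h u)"
  using assms closed_form_commute[of u v] by (auto simp: friedrichs_def)

text \<open>The Friedrichs extension is the restriction of the adjoint of \<open>T\<close> to the form domain.\<close>

lemma friedrichsI:
  assumes u: "u \<in> form_domain T"
    and weak: "\<And>v h. (v, h) \<in> T \<Longrightarrow> l2_cinner u h = l2_cinner f v"
  shows "(u, f) \<in> friedrichs T"
proof -
  obtain s where s: "form_approx T s u"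
    using u by (auto simp: form_domain_def)
  have "closed_form T u v = l2_cinner f v" if v: "v \<in> form_domain T" for v
  proof -
    obtain s' where s': "form_approx T s' v"
      using v by (auto simp: form_domain_def)
    obtain B N where B: "0 \<le> B" "\<And>n. n \<ge> N \<Longrightarrow> qform (s' n) \<le> B"
      using form_approx_bounded[OF s'] by blast
    have T: "s n \<in> T" "s' n \<in> T" for n
      using s s' by (auto simp: form_approx_iff)
    have 1: "(\<lambda>n. form (s n) (s' n) - l2_cinner f (fst (s' n))) \<longlonglongrightarrow> 0"
    proof (rule LIMSEQ_I)
      fix \<epsilon> :: real assume "\<epsilon> > 0"
      then obtain M where M: "\<And>m n q. m \<ge> M \<Longrightarrow> n \<ge> M \<Longrightarrow> q \<in> T \<Longrightarrow> qform q \<le> B \<Longrightarrow>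
          cmod (form (s m - s n) q) < \<epsilon> / 2 \<and> cmod (form q (s m - s n)) < \<epsilon> / 2"
        using form_approx_small[OF s B(1), of "\<epsilon> / 2"] by auto
      \<comment> \<open>For fixed \<open>n\<close> the index of \<open>s\<close> is sent to
        infinity. Symmetry moves the operator onto the test vector \<open>s' n\<close>, where only
        the norm limit \<open>u\<close> and the weak equation matter.\<close>
      have "cmod (form (s n) (s' n) - l2_cinner f (fst (s' n))) \<le> \<epsilon> / 2" if n: "n \<ge> max M N" for n
      proof (rule tendsto_upperbound)
        have "(\<lambda>k. l2_cinner (fst (s k)) (snd (s' n))) \<longlonglongrightarrow> l2_cinner u (snd (s' n))"
          using s unfolding form_approx_iff by (intro l2_cinner.tendsto tendsto_const) auto
        moreover have "l2_cinner (fst (s k)) (snd (s' n)) = form (s k) (s' n)" for k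
          by (metis T T_sym form_def l2_cinner_commute)
        moreover have "l2_cinner u (snd (s' n)) = l2_cinner f (fst (s' n))"
          using weak[of "fst (s' n)" "snd (s' n)"] T by simp
        ultimately have "(\<lambda>k. form (s k) (s' n)) \<longlonglongrightarrow> l2_cinner f (fst (s' n))"
          by simp
        then show "(\<lambda>k. cmod (form (s n) (s' n) - form (s k) (s' n)))
            \<longlonglongrightarrow> cmod (form (s n) (s' n) - l2_cinner f (fst (s' n)))"
          by (intro tendsto_intros)
        show "\<forall>\<^sub>F k in sequentially. cmod (form (s n) (s' n) - form (s k) (s' n)) \<le> \<epsilon> / 2"
        proof (rule eventually_sequentiallyI)
          fix k assume "M \<le> k"
          then show "cmod (form (s n) (s' n) - form (s k) (s' n)) \<le> \<epsilon> / 2"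
            using M[of n k "s' n"] n T B by (auto simp: form_diff_left)
        qed
      qed simp
      then have "\<forall>n\<ge>max M N. norm (form (s n) (s' n) - l2_cinner f (fst (s' n)) - 0) < \<epsilon>"
        using \<open>\<epsilon> > 0\<close> by (metis diff_zero field_sum_of_halves less_add_same_cancel1 half_gt_zero order_le_less_trans)
      then show "\<exists>no. \<forall>n\<ge>no. norm (form (s n) (s' n) - l2_cinner f (fst (s' n)) - 0) < \<epsilon>"
        by blast
    qed
    have 2: "(\<lambda>n. l2_cinner f (fst (s' n))) \<longlonglongrightarrow> l2_cinner f v"
      using s' unfolding form_approx_iff by (intro l2_cinner.tendsto tendsto_const) auto
    have "(\<lambda>n. form (s n) (s' n)) \<longlonglongrightarrow> l2_cinner f v"
      using tendsto_add[OF 1 2] by simp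
    then show ?thesis
      by (rule closed_form_eqI[OF s s'])
  qed
  with u show ?thesis
    by (simp add: friedrichs_def)
qed

end

section \<open>Smooth functions of one real variable\<close>

text \<open>Order 0 demands nothing: \<open>smooth\<close> quantifies over all orders, so continuity
  comes from the differentiability required one order higher.\<close>

primrec smooth_order :: "nat \<Rightarrow> real set \<Rightarrow> (real \<Rightarrow> complex) \<Rightarrow> bool" where
  "smooth_order 0 U f \<longleftrightarrow> True"
| "smooth_order (Suc k) U f \<longleftrightarrow> (\<forall>t\<in>U. f differentiable (at t)) \<and>
     smooth_order k U (\<lambda>t. vector_derivative f (at t))"

definition smooth :: "real set \<Rightarrow> (real \<Rightarrow> complex) \<Rightarrow> bool" where
  "smooth U f \<longleftrightarrow> (\<forall>k. smooth_order k U f)"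

lemma smooth_order_cong:
  assumes "open U" "\<And>t. t \<in> U \<Longrightarrow> f t = g t" "smooth_order k U f"
  shows "smooth_order k U g"
  using assms(2,3)
proof (induction k arbitrary: f g)
  case (Suc k)
  have d: "(g has_vector_derivative vector_derivative f (at t)) (at t)" if "t \<in> U" for t
  proof (rule has_vector_derivative_transform_within_open[OF _ assms(1) that Suc.prems(1)])
    show "(f has_vector_derivative vector_derivative f (at t)) (at t)"
      using Suc.prems(2) that by (auto simp: vector_derivative_works)
  qed
  have "smooth_order k U (\<lambda>t. vector_derivative g (at t))"
  proof (rule Suc.IH[of "\<lambda>t. vector_derivative f (at t)"])
    show "vector_derivative f (at t) = vector_derivative g (at t)" if "t \<in> U" for t
      using vector_derivative_at[OF d[OF that]] by simp
  qed (use Suc.prems in simp)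
  moreover have "g differentiable (at t)" if "t \<in> U" for t
    using d[OF that] by (rule differentiableI_vector)
  ultimately show ?case by simp
qed simp

lemma smooth_order_SucI:
  assumes "open U" and d: "\<And>t. t \<in> U \<Longrightarrow> (f has_vector_derivative f' t) (at t)"
    and "smooth_order k U f'"
  shows "smooth_order (Suc k) U f"
proof -
  have "smooth_order k U (\<lambda>t. vector_derivative f (at t))"
    by (rule smooth_order_cong[OF assms(1) _ assms(3)]) (simp only: vector_derivative_at[OF d])
  then show ?thesis
    using d differentiableI_vector by auto
qed

lemma smooth_order_SucD:
  assumes "smooth_order (Suc k) U f"
  shows "\<exists>f'. (\<forall>t\<in>U. (f has_vector_derivative f' t) (at t)) \<and> smooth_order k U f'"
  by (rule exI[of _ "\<lambda>t. vector_derivative f (at t)"])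
     (use assms in \<open>simp add: vector_derivative_works\<close>)

lemma smooth_order_mono: "smooth_order (Suc k) U f \<Longrightarrow> smooth_order k U f"
  by (induction k arbitrary: f) auto

lemma smooth_order_subset: "smooth_order k U f \<Longrightarrow> V \<subseteq> U \<Longrightarrow> smooth_order k V f"
  by (induction k arbitrary: f) auto

lemma smooth_order_Un: "smooth_order k U f \<Longrightarrow> smooth_order k V f \<Longrightarrow> smooth_order k (U \<union> V) f"
  by (induction k arbitrary: f) auto

lemma smooth_order_const: "open U \<Longrightarrow> smooth_order k U (\<lambda>_. c)"
proof (induction k arbitrary: c)
  case (Suc k)
  show ?case
    by (rule smooth_order_SucI[OF Suc.prems has_vector_derivative_const Suc.IH[OF Suc.prems]])
qed simp

lemma smooth_order_add:
  assumes "open U" "smooth_order k U f" "smooth_order k U g"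
  shows "smooth_order k U (\<lambda>t. f t + g t)"
  using assms(2,3)
proof (induction k arbitrary: f g)
  case (Suc k)
  obtain f' where f': "\<forall>t\<in>U. (f has_vector_derivative f' t) (at t)" "smooth_order k U f'"
    using smooth_order_SucD[OF Suc.prems(1)] by blast
  obtain g' where "\<forall>t\<in>U. (g has_vector_derivative g' t) (at t)" "smooth_order k U g'"
    using smooth_order_SucD[OF Suc.prems(2)] by blast
  with f' show ?case
    by (intro smooth_order_SucI[OF assms(1), of _ "\<lambda>t. f' t + g' t"] Suc.IH has_vector_derivative_add)
       auto
qed simp

lemma smooth_order_mult:
  assumes "open U" "smooth_order k U f" "smooth_order k U g"
  shows "smooth_order k U (\<lambda>t. f t * g t)"
  using assms(2,3)
proof (induction k arbitrary: f g)
  case (Suc k)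
  obtain f' where f': "\<forall>t\<in>U. (f has_vector_derivative f' t) (at t)" "smooth_order k U f'"
    using smooth_order_SucD[OF Suc.prems(1)] by blast
  obtain g' where "\<forall>t\<in>U. (g has_vector_derivative g' t) (at t)" "smooth_order k U g'"
    using smooth_order_SucD[OF Suc.prems(2)] by blast
  with f' show ?case
    using Suc.prems[THEN smooth_order_mono]
    by (intro smooth_order_SucI[OF assms(1), of _ "\<lambda>t. f t * g' t + f' t * g t"] Suc.IH
        has_vector_derivative_mult smooth_order_add assms(1))
       auto
qed simp

lemma smooth_cong: "smooth U f \<Longrightarrow> open U \<Longrightarrow> (\<And>t. t \<in> U \<Longrightarrow> f t = g t) \<Longrightarrow> smooth U g"
  unfolding smooth_def using smooth_order_cong by blast

lemma smooth_subset: "smooth U f \<Longrightarrow> V \<subseteq> U \<Longrightarrow> smooth V f"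
  unfolding smooth_def using smooth_order_subset by blast

lemma smooth_Un: "smooth U f \<Longrightarrow> smooth V f \<Longrightarrow> smooth (U \<union> V) f"
  unfolding smooth_def using smooth_order_Un by blast

lemma smooth_const: "open U \<Longrightarrow> smooth U (\<lambda>_. c)"
  unfolding smooth_def using smooth_order_const by blast

lemma smooth_mult: "open U \<Longrightarrow> smooth U f \<Longrightarrow> smooth U g \<Longrightarrow> smooth U (\<lambda>t. f t * g t)"
  unfolding smooth_def using smooth_order_mult by blast

text \<open>Iterating \<open>step\<close> supplies derivatives of every order without naming them.
  This serves parameter integrals, restrictions to rays and given sequences of derivatives, whose
  higher derivatives are tedious to write out.\<close>

lemma smooth_coinduct:
  assumes "open U" "X f"
    and step: "\<And>f. X f \<Longrightarrow> \<exists>f'. (\<forall>t\<in>U. (f has_vector_derivative f' t) (at t)) \<and> X f'"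
  shows "smooth U f"
proof -
  have "smooth_order k U f" for k
    using assms(2)
  proof (induction k arbitrary: f)
    case (Suc k)
    then obtain f' where "\<forall>t\<in>U. (f has_vector_derivative f' t) (at t)" "X f'"
      using step by blast
    then show ?case
      using Suc.IH assms(1) smooth_order_SucI by blast
  qed simp
  then show ?thesis by (simp add: smooth_def)
qed

lemma smooth_has_vector_derivative:
  assumes "smooth U f" "t \<in> U"
  shows "(f has_vector_derivative vector_derivative f (at t)) (at t)"
proof -
  have "smooth_order (Suc 0) U f" using assms unfolding smooth_def by blast
  then show ?thesis using assms by (auto simp: vector_derivative_works)
qed

lemma smooth_vector_derivative: "smooth U f \<Longrightarrow> smooth U (\<lambda>t. vector_derivative f (at t))"
  unfolding smooth_def by (metis smooth_order.simps(2))

lemma smooth_derivative_exists: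
  assumes "smooth U f"
  shows "\<exists>f'. (\<forall>t\<in>U. (f has_vector_derivative f' t) (at t)) \<and> smooth U f'"
  using assms smooth_vector_derivative smooth_has_vector_derivative
  by (intro exI[of _ "\<lambda>t. vector_derivative f (at t)"]) simp

lemma smooth_continuous_on:
  assumes "smooth U f"
  shows "continuous_on U f"
  by (intro continuous_at_imp_continuous_on ballI)
     (rule has_vector_derivative_continuous[OF smooth_has_vector_derivative[OF assms]])

section \<open>Powers, logarithmic substitution and integrals with a parameter\<close>

text \<open>With the square inside, the power makes sense on both half-lines and is even, as the odd
  extension of the initial datum requires. The induction runs over all exponents, since
  differentiation lowers \<open>a\<close> by one.\<close>

lemma smooth_powr_square: "smooth (- {0}) (\<lambda>s. complex_of_real ((s\<^sup>2) powr a))"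
proof -
  have op: "open (- {0 :: real})" by (simp add: open_Compl)
  have d0: "((\<lambda>s. complex_of_real s) has_vector_derivative 1) (at t)" for t :: real
    using bounded_linear.has_vector_derivative[OF bounded_linear_of_real[where 'a = complex]
        has_vector_derivative_id[where net = "at t"]]
    by simp
  have id: "smooth_order k (- {0}) complex_of_real" for k
  proof (cases k)
    case (Suc n)
    then show ?thesis
      using smooth_order_SucI[OF op d0 smooth_order_const[OF op]] by simp
  qed simp
  have "smooth_order k (- {0}) (\<lambda>s. complex_of_real ((s\<^sup>2) powr a))" for k
  proof (induction k arbitrary: a)
    case (Suc k)
    show ?case
    proof (rule smooth_order_SucI[OF op])
      show "((\<lambda>s. complex_of_real ((s\<^sup>2) powr a)) has_vector_derivative
          complex_of_real (2 * a) * (complex_of_real t * complex_of_real ((t\<^sup>2) powr (a - 1)))) (at t)"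
        if "t \<in> - {0}" for t
      proof -
        have "((\<lambda>s. (s\<^sup>2) powr a) has_real_derivative a * (t\<^sup>2) powr (a - 1) * (2 * t)) (at t)"
          using that by (auto intro!: derivative_eq_intros simp: powr_diff)
        then have "((\<lambda>s. (s\<^sup>2) powr a) has_vector_derivative 2 * a * (t * (t\<^sup>2) powr (a - 1))) (at t)"
          by (simp add: has_real_derivative_iff_has_vector_derivative mult_ac)
        from bounded_linear.has_vector_derivative[OF bounded_linear_of_real this]
        show ?thesis by simp
      qed
      show "smooth_order k (- {0})
         (\<lambda>t. complex_of_real (2 * a) * (complex_of_real t * complex_of_real ((t\<^sup>2) powr (a - 1))))"
        by (intro smooth_order_mult smooth_order_const op id Suc.IH)
    qed
  qed simp
  then show ?thesis by (simp add: smooth_def)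
qed

lemma smooth_powr: "smooth {0<..} (\<lambda>s. complex_of_real (s powr a))"
proof (rule smooth_cong[OF smooth_subset[OF smooth_powr_square[of "a / 2"]]])
  show "complex_of_real ((t\<^sup>2) powr (a / 2)) = complex_of_real (t powr a)" if "t \<in> {0<..}" for t :: real
    using that by (simp add: powr_powr flip: powr_numeral)
qed auto

text \<open>Serves the logarithmic cutoffs. The derivative is a power of \<open>r\<close> times a
  composition of the same shape with \<open>f'\<close>, so the induction runs over all
  \<open>f\<close>.\<close>

lemma smooth_comp_ln:
  assumes "smooth UNIV f"
  shows "smooth {0<..} (\<lambda>r. f (a + b * ln r))"
proof -
  have "smooth_order k {0<..} (\<lambda>r. f (a + b * ln r))" if "smooth UNIV f" for k f
    using that
  proof (induction k arbitrary: f)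
    case (Suc k)
    obtain f' where f': "\<forall>t\<in>UNIV. (f has_vector_derivative f' t) (at t)" "smooth UNIV f'"
      using smooth_derivative_exists[OF Suc.prems] by blast
    show ?case
    proof (rule smooth_order_SucI)
      fix t :: real assume "t \<in> {0<..}"
      then have "((\<lambda>r. a + b * ln r) has_real_derivative b * t powr (-1)) (at t)"
        by (auto intro!: derivative_eq_intros simp: powr_minus field_simps)
      then have "((\<lambda>r. a + b * ln r) has_vector_derivative b * t powr (-1)) (at t)"
        by (simp add: has_real_derivative_iff_has_vector_derivative)
      from vector_diff_chain_at[OF this f'(1)[rule_format, OF UNIV_I]]
      show "((\<lambda>r. f (a + b * ln r)) has_vector_derivative
          complex_of_real b * (complex_of_real (t powr (-1)) * f' (a + b * ln t))) (at t)"
        by (simp add: o_def scaleR_conv_of_real mult_ac)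
    next
      have "smooth_order k {0<..} (\<lambda>s. complex_of_real (s powr (-1)))"
        using smooth_powr unfolding smooth_def by blast
      then show "smooth_order k {0<..}
          (\<lambda>t. complex_of_real b * (complex_of_real (t powr (-1)) * f' (a + b * ln t)))"
        by (intro smooth_order_mult smooth_order_const Suc.IH f') auto
    qed auto
  qed simp
  with assms show ?thesis by (simp add: smooth_def)
qed

text \<open>Differentiation under the integral multiplies the weight by \<open>d\<close> and keeps
  the affine argument. The radius and time derivatives of ring averages and the derivatives of Abel
  transforms are all instances.\<close>

lemma has_vector_derivative_affine_integral:
  fixes f f' :: "real \<Rightarrow> 'b::banach" and a b :: real
  assumes f: "\<And>t. (f has_vector_derivative f' t) (at t)" and f': "continuous_on UNIV f'"
    and c: "continuous_on {a..b} c" and k: "continuous_on {a..b} k" and d: "continuous_on {a..b} d"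
  shows "((\<lambda>s. integral {a..b} (\<lambda>\<theta>. c \<theta> *\<^sub>R f (k \<theta> + s * d \<theta>))) has_vector_derivative
     integral {a..b} (\<lambda>\<theta>. (c \<theta> * d \<theta>) *\<^sub>R f' (k \<theta> + s * d \<theta>))) (at s)"
proof -
  have fc: "continuous_on UNIV f"
    by (intro continuous_at_imp_continuous_on ballI) (rule has_vector_derivative_continuous[OF f])
  have "((\<lambda>s. integral (cbox a b) (\<lambda>\<theta>. c \<theta> *\<^sub>R f (k \<theta> + s * d \<theta>))) has_vector_derivative
     integral (cbox a b) (\<lambda>\<theta>. (c \<theta> * d \<theta>) *\<^sub>R f' (k \<theta> + s * d \<theta>))) (at s within UNIV)"
  proof (rule leibniz_rule_vector_derivative)
    fix s t
    have "((\<lambda>s. k t + s * d t) has_vector_derivative d t) (at s)"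
      by (auto intro!: derivative_eq_intros simp flip: has_real_derivative_iff_has_vector_derivative)
    from vector_diff_chain_at[OF this f]
    have "((\<lambda>s. f (k t + s * d t)) has_vector_derivative d t *\<^sub>R f' (k t + s * d t)) (at s)"
      by (simp add: o_def)
    from bounded_linear.has_vector_derivative[OF bounded_linear_scaleR_right this, of "c t"]
    show "((\<lambda>s. c t *\<^sub>R f (k t + s * d t)) has_vector_derivative
        (c t * d t) *\<^sub>R f' (k t + s * d t)) (at s within UNIV)"
      by simp
  next
    fix s :: real
    have "(\<lambda>\<theta>. c \<theta> *\<^sub>R f (k \<theta> + s * d \<theta>)) integrable_on {a..b}"
      using c k d by (intro integrable_continuous_real)
         (auto intro!: continuous_intros continuous_on_compose2[OF fc])
    then show "(\<lambda>\<theta>. c \<theta> *\<^sub>R f (k \<theta> + s * d \<theta>)) integrable_on cbox a b"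
      by simp
  next
    have sub: "continuous_on (UNIV \<times> {a..b}) (\<lambda>x. h (snd x))" if "continuous_on {a..b} h" for h :: "real \<Rightarrow> real"
      by (rule continuous_on_compose2[OF that continuous_on_snd[OF continuous_on_id]]) auto
    show "continuous_on (UNIV \<times> cbox a b) (\<lambda>(s, \<theta>). (c \<theta> * d \<theta>) *\<^sub>R f' (k \<theta> + s * d \<theta>))"
      unfolding case_prod_beta
      by (auto intro!: continuous_intros continuous_on_compose2[OF f'] sub c k d)
  qed auto
  then show ?thesis by simp
qed

lemma smooth_affine_integral:
  fixes a b :: real
  assumes f: "smooth UNIV f" and c: "continuous_on {a..b} c" and k: "continuous_on {a..b} k"
    and d: "continuous_on {a..b} d"
  shows "smooth UNIV (\<lambda>s. integral {a..b} (\<lambda>\<theta>. c \<theta> *\<^sub>R f (k \<theta> + s * d \<theta>)))"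
proof (rule smooth_coinduct[where X = "\<lambda>h. \<exists>c f. smooth UNIV f \<and> continuous_on {a..b} c \<and>
    h = (\<lambda>s. integral {a..b} (\<lambda>\<theta>. c \<theta> *\<^sub>R f (k \<theta> + s * d \<theta>)))"])
  fix h assume "\<exists>c f. smooth UNIV f \<and> continuous_on {a..b} c \<and>
    h = (\<lambda>s. integral {a..b} (\<lambda>\<theta>. c \<theta> *\<^sub>R f (k \<theta> + s * d \<theta>)))"
  then obtain c f where f: "smooth UNIV f" "continuous_on {a..b} c"
    and h: "h = (\<lambda>s. integral {a..b} (\<lambda>\<theta>. c \<theta> *\<^sub>R f (k \<theta> + s * d \<theta>)))"
    by blast
  obtain f' where f': "\<forall>t\<in>UNIV. (f has_vector_derivative f' t) (at t)" "smooth UNIV f'"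
    using smooth_derivative_exists[OF f(1)] by blast
  have "(h has_vector_derivative
      integral {a..b} (\<lambda>\<theta>. (c \<theta> * d \<theta>) *\<^sub>R f' (k \<theta> + s * d \<theta>))) (at s)" for s
    unfolding h using f' f smooth_continuous_on k d
    by (intro has_vector_derivative_affine_integral) auto
  moreover have "continuous_on {a..b} (\<lambda>\<theta>. c \<theta> * d \<theta>)"
    using f d by (intro continuous_intros)
  ultimately show "\<exists>f'. (\<forall>t\<in>UNIV. (h has_vector_derivative f' t) (at t)) \<and>
     (\<exists>c f. smooth UNIV f \<and> continuous_on {a..b} c \<and>
       f' = (\<lambda>s. integral {a..b} (\<lambda>\<theta>. c \<theta> *\<^sub>R f (k \<theta> + s * d \<theta>))))"
    by (intro exI[of _ "\<lambda>s. integral {a..b} (\<lambda>\<theta>. (c \<theta> * d \<theta>) *\<^sub>R f' (k \<theta> + s * d \<theta>))"]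
        conjI exI[of _ f'] exI[of _ "\<lambda>\<theta>. c \<theta> * d \<theta>"] ballI f'(2) refl) auto
qed (use assms in auto)

text \<open>Along a basis vector the derivative of the restriction is the restriction of a partial
  derivative, which is again in every \<open>C_k\<close>. This makes the profile of a radial test
  function smooth.\<close>

lemma smooth_ray:
  fixes g :: "'a::euclidean_space \<Rightarrow> complex"
  assumes "\<And>k. C_k k g" "e \<in> Basis"
  shows "smooth UNIV (\<lambda>s. g (s *\<^sub>R e))"
proof (rule smooth_coinduct[where X = "\<lambda>h. \<exists>g. (\<forall>k. C_k k g) \<and> h = (\<lambda>s. g (s *\<^sub>R e))"])
  fix h assume "\<exists>g. (\<forall>k. C_k k g) \<and> h = (\<lambda>s. g (s *\<^sub>R e))"
  then obtain g :: "'a \<Rightarrow> complex" where g: "\<And>k. C_k k g" and h: "h = (\<lambda>s. g (s *\<^sub>R e))" by blast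
  have gd: "g differentiable (at x)" for x
    using g[of "Suc 0"] by simp
  have "(h has_vector_derivative partial_deriv e g (s *\<^sub>R e)) (at s)" for s
  proof -
    have "((\<lambda>s. s *\<^sub>R e) has_derivative (\<lambda>s. s *\<^sub>R e)) (at s)"
      by (auto intro!: derivative_eq_intros)
    from has_derivative_compose[OF this frechet_derivative_works[THEN iffD1, OF gd]]
    have "(h has_derivative (\<lambda>t. frechet_derivative g (at (s *\<^sub>R e)) (t *\<^sub>R e))) (at s)"
      by (simp add: h)
    then show ?thesis
      using linear_frechet_derivative[OF gd]
      by (simp add: has_vector_derivative_def partial_deriv_def linear_scale)
  qed
  moreover have "C_k k (partial_deriv e g)" for k
    using g[of "Suc k"] assms(2) by simp
  ultimately show "\<exists>f'. (\<forall>t\<in>UNIV. (h has_vector_derivative f' t) (at t)) \<and>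
      (\<exists>g. (\<forall>k. C_k k g) \<and> f' = (\<lambda>s. g (s *\<^sub>R e)))"
    by (intro exI[of _ "\<lambda>s. partial_deriv e g (s *\<^sub>R e)"]) auto
qed (use assms in auto)

section \<open>Radial functions\<close>

text \<open>Vanishing is imposed on the whole complement of an interval of positive radii, negative
  arguments included. A profile is therefore differentiable on the entire line, and its radial
  function is zero near the origin.\<close>

definition radial_profiles :: "(real \<Rightarrow> complex) set" where
  "radial_profiles = {\<psi>. smooth {0<..} \<psi> \<and> (\<exists>a>0. \<exists>b. \<forall>s. s \<notin> {a..b} \<longrightarrow> \<psi> s = 0)}"

lemma radial_profileE:
  assumes "\<psi> \<in> radial_profiles"
  obtains a b where "0 < a" "\<And>s. s \<notin> {a..b} \<Longrightarrow> \<psi> s = 0"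
  using assms by (auto simp: radial_profiles_def)

lemma radial_profile_has_vector_derivative:
  assumes \<psi>: "\<psi> \<in> radial_profiles"
  shows "(\<psi> has_vector_derivative vector_derivative \<psi> (at s)) (at s)"
    and "(\<lambda>s. vector_derivative \<psi> (at s)) \<in> radial_profiles"
proof -
  obtain a b where ab: "0 < a" "\<And>s. s \<notin> {a..b} \<Longrightarrow> \<psi> s = 0"
    using radial_profileE[OF \<psi>] by metis
  have out: "(\<psi> has_vector_derivative 0) (at s)" if "s \<notin> {a..b}" for s
  proof (rule has_vector_derivative_transform_within_open[of "\<lambda>_. 0" _ _ "- {a..b}"])
    show "0 = \<psi> t" if "t \<in> - {a..b}" for t
      using ab(2)[of t] that by simp
  qed (use that in \<open>auto simp: open_Compl\<close>)
  have sm: "smooth {0<..} \<psi>"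
    using \<psi> by (simp add: radial_profiles_def)
  show "(\<psi> has_vector_derivative vector_derivative \<psi> (at s)) (at s)"
  proof (cases "s \<in> {a..b}")
    case True
    then show ?thesis using ab(1) by (intro smooth_has_vector_derivative[OF sm]) auto
  next
    case False
    then show ?thesis using vector_derivative_at[OF out[OF False]] out by simp
  qed
  show "(\<lambda>s. vector_derivative \<psi> (at s)) \<in> radial_profiles"
    unfolding radial_profiles_def using smooth_vector_derivative[OF sm] ab(1) vector_derivative_at[OF out]
    by blast
qed

lemma radial_profile_mult:
  assumes "smooth {0<..} h" "\<psi> \<in> radial_profiles"
  shows "(\<lambda>s. h s * \<psi> s) \<in> radial_profiles"
proof -
  obtain a b where "0 < a" "\<And>s. s \<notin> {a..b} \<Longrightarrow> \<psi> s = 0"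
    using radial_profileE[OF assms(2)] by metis
  moreover have "smooth {0<..} (\<lambda>s. h s * \<psi> s)"
    using assms by (intro smooth_mult) (auto simp: radial_profiles_def)
  ultimately show ?thesis
    unfolding radial_profiles_def by fastforce
qed

text \<open>The operator \<open>(1/s) d/ds\<close>. The gradient of a radial function is
  \<open>x\<close> times the function with this profile, so coordinates times radial functions stay
  closed under differentiation.\<close>

definition radial_deriv :: "(real \<Rightarrow> complex) \<Rightarrow> real \<Rightarrow> complex" where
  "radial_deriv \<psi> s = complex_of_real (s powr (-1)) * vector_derivative \<psi> (at s)"

lemma radial_deriv_profile: "\<psi> \<in> radial_profiles \<Longrightarrow> radial_deriv \<psi> \<in> radial_profiles"
  unfolding radial_deriv_def[abs_def]
  by (intro radial_profile_mult smooth_powr radial_profile_has_vector_derivative(2))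

lemma has_derivative_radial:
  fixes x :: "'a::euclidean_space"
  assumes \<psi>: "\<psi> \<in> radial_profiles"
  shows "((\<lambda>x. \<psi> (norm x)) has_derivative (\<lambda>h. complex_of_real (x \<bullet> h) * radial_deriv \<psi> (norm x))) (at x)"
proof (cases "x = 0")
  case True
  obtain a b where ab: "0 < a" "\<And>s. s \<notin> {a..b} \<Longrightarrow> \<psi> s = 0"
    using radial_profileE[OF \<psi>] by metis
  have "((\<lambda>x. \<psi> (norm x)) has_derivative (\<lambda>h. 0)) (at x)"
  proof (rule has_derivative_transform_within_open[of "\<lambda>_. 0" _ _ _ "ball 0 a"])
    show "0 = \<psi> (norm y)" if "y \<in> ball 0 a" for y :: 'a
      using that ab(2)[of "norm y"] by simp
  qed (use True ab in auto)
  then show ?thesis using True by simp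
next
  case False
  have "((\<lambda>x. \<psi> (norm x)) has_derivative (\<lambda>h. (h \<bullet> sgn x) *\<^sub>R vector_derivative \<psi> (at (norm x)))) (at x)"
    using has_derivative_compose[OF has_derivative_norm[OF False]
        radial_profile_has_vector_derivative(1)[OF \<psi>, unfolded has_vector_derivative_def]]
    by simp
  moreover have "(h \<bullet> sgn x) *\<^sub>R vector_derivative \<psi> (at (norm x))
      = complex_of_real (x \<bullet> h) * radial_deriv \<psi> (norm x)" for h
    using False by (simp add: radial_deriv_def sgn_div_norm inner_commute powr_minus scaleR_conv_of_real)
  ultimately show ?thesis by simp
qed

lemma partial_deriv_eqI:
  assumes "\<And>x. (f has_derivative D x) (at x)"
  shows "partial_deriv e f = (\<lambda>x. D x e)"
  unfolding partial_deriv_def using frechet_derivative_at[OF assms] by (auto simp: fun_eq_iff)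

text \<open>Being closed under partial derivatives, this span consists of smooth functions.\<close>

inductive radial_span :: "('a::euclidean_space \<Rightarrow> complex) \<Rightarrow> bool" where
  base: "\<psi> \<in> radial_profiles \<Longrightarrow> radial_span (\<lambda>x. \<psi> (norm x))"
| mult: "radial_span f \<Longrightarrow> radial_span (\<lambda>x. complex_of_real (x \<bullet> e) * f x)"
| add: "radial_span f \<Longrightarrow> radial_span g \<Longrightarrow> radial_span (\<lambda>x. f x + g x)"

lemma radial_span_cmult: "radial_span f \<Longrightarrow> radial_span (\<lambda>x. c * f x)"
proof (induction rule: radial_span.induct)
  case (base \<psi>)
  then show ?case
    by (intro radial_span.base[OF radial_profile_mult[OF smooth_const]]) auto
next
  case (mult f e)
  show ?case using radial_span.mult[OF mult.IH, of e] by (simp add: mult_ac)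
next
  case (add f g)
  show ?case using radial_span.add[OF add.IH] by (simp add: distrib_left)
qed

lemma radial_span_partial:
  "radial_span f \<Longrightarrow> (\<forall>x. f differentiable (at x)) \<and> (\<forall>e. radial_span (partial_deriv e f))"
proof (induction rule: radial_span.induct)
  case (base \<psi>)
  have "radial_span (partial_deriv e (\<lambda>x::'a. \<psi> (norm x)))" for e
    unfolding partial_deriv_eqI[OF has_derivative_radial[OF base]]
    by (intro radial_span.mult radial_span.base radial_deriv_profile base)
  then show ?case
    using has_derivative_radial[OF base] by (auto simp: differentiable_def)
next
  case (mult f e)
  then have f: "(f has_derivative frechet_derivative f (at x)) (at x)" for x
    by (simp add: frechet_derivative_works)
  have d: "((\<lambda>x. complex_of_real (x \<bullet> e) * f x) has_derivative
      (\<lambda>h. complex_of_real (x \<bullet> e) * frechet_derivative f (at x) h + complex_of_real (h \<bullet> e) * f x)) (at x)" for x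
    by (auto intro!: derivative_eq_intros f)
  have "radial_span (partial_deriv b (\<lambda>x. complex_of_real (x \<bullet> e) * f x))" for b
    unfolding partial_deriv_eqI[OF d] using mult
    by (intro radial_span.add radial_span_cmult radial_span.mult)
       (auto simp flip: partial_deriv_def)
  with d show ?case by (auto simp: differentiable_def)
next
  case (add f g)
  then have fg: "(f has_derivative frechet_derivative f (at x)) (at x)"
    "(g has_derivative frechet_derivative g (at x)) (at x)" for x
    by (simp_all add: frechet_derivative_works)
  have d: "((\<lambda>x. f x + g x) has_derivative
      (\<lambda>h. frechet_derivative f (at x) h + frechet_derivative g (at x) h)) (at x)" for x
    by (auto intro!: derivative_eq_intros fg)
  have "radial_span (partial_deriv b (\<lambda>x. f x + g x))" for b
    unfolding partial_deriv_eqI[OF d] using add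
    by (intro radial_span.add) (auto simp flip: partial_deriv_def)
  with d show ?case by (auto simp: differentiable_def)
qed

lemma radial_span_C_k: "radial_span f \<Longrightarrow> C_k k f"
proof (induction k arbitrary: f)
  case 0
  then show ?case
    using radial_span_partial[of f] by (auto intro!: continuous_at_imp_continuous_on differentiable_imp_continuous_within)
next
  case (Suc k)
  then show ?case using radial_span_partial[of f] by simp
qed

lemma radial_test_function:
  assumes \<psi>: "\<psi> \<in> radial_profiles"
  shows "(\<lambda>x::'a::euclidean_space. \<psi> (norm x)) \<in> test_functions (UNIV - {0})"
proof -
  obtain a b where ab: "0 < a" "\<And>s. s \<notin> {a..b} \<Longrightarrow> \<psi> s = 0"
    using radial_profileE[OF \<psi>] by metis
  let ?X = "{x::'a. \<psi> (norm x) \<noteq> 0}"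
  have sub: "?X \<subseteq> {x. a \<le> norm x} \<inter> cball 0 b"
    using ab by fastforce
  have cl: "closed ({x::'a. a \<le> norm x} \<inter> cball 0 b)"
    by (intro closed_Int closed_Collect_le continuous_intros closed_cball)
  have "closure ?X \<subseteq> {x. a \<le> norm x} \<inter> cball 0 b"
    by (rule closure_minimal[OF sub cl])
  moreover have "compact (closure ?X)"
    using bounded_subset[OF bounded_cball[of 0 b], of ?X] sub by (auto simp: compact_closure)
  ultimately show ?thesis
    unfolding test_functions_def using radial_span_C_k[OF radial_span.base[OF \<psi>]] ab(1) by auto
qed

section \<open>The radial Laplacian and the passage to the plane\<close>

text \<open>Each second partial derivative is \<open>radial_deriv \<psi>\<close> plus a squared
  coordinate times the iterated operator, and the squared coordinates sum to the squared norm. In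
  this form no division by the norm appears outside the profile.\<close>

lemma laplacian_radial:
  fixes x :: "'a::euclidean_space"
  assumes \<psi>: "\<psi> \<in> radial_profiles"
  shows "laplacian (\<lambda>x. \<psi> (norm x)) x = of_nat DIM('a) * radial_deriv \<psi> (norm x) +
     complex_of_real ((norm x)\<^sup>2) * radial_deriv (radial_deriv \<psi>) (norm x)"
proof -
  have d: "((\<lambda>x. complex_of_real (x \<bullet> e) * radial_deriv \<psi> (norm x)) has_derivative
      (\<lambda>h. complex_of_real (x \<bullet> e) * (complex_of_real (x \<bullet> h) * radial_deriv (radial_deriv \<psi>) (norm x)) +
           complex_of_real (h \<bullet> e) * radial_deriv \<psi> (norm x))) (at x)" for x e :: 'a
    by (auto intro!: derivative_eq_intros has_derivative_radial radial_deriv_profile \<psi>)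
  have "laplacian (\<lambda>x. \<psi> (norm x)) x = (\<Sum>e\<in>Basis. complex_of_real (x \<bullet> e) *
      (complex_of_real (x \<bullet> e) * radial_deriv (radial_deriv \<psi>) (norm x)) + radial_deriv \<psi> (norm x))"
    unfolding laplacian_def partial_deriv_eqI[OF has_derivative_radial[OF \<psi>]] partial_deriv_eqI[OF d]
    by (intro sum.cong) (auto simp: inner_same_Basis)
  also have "\<dots> = of_nat DIM('a) * radial_deriv \<psi> (norm x) +
      (\<Sum>e\<in>Basis. complex_of_real (x \<bullet> e * (x \<bullet> e))) * radial_deriv (radial_deriv \<psi>) (norm x)"
    by (simp add: sum.distrib sum_distrib_right mult.assoc)
  also have "(\<Sum>e\<in>Basis. complex_of_real (x \<bullet> e * (x \<bullet> e))) = complex_of_real ((norm x)\<^sup>2)"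
    unfolding power2_norm_eq_inner by (subst (3) euclidean_inner) simp
  finally show ?thesis .
qed

text \<open>
  Conjugation with \<open>|x|\<^bsup>-(N-2)/2\<^esup>\<close>, the radial ground state of the critical Hardy operator,
  turns its radial part into the two-dimensional radial Laplacian.
\<close>

definition hardy_lift :: "(real \<Rightarrow> complex) \<Rightarrow> 'a::euclidean_space \<Rightarrow> complex" where
  "hardy_lift \<phi> x = complex_of_real (norm x powr (- ((real DIM('a) - 2) / 2))) * \<phi> (norm x)"

lemma hardy_lift_profile:
  "\<phi> \<in> radial_profiles \<Longrightarrow> (\<lambda>s. complex_of_real (s powr a) * \<phi> s) \<in> radial_profiles"
  by (intro radial_profile_mult smooth_powr)

lemma hardy_lift_test_function:
  "\<phi> \<in> radial_profiles \<Longrightarrow> (hardy_lift \<phi> :: 'a::euclidean_space \<Rightarrow> complex) \<in> test_functions (UNIV - {0})"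
  unfolding hardy_lift_def[abs_def] by (intro radial_test_function hardy_lift_profile)

text \<open>With \<open>m = (N - 2) / 2\<close> the product rule gives the first-order coefficient
  \<open>(N - 1 - 2 m) / r = 1 / r\<close>, while minus the Laplacian has the zero-order coefficient
  \<open>m^2 / r^2\<close>, which the potential cancels. Criticality of the coupling constant is
  exactly this cancellation.\<close>

lemma hardy_op_lift:
  fixes x :: "'a::euclidean_space"
  assumes \<phi>: "\<phi> \<in> radial_profiles"
    and d1: "\<And>s. (\<phi> has_vector_derivative \<phi>' s) (at s)"
    and d2: "\<And>s. (\<phi>' has_vector_derivative \<phi>'' s) (at s)"
  shows "hardy_op (- ((real DIM('a) - 2) / 2)\<^sup>2) (hardy_lift \<phi>) x =
     hardy_lift (\<lambda>s. - \<phi>'' s - \<phi>' s / complex_of_real s) x"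
proof (cases "x = 0")
  \<comment> \<open>At the origin \<open>0 powr a = 0\<close> annihilates both lifts, and the
    Laplacian vanishes because \<open>radial_deriv\<close> of a profile is again a profile.\<close>
  case True
  have z: "\<psi> 0 = 0" if "\<psi> \<in> radial_profiles" for \<psi>
    using radial_profileE[OF that] by (metis atLeastAtMost_iff not_less)
  have p: "(\<lambda>s. complex_of_real (s powr (- ((real DIM('a) - 2) / 2))) * \<phi> s) \<in> radial_profiles"
    by (rule hardy_lift_profile[OF \<phi>])
  show ?thesis
    using True z[OF radial_deriv_profile[OF p]]
    by (simp add: hardy_op_def hardy_lift_def[abs_def] laplacian_radial[OF p])
next
  case False
  define m where "m = (real DIM('a) - 2) / 2"
  define r where "r = norm x"
  have r: "r > 0" using False by (simp add: r_def)
  define \<psi> where "\<psi> = (\<lambda>s. complex_of_real (s powr (- m)) * \<phi> s)"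
  have p: "\<psi> \<in> radial_profiles"
    unfolding \<psi>_def by (rule hardy_lift_profile[OF \<phi>])
  have pw: "((\<lambda>s. complex_of_real (s powr a)) has_vector_derivative complex_of_real (a * s powr (a - 1))) (at s)"
    if "s > 0" for s a
  proof -
    have "((\<lambda>s. s powr a) has_vector_derivative a * s powr (a - 1)) (at s)"
      using that by (auto intro!: derivative_eq_intros simp flip: has_real_derivative_iff_has_vector_derivative)
    then show ?thesis by (rule bounded_linear.has_vector_derivative[OF bounded_linear_of_real])
  qed
  have R1: "radial_deriv \<psi> s = complex_of_real (s powr (- m - 1)) * \<phi>' s
      + complex_of_real (- m * s powr (- m - 2)) * \<phi> s" if "s > 0" for s
  proof -
    have "(\<psi> has_vector_derivative complex_of_real (s powr (- m)) * \<phi>' s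
        + complex_of_real (- m * s powr (- m - 1)) * \<phi> s) (at s)"
      unfolding \<psi>_def by (rule has_vector_derivative_mult[OF pw[OF that] d1])
    from vector_derivative_at[OF this]
    have vd: "vector_derivative \<psi> (at s) = complex_of_real (s powr (- m)) * \<phi>' s
        + complex_of_real (- m * s powr (- m - 1)) * \<phi> s" .
    have e: "s powr (- m - 1) = s powr (- m) / s" "s powr (- m - 2) = s powr (- m) / s\<^sup>2"
        "s powr (-1) = 1 / s"
      using that by (simp_all add: powr_diff powr_numeral powr_minus_divide)
    show ?thesis
      unfolding radial_deriv_def vd e using that by (simp add: field_simps power2_eq_square)
  qed
  \<comment> \<open>One of the two factors \<open>r\<close> in front of the iterated operator is
    spent on the outer \<open>r powr (-1)\<close>, which leaves a plain derivative of
    \<open>radial_deriv \<psi>\<close>.\<close>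
  have R2: "complex_of_real r * radial_deriv (radial_deriv \<psi>) r =
      complex_of_real (r powr (- m - 1)) * \<phi>'' r + complex_of_real ((- m - 1) * r powr (- m - 2)) * \<phi>' r
      + (complex_of_real (- m * r powr (- m - 2)) * \<phi>' r
         + complex_of_real (- m * ((- m - 2) * r powr (- m - 3))) * \<phi> r)"
  proof -
    have "((\<lambda>s. complex_of_real (s powr (- m - 1)) * \<phi>' s
        + complex_of_real (- m) * complex_of_real (s powr (- m - 2)) * \<phi> s) has_vector_derivative
      complex_of_real (r powr (- m - 1)) * \<phi>'' r + complex_of_real ((- m - 1) * r powr (- m - 1 - 1)) * \<phi>' r
      + (complex_of_real (- m) * complex_of_real (r powr (- m - 2)) * \<phi>' r
         + complex_of_real (- m) * complex_of_real ((- m - 2) * r powr (- m - 2 - 1)) * \<phi> r)) (at r)"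
      by (intro has_vector_derivative_add has_vector_derivative_mult has_vector_derivative_mult_right pw r d1 d2)
    then have "(radial_deriv \<psi> has_vector_derivative
      complex_of_real (r powr (- m - 1)) * \<phi>'' r + complex_of_real ((- m - 1) * r powr (- m - 1 - 1)) * \<phi>' r
      + (complex_of_real (- m) * complex_of_real (r powr (- m - 2)) * \<phi>' r
         + complex_of_real (- m) * complex_of_real ((- m - 2) * r powr (- m - 2 - 1)) * \<phi> r)) (at r)"
      by (rule has_vector_derivative_transform_within_open[of _ _ _ "{0<..}"]) (use r R1 in auto)
    from vector_derivative_at[OF this]
    have vd: "vector_derivative (radial_deriv \<psi>) (at r) =
      complex_of_real (r powr (- m - 1)) * \<phi>'' r + complex_of_real ((- m - 1) * r powr (- m - 2)) * \<phi>' r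
      + (complex_of_real (- m) * complex_of_real (r powr (- m - 2)) * \<phi>' r
         + complex_of_real (- m) * complex_of_real ((- m - 2) * r powr (- m - 3)) * \<phi> r)"
      by (simp only: diff_diff_eq one_add_one) simp
    have "complex_of_real r * complex_of_real (r powr (-1)) = 1"
      using r by (simp add: powr_minus)
    then have c: "complex_of_real r * (complex_of_real (r powr (-1)) * z) = z" for z
      by (metis mult.assoc mult_1)
    show ?thesis
      unfolding radial_deriv_def[of "radial_deriv \<psi>"] vd c by (simp add: mult.assoc)
  qed
  have \<psi>r: "\<psi> r = complex_of_real (r powr (- m)) * \<phi> r"
    by (simp add: \<psi>_def)
  have N: "of_nat DIM('a) = complex_of_real (2 * m + 2)"
    by (simp add: m_def diff_divide_distrib)
  have e: "r powr (- m - 1) = r powr (- m) / r" "r powr (- m - 2) = r powr (- m) / r\<^sup>2"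
      "r powr (- m - 3) = r powr (- m) / r ^ 3"
    using r by (simp_all add: powr_diff powr_numeral)
  have "hardy_op (- m\<^sup>2) (hardy_lift \<phi>) x = - (of_nat DIM('a) * radial_deriv \<psi> r +
     complex_of_real r * (complex_of_real r * radial_deriv (radial_deriv \<psi>) r)) - complex_of_real (m\<^sup>2 / r\<^sup>2) * \<psi> r"
    using laplacian_radial[OF p, of x]
    by (simp add: hardy_op_def hardy_lift_def[abs_def] \<psi>_def m_def r_def power2_eq_square mult.assoc)
  also have "\<dots> = complex_of_real (r powr (- m)) * (- \<phi>'' r - \<phi>' r / complex_of_real r)"
    unfolding R2 R1[OF r] N \<psi>r e using r by (simp add: field_simps power2_eq_square power3_eq_cube)
  finally show ?thesis
    by (simp add: hardy_lift_def m_def r_def)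
qed

section \<open>The quadratic form of the critical Hardy operator\<close>

lemma continuous_compact_support_integrable:
  fixes f :: "'a::euclidean_space \<Rightarrow> complex"
  assumes f: "continuous_on UNIV f" and K: "compact K" and supp: "\<And>x. x \<notin> K \<Longrightarrow> f x = 0"
  shows "integrable lborel f"
proof -
  have "integrable lborel (\<lambda>x. indicator K x *\<^sub>R f x)"
    using K by (intro borel_integrable_compact continuous_on_subset[OF f]) auto
  moreover have "(\<lambda>x. indicator K x *\<^sub>R f x) = f"
    using supp by (auto simp: fun_eq_iff indicator_def)
  ultimately show ?thesis by simp
qed

lemma continuous_compact_support_bounded:
  fixes f :: "'a::euclidean_space \<Rightarrow> complex"
  assumes f: "continuous_on UNIV f" and K: "compact K" and supp: "\<And>x. x \<notin> K \<Longrightarrow> f x = 0"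
  obtains B where "0 \<le> B" "\<And>x. cmod (f x) \<le> B"
proof -
  have "bounded (f ` K)"
    using compact_continuous_image[OF continuous_on_subset[OF f] K] compact_imp_bounded by auto
  then obtain B where B: "\<forall>y\<in>f ` K. norm y \<le> B" "0 < B"
    by (meson bounded_pos)
  have "cmod (f x) \<le> B" for x
    using B supp[of x] by (cases "x \<in> K") auto
  with B(2) show thesis using that[of B] by simp
qed

text \<open>Difference quotients of \<open>F\<close> have integral zero by translation invariance of
  Lebesgue measure, and they converge to the directional derivative under a common bound with
  compact support. Integration by parts is thus obtained without iterated integrals.\<close>

lemma integral_directional_derivative_eq_0:
  fixes F :: "'a::euclidean_space \<Rightarrow> complex"
  assumes d: "\<And>x. (F has_derivative D x) (at x)"
    and cont: "continuous_on UNIV (\<lambda>x. D x e)"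
    and K: "compact K" and supp: "\<And>x. x \<notin> K \<Longrightarrow> F x = 0"
  shows "integrable lborel (\<lambda>x. D x e)" "(LINT x|lborel. D x e) = 0"
proof -
  have out: "D x e = 0" if "x \<notin> K" for x
  proof -
    have "(F has_derivative (\<lambda>_. 0)) (at x)"
      by (rule has_derivative_transform_within_open[of "\<lambda>_. 0" _ _ _ "- K"])
         (use that supp K in \<open>auto simp: open_Compl compact_imp_closed\<close>)
    then show ?thesis
      using has_derivative_unique[OF d] by metis
  qed
  show "integrable lborel (\<lambda>x. D x e)"
    by (rule continuous_compact_support_integrable[OF cont K out])
  obtain B where B: "0 \<le> B" "\<And>x. cmod (D x e) \<le> B"
    by (rule continuous_compact_support_bounded[OF cont K out]) auto
  have Fc: "continuous_on UNIV F"
    using d has_derivative_continuous by (blast intro: continuous_at_imp_continuous_on)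
  have Fi: "integrable lborel F"
    by (rule continuous_compact_support_integrable[OF Fc K supp])
  have line: "((\<lambda>s. F (x + s *\<^sub>R e)) has_derivative (\<lambda>t. t *\<^sub>R D (x + s *\<^sub>R e) e)) (at s within S)" for x s S
  proof -
    have "((\<lambda>s. x + s *\<^sub>R e) has_derivative (\<lambda>s. s *\<^sub>R e)) (at s within S)"
      by (auto intro!: derivative_eq_intros)
    from has_derivative_compose[OF this d]
    have "((\<lambda>s. F (x + s *\<^sub>R e)) has_derivative (\<lambda>t. D (x + s *\<^sub>R e) (t *\<^sub>R e))) (at s within S)" .
    then show ?thesis
      using has_derivative_linear[OF d] by (simp add: linear_scale)
  qed
  have bound: "cmod (F (x + s *\<^sub>R e) - F x) \<le> B * \<bar>s\<bar>" for x s
  proof -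
    have on: "onorm (\<lambda>t::real. t *\<^sub>R D (x + u *\<^sub>R e) e) \<le> B" for u
      using B onorm_scaleR_left[OF bounded_linear_ident, of "D (x + u *\<^sub>R e) e"] by (simp add: onorm_id)
    have "norm ((\<lambda>s. F (x + s *\<^sub>R e)) s - (\<lambda>s. F (x + s *\<^sub>R e)) 0) \<le> B * norm (s - 0)"
      by (rule differentiable_bound[of UNIV, OF convex_UNIV line on]) auto
    then show ?thesis by simp
  qed
  define t where "t n = inverse (real (Suc n))" for n
  have t: "t n > 0" "t n \<le> 1" for n by (simp_all add: t_def inverse_le_1_iff)
  \<comment> \<open>The union of the translates of \<open>K\<close> by \<open>- s e\<close> with
    \<open>0 \<le> s \<le> 1\<close>. It contains the support of every difference quotient, since
    all steps \<open>t n\<close> are at most 1.\<close>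
  define K' where "K' = (\<lambda>(x, s). x - s *\<^sub>R e) ` (K \<times> {0..1})"
  have K': "compact K'"
    unfolding K'_def by (intro compact_continuous_image compact_Times K)
      (auto simp: case_prod_beta intro!: continuous_intros)
  have inK': "x \<in> K'" if "F (x + s *\<^sub>R e) \<noteq> 0 \<or> F x \<noteq> 0" "0 \<le> s" "s \<le> 1" for x s
  proof -
    have "x + s *\<^sub>R e \<in> K \<or> x \<in> K"
      using that(1) supp by blast
    then show ?thesis
    proof
      assume "x + s *\<^sub>R e \<in> K"
      then show ?thesis
        unfolding K'_def using that by (intro image_eqI[of _ _ "(x + s *\<^sub>R e, s)"]) auto
    next
      assume "x \<in> K"
      then show ?thesis
        unfolding K'_def by (intro image_eqI[of _ _ "(x, 0)"]) auto
    qed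
  qed
  have shift: "(LINT x|lborel. F (x + c)) = (LINT x|lborel. F x)" "integrable lborel (\<lambda>x. F (x + c))" for c
  proof -
    have F: "F \<in> borel_measurable borel"
      by (rule borel_measurable_continuous_onI[OF Fc])
    have "(LINT x|lborel. F x) = (LINT x|distr lborel borel ((+) c). F x)"
      by (simp add: lborel_distr_plus)
    also have "\<dots> = (LINT x|lborel. F (c + x))"
      by (intro integral_distr F) auto
    finally show "(LINT x|lborel. F (x + c)) = (LINT x|lborel. F x)"
      by (simp add: add.commute)
    have "integrable (distr lborel borel ((+) c)) F"
      using Fi by (simp add: lborel_distr_plus)
    then have "integrable lborel (\<lambda>x. F (c + x))"
      by (subst (asm) integrable_distr_eq) (use F in auto)
    then show "integrable lborel (\<lambda>x. F (x + c))"
      by (simp add: add.commute)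
  qed
  have zero: "(LINT x|lborel. (F (x + t n *\<^sub>R e) - F x) / complex_of_real (t n)) = 0" for n
    using shift[of "t n *\<^sub>R e"] Fi by simp
  have "(\<lambda>n. LINT x|lborel. (F (x + t n *\<^sub>R e) - F x) / complex_of_real (t n)) \<longlonglongrightarrow> (LINT x|lborel. D x e)"
  proof (rule integral_dominated_convergence)
    have [measurable]: "F \<in> borel_measurable lborel"
      using borel_measurable_continuous_onI[OF Fc] by simp
    show "(\<lambda>x. (F (x + t n *\<^sub>R e) - F x) / complex_of_real (t n)) \<in> borel_measurable lborel" for n
      by (intro borel_measurable_divide borel_measurable_diff borel_measurable_const
          borel_measurable_integrable shift Fi)
    show "(\<lambda>x. D x e) \<in> borel_measurable lborel"
      using borel_measurable_continuous_onI[OF cont] by simp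
    show "integrable lborel (\<lambda>x. indicator K' x *\<^sub>R B)"
      using K' by (intro borel_integrable_compact) auto
    show "AE x in lborel. (\<lambda>n. (F (x + t n *\<^sub>R e) - F x) / complex_of_real (t n)) \<longlonglongrightarrow> D x e"
    proof (rule AE_I2)
      fix x
      have "(\<lambda>h. norm (F (x + (0 + h) *\<^sub>R e) - F (x + 0 *\<^sub>R e) - h *\<^sub>R D (x + 0 *\<^sub>R e) e) / norm h) \<midarrow>0\<rightarrow> 0"
        using line[of x 0 UNIV] unfolding has_derivative_at by blast
      moreover have "filterlim t (at 0) sequentially"
        unfolding filterlim_at using t(1) LIMSEQ_inverse_real_of_nat
        by (simp add: t_def[abs_def])
      ultimately have lim: "(\<lambda>n. norm (F (x + (0 + t n) *\<^sub>R e) - F (x + 0 *\<^sub>R e) - t n *\<^sub>R D (x + 0 *\<^sub>R e) e) / norm (t n)) \<longlonglongrightarrow> 0"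
        by (rule filterlim_compose)
      have eq: "norm (F (x + (0 + t n) *\<^sub>R e) - F (x + 0 *\<^sub>R e) - t n *\<^sub>R D (x + 0 *\<^sub>R e) e) / norm (t n)
          = norm ((F (x + t n *\<^sub>R e) - F x) / complex_of_real (t n) - D x e)" for n
      proof -
        have "(F (x + t n *\<^sub>R e) - F x) / complex_of_real (t n) - D x e
            = (F (x + t n *\<^sub>R e) - F x - t n *\<^sub>R D x e) / complex_of_real (t n)"
          using t(1)[of n] by (simp add: field_simps scaleR_conv_of_real)
        then show ?thesis
          by (simp add: norm_divide)
      qed
      from lim show "(\<lambda>n. (F (x + t n *\<^sub>R e) - F x) / complex_of_real (t n)) \<longlonglongrightarrow> D x e"
        unfolding eq by (simp only: tendsto_norm_zero_iff LIM_zero_iff)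
    qed
    show "AE x in lborel. norm ((F (x + t n *\<^sub>R e) - F x) / complex_of_real (t n)) \<le> indicator K' x *\<^sub>R B" for n
    proof (rule AE_I2)
      fix x
      show "norm ((F (x + t n *\<^sub>R e) - F x) / complex_of_real (t n)) \<le> indicator K' x *\<^sub>R B"
      proof (cases "x \<in> K'")
        case True
        then show ?thesis
          using bound[of x "t n"] t[of n] by (simp add: norm_divide pos_divide_le_eq)
      next
        case False
        then have "F (x + t n *\<^sub>R e) = 0" "F x = 0"
          using inK'[of x "t n"] t[of n] by auto
        then show ?thesis using False by simp
      qed
    qed
  qed
  then show "(LINT x|lborel. D x e) = 0"
    unfolding zero by (simp add: LIMSEQ_const_iff)
qed

lemma test_functionE:
  assumes "f \<in> test_functions (UNIV - {0})"
  obtains "\<And>k. C_k k f" "compact (closure {x. f x \<noteq> 0})" "0 \<notin> closure {x. f x \<noteq> 0}"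
    "\<And>x. x \<notin> closure {x. f x \<noteq> 0} \<Longrightarrow> f x = 0"
  using assms closure_subset[of "{x. f x \<noteq> 0}"] unfolding test_functions_def by blast

lemma test_functionD:
  assumes "f \<in> test_functions (UNIV - {0})"
  shows "compact (closure {x. f x \<noteq> 0})" "0 \<notin> closure {x. f x \<noteq> 0}"
    "x \<notin> closure {x. f x \<noteq> 0} \<Longrightarrow> f x = 0"
  using test_functionE[OF assms] by metis+

section \<open>The ground state representation of the form\<close>

text \<open>With \<open>m = (N - 2) / 2\<close> this is \<open>|x|^(-m)\<close> times the partial
  derivative of \<open>|x|^m f\<close>, the gradient as it appears after the ground state
  substitution.\<close>

definition hardy_grad :: "'a::euclidean_space \<Rightarrow> ('a \<Rightarrow> complex) \<Rightarrow> 'a \<Rightarrow> complex" where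
  "hardy_grad e f x = partial_deriv e f x +
     complex_of_real ((real DIM('a) - 2) / 2 * (x \<bullet> e) / (norm x)\<^sup>2) * f x"

lemma continuous_on_vanishing_near_0:
  fixes f :: "'a::euclidean_space \<Rightarrow> complex"
  assumes "continuous_on (UNIV - {0}) f" "closed K" "0 \<notin> K" "\<And>x. x \<notin> K \<Longrightarrow> f x = 0"
  shows "continuous_on UNIV f"
proof -
  have c2: "continuous_on (- K) f"
    by (rule continuous_on_eq[of _ "\<lambda>_. 0"]) (use assms in auto)
  have "UNIV = (UNIV - {0}) \<union> - K"
    using assms(3) by auto
  then show ?thesis
    using continuous_on_open_Un[OF open_delete[OF open_UNIV] open_Compl[OF assms(2)] assms(1) c2] by simp
qed

lemma test_function_partial_deriv:
  assumes f: "f \<in> test_functions (UNIV - {0})" and e: "e \<in> Basis"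
  shows "(f has_derivative frechet_derivative f (at x)) (at x)"
    "(partial_deriv e f has_derivative frechet_derivative (partial_deriv e f) (at x)) (at x)"
    "continuous_on UNIV f" "continuous_on UNIV (partial_deriv e f)"
    "continuous_on UNIV (partial_deriv e (partial_deriv e f))"
    "x \<notin> closure {x. f x \<noteq> 0} \<Longrightarrow> partial_deriv e f x = 0"
proof -
  from f obtain C: "\<And>k. C_k k f" and supp: "\<And>x. x \<notin> closure {x. f x \<noteq> 0} \<Longrightarrow> f x = 0"
    by (rule test_functionE) blast
  show "(f has_derivative frechet_derivative f (at x)) (at x)"
    "(partial_deriv e f has_derivative frechet_derivative (partial_deriv e f) (at x)) (at x)"
    using C[of "Suc (Suc 0)"] e by (auto simp flip: frechet_derivative_works)
  show "continuous_on UNIV f" "continuous_on UNIV (partial_deriv e f)"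
    "continuous_on UNIV (partial_deriv e (partial_deriv e f))"
    using C[of 0] C[of "Suc 0"] C[of "Suc (Suc 0)"] e by auto
  show "partial_deriv e f x = 0" if "x \<notin> closure {x. f x \<noteq> 0}"
  proof (rule partial_deriv_eq_0)
    show "open (- closure {x. f x \<noteq> 0})" by (simp add: open_Compl)
    show "x \<in> - closure {x. f x \<noteq> 0}" using that by blast
    show "f y = 0" if "y \<in> - closure {x. f x \<noteq> 0}" for y
      using that by (intro supp) blast
  qed
qed

lemma hardy_grad_square_integrable:
  fixes f :: "'a::euclidean_space \<Rightarrow> complex"
  assumes f: "f \<in> test_functions (UNIV - {0})" and e: "e \<in> Basis"
  shows "square_integrable (hardy_grad e f)"
proof -
  from f obtain K: "compact (closure {x. f x \<noteq> 0})" "0 \<notin> closure {x. f x \<noteq> 0}"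
    and supp: "\<And>x. x \<notin> closure {x. f x \<noteq> 0} \<Longrightarrow> f x = 0"
    by (rule test_functionE) blast
  have out: "hardy_grad e f x = 0" if "x \<notin> closure {x. f x \<noteq> 0}" for x
    using supp[OF that] test_function_partial_deriv(6)[OF f e that] by (simp add: hardy_grad_def)
  have "continuous_on (UNIV - {0}) (hardy_grad e f)"
    unfolding hardy_grad_def
    by (intro continuous_intros continuous_on_subset[OF test_function_partial_deriv(4)[OF f e]]
        continuous_on_subset[OF test_function_partial_deriv(3)[OF f e]]) auto
  then have "continuous_on UNIV (hardy_grad e f)"
    by (rule continuous_on_vanishing_near_0[OF _ closed_closure K(2) out])
  then show ?thesis
    by (rule continuous_compact_support_square_integrable[OF _ K(1) out])
qed

text \<open>The two integrands differ by the divergence of the field with components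
  \<open>F e\<close>, that is \<open>hardy_grad e f\<close> times the conjugate of \<open>h\<close>,
  and its integral vanishes because \<open>f\<close> is supported away from the origin. For
  \<open>h = f\<close> this displays the form as a sum of squares, hence the Hardy
  inequality.\<close>

lemma hardy_op_form:
  fixes f h :: "'a::euclidean_space \<Rightarrow> complex"
  assumes f: "f \<in> test_functions (UNIV - {0})" and h: "h \<in> test_functions (UNIV - {0})"
  shows "(LINT x|lborel. hardy_op (- ((real DIM('a) - 2) / 2)\<^sup>2) f x * cnj (h x)) =
     (\<Sum>e\<in>Basis. LINT x|lborel. hardy_grad e f x * cnj (hardy_grad e h x))"
proof -
  define m where "m = (real DIM('a) - 2) / 2"
  define K where "K = closure {x. f x \<noteq> 0}"
  note K = test_functionD(1,2)[OF f, folded K_def] and supp = test_functionD(3)[OF f, folded K_def]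
  define F where "F e x = partial_deriv e f x * cnj (h x)
      + complex_of_real (m * (x \<bullet> e) / (norm x)\<^sup>2) * (f x * cnj (h x))" for e x
  define D where "D e x v =
      (partial_deriv e f x * cnj (frechet_derivative h (at x) v)
        + frechet_derivative (partial_deriv e f) (at x) v * cnj (h x))
      + (complex_of_real (m * (x \<bullet> e) / (norm x)\<^sup>2) *
          (f x * cnj (frechet_derivative h (at x) v) + frechet_derivative f (at x) v * cnj (h x))
        + complex_of_real (m * (v \<bullet> e) / (norm x)\<^sup>2 - m * (x \<bullet> e) * (2 * (x \<bullet> v)) / ((norm x)\<^sup>2)\<^sup>2)
          * (f x * cnj (h x)))" for e x v
  note fd = test_function_partial_deriv[OF f, folded K_def] and hd = test_function_partial_deriv[OF h]
  have dF: "(F e has_derivative D e x) (at x)" if e: "e \<in> Basis" for e x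
  proof (cases "x = 0")
    case True
    have z: "frechet_derivative f (at x) v = 0" "frechet_derivative (partial_deriv e f) (at x) v = 0" for v
    proof -
      have "(f has_derivative (\<lambda>_. 0)) (at x)" "(partial_deriv e f has_derivative (\<lambda>_. 0)) (at x)"
        by (rule has_derivative_transform_within_open[of "\<lambda>_. 0" _ _ _ "- K"];
            use True supp K fd(6)[OF e] in \<open>auto simp: open_Compl compact_imp_closed\<close>)+
      then show "frechet_derivative f (at x) v = 0" "frechet_derivative (partial_deriv e f) (at x) v = 0"
        by (metis frechet_derivative_at)+
    qed
    have "(F e has_derivative (\<lambda>_. 0)) (at x)"
      by (rule has_derivative_transform_within_open[of "\<lambda>_. 0" _ _ _ "- K"])
         (use True supp K fd(6)[OF e] in \<open>auto simp: open_Compl compact_imp_closed F_def\<close>)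
    moreover have "D e x = (\<lambda>_. 0)"
      using z True supp[of x] K fd(6)[OF e, of x] by (auto simp: D_def fun_eq_iff)
    ultimately show ?thesis by simp
  next
    case False
    have n: "((\<lambda>x. (norm x)\<^sup>2) has_derivative (\<lambda>v. 2 * (x \<bullet> v))) (at x)"
      unfolding power2_norm_eq_inner by (auto intro!: derivative_eq_intros simp: inner_commute)
    have q: "((\<lambda>x. m * (x \<bullet> e) / (norm x)\<^sup>2) has_derivative
        (\<lambda>v. m * (v \<bullet> e) / (norm x)\<^sup>2 - m * (x \<bullet> e) * (2 * (x \<bullet> v)) / ((norm x)\<^sup>2)\<^sup>2)) (at x)"
      by (rule has_derivative_eq_rhs[OF has_derivative_divide'[OF _ n]])
         (use False in \<open>auto intro!: derivative_eq_intros simp: field_simps power2_eq_square\<close>)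
    have hc: "((\<lambda>x. cnj (h x)) has_derivative (\<lambda>v. cnj (frechet_derivative h (at x) v))) (at x)"
      by (rule bounded_linear.has_derivative[OF bounded_linear_cnj hd(1)[OF e]])
    show ?thesis
      unfolding F_def[abs_def] D_def
      by (intro has_derivative_add has_derivative_mult has_derivative_of_real q hc fd(1,2)[OF e])
  qed
  have De: "D e x e = (partial_deriv e f x * cnj (partial_deriv e h x)
        + partial_deriv e (partial_deriv e f) x * cnj (h x))
      + (complex_of_real (m * (x \<bullet> e) / (norm x)\<^sup>2) *
          (f x * cnj (partial_deriv e h x) + partial_deriv e f x * cnj (h x))
        + complex_of_real (m / (norm x)\<^sup>2 - m * (x \<bullet> e) * (2 * (x \<bullet> e)) / ((norm x)\<^sup>2)\<^sup>2)
          * (f x * cnj (h x)))" if "e \<in> Basis" for e x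
    using that by (simp add: D_def partial_deriv_def inner_same_Basis)
  have cD: "continuous_on UNIV (\<lambda>x. D e x e)" if e: "e \<in> Basis" for e
  proof (rule continuous_on_vanishing_near_0[of _ K])
    show "continuous_on (UNIV - {0}) (\<lambda>x. D e x e)"
      unfolding De[OF e]
      by (intro continuous_intros fd(3-5)[OF e, THEN continuous_on_subset] hd(3-5)[OF e, THEN continuous_on_subset]) auto
    show "D e x e = 0" if "x \<notin> K" for x
    proof -
      have "(F e has_derivative (\<lambda>_. 0)) (at x)"
        by (rule has_derivative_transform_within_open[of "\<lambda>_. 0" _ _ _ "- K"])
           (use that supp K fd(6)[OF e] in \<open>auto simp: open_Compl compact_imp_closed F_def\<close>)
      then show ?thesis using has_derivative_unique[OF dF[OF e]] by metis
    qed
  qed (use K compact_imp_closed in auto)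
  have Fsupp: "F e x = 0" if "x \<notin> K" "e \<in> Basis" for e x
    using that supp fd(6) by (simp add: F_def)
  note D0 = integral_directional_derivative_eq_0[OF dF cD K(1) Fsupp]
  have pw: "hardy_op (- m\<^sup>2) f x * cnj (h x) =
     (\<Sum>e\<in>Basis. hardy_grad e f x * cnj (hardy_grad e h x)) - (\<Sum>e\<in>Basis. D e x e)" for x
  proof -
    define \<rho> where "\<rho> = complex_of_real (m / (norm x)\<^sup>2)"
    \<comment> \<open>Summed over the basis, the last coefficient contributes
      \<open>(m^2 + 2 m) / |x|^2\<close> and the \<open>\<rho>\<close> terms contribute
      \<open>- N m / |x|^2\<close>; with \<open>N = 2 m + 2\<close> they add up to the potential
      \<open>- m^2 / |x|^2\<close>.\<close>
    have t: "hardy_grad e f x * cnj (hardy_grad e h x) - D e x e =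
       - partial_deriv e (partial_deriv e f) x * cnj (h x) - \<rho> * (f x * cnj (h x))
       + complex_of_real ((x \<bullet> e) * (x \<bullet> e)) *
         ((complex_of_real (m * m + 2 * m) / complex_of_real (((norm x)\<^sup>2)\<^sup>2)) * (f x * cnj (h x)))"
      if "e \<in> Basis" for e
      unfolding De[OF that] hardy_grad_def m_def[symmetric] \<rho>_def
      by (simp add: algebra_simps add_divide_distrib power2_eq_square)
    have "(\<Sum>e\<in>Basis. hardy_grad e f x * cnj (hardy_grad e h x)) - (\<Sum>e\<in>Basis. D e x e) =
       (\<Sum>e\<in>Basis. - partial_deriv e (partial_deriv e f) x * cnj (h x) - \<rho> * (f x * cnj (h x))
       + complex_of_real ((x \<bullet> e) * (x \<bullet> e)) *
         ((complex_of_real (m * m + 2 * m) / complex_of_real (((norm x)\<^sup>2)\<^sup>2)) * (f x * cnj (h x))))"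
      unfolding sum_subtractf[symmetric] by (intro sum.cong refl t)
    also have "\<dots> = - laplacian f x * cnj (h x) - of_nat DIM('a) * \<rho> * (f x * cnj (h x)) +
       (\<Sum>e\<in>Basis. complex_of_real ((x \<bullet> e) * (x \<bullet> e))) *
         ((complex_of_real (m * m + 2 * m) / complex_of_real (((norm x)\<^sup>2)\<^sup>2)) * (f x * cnj (h x)))"
      by (simp add: sum.distrib sum_subtractf laplacian_def sum_distrib_right sum_divide_distrib sum_negf mult.assoc)
    also have "(\<Sum>e\<in>Basis. complex_of_real ((x \<bullet> e) * (x \<bullet> e))) = complex_of_real ((norm x)\<^sup>2)"
      unfolding power2_norm_eq_inner by (subst (3) euclidean_inner) simp
    also have "- laplacian f x * cnj (h x) - of_nat DIM('a) * \<rho> * (f x * cnj (h x)) +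
       complex_of_real ((norm x)\<^sup>2) *
         ((complex_of_real (m * m + 2 * m) / complex_of_real (((norm x)\<^sup>2)\<^sup>2)) * (f x * cnj (h x)))
       = hardy_op (- m\<^sup>2) f x * cnj (h x)"
    proof -
      have N: "of_nat DIM('a) = complex_of_real (2 * m + 2)"
        by (simp add: m_def diff_divide_distrib)
      show ?thesis
        unfolding N by (cases "x = 0") (simp_all add: hardy_op_def \<rho>_def field_simps power2_eq_square)
    qed
    finally show ?thesis by simp
  qed
  have gi: "integrable lborel (\<lambda>x. hardy_grad e f x * cnj (hardy_grad e h x))" if "e \<in> Basis" for e
    by (intro square_integrable_mult_cnj hardy_grad_square_integrable f h that)
  have "(LINT x|lborel. hardy_op (- m\<^sup>2) f x * cnj (h x)) =
     (LINT x|lborel. (\<Sum>e\<in>Basis. hardy_grad e f x * cnj (hardy_grad e h x)) - (\<Sum>e\<in>Basis. D e x e))"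
    by (simp only: pw)
  also have "\<dots> = (\<Sum>e\<in>Basis. LINT x|lborel. hardy_grad e f x * cnj (hardy_grad e h x))"
    using gi D0 by (simp add: Bochner_Integration.integral_diff Bochner_Integration.integral_sum)
  finally show ?thesis by (simp add: m_def)
qed

section \<open>The minimal realization as a bounded symmetric form\<close>

lemma l2_cinner_abs_l2:
  assumes "square_integrable f" "square_integrable g"
  shows "l2_cinner (abs_l2 f) (abs_l2 g) = (LINT x|lborel. f x * cnj (g x))"
  using assms by (intro l2_cinner.abs_eq) (simp_all add: l2_rel_def)

lemma abs_l2_diff:
  assumes "square_integrable f" "square_integrable g"
  shows "abs_l2 f - abs_l2 g = abs_l2 (\<lambda>x. f x - g x)"
proof -
  have g: "square_integrable (\<lambda>x. - g x)"
    using square_integrable_cmult[OF assms(2), of "-1"] by simp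
  have "- abs_l2 g = abs_l2 (\<lambda>x. - g x)"
    using assms by (intro uminus_l2.abs_eq) (simp add: l2_rel_def)
  then have "abs_l2 f - abs_l2 g = abs_l2 f + abs_l2 (\<lambda>x. - g x)"
    by (simp add: minus_l2_def)
  also have "\<dots> = abs_l2 (\<lambda>x. f x + - g x)"
    using assms g by (intro plus_l2.abs_eq) (simp_all add: l2_rel_def)
  finally show ?thesis by simp
qed

lemma partial_deriv_diff:
  assumes "\<And>x. f differentiable (at x)" "\<And>x. g differentiable (at x)"
  shows "partial_deriv e (\<lambda>x. f x - g x) = (\<lambda>x. partial_deriv e f x - partial_deriv e g x)"
proof -
  have "((\<lambda>x. f x - g x) has_derivative (\<lambda>v. frechet_derivative f (at x) v - frechet_derivative g (at x) v)) (at x)" for x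
    using assms by (intro has_derivative_diff) (simp_all flip: frechet_derivative_works)
  from partial_deriv_eqI[OF this] show ?thesis
    by (simp add: partial_deriv_def)
qed

lemma C_k_diff: "C_k k f \<Longrightarrow> C_k k g \<Longrightarrow> C_k k (\<lambda>x. f x - g x)"
  by (induction k arbitrary: f g) (auto intro!: continuous_intros simp: partial_deriv_diff)

lemma test_function_diff:
  assumes "f \<in> test_functions \<Omega>" "g \<in> test_functions \<Omega>"
  shows "(\<lambda>x. f x - g x) \<in> test_functions \<Omega>"
proof -
  let ?X = "closure {x. f x \<noteq> 0}" and ?Y = "closure {x. g x \<noteq> 0}"
  have sub: "closure {x. f x - g x \<noteq> 0} \<subseteq> ?X \<union> ?Y"
    unfolding closure_Un[symmetric] by (intro closure_mono) auto
  have "compact (?X \<union> ?Y)"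
    using assms by (intro compact_Un) (auto simp: test_functions_def)
  then have "compact (closure {x. f x - g x \<noteq> 0})"
    using compact_Int_closed[of "?X \<union> ?Y" "closure {x. f x - g x \<noteq> 0}"] sub
    by (simp add: Int_absorb1)
  moreover have "C_k k (\<lambda>x. f x - g x)" for k
    using assms by (intro C_k_diff) (simp_all add: test_functions_def)
  moreover have "closure {x. f x - g x \<noteq> 0} \<subseteq> \<Omega>"
    using sub assms unfolding test_functions_def by blast
  ultimately show ?thesis
    unfolding test_functions_def by blast
qed

lemma hardy_op_diff:
  assumes "f \<in> test_functions \<Omega>" "g \<in> test_functions \<Omega>"
  shows "hardy_op c (\<lambda>x. f x - g x) = (\<lambda>x. hardy_op c f x - hardy_op c g x)"
proof -
  have C: "C_k (Suc (Suc 0)) f" "C_k (Suc (Suc 0)) g"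
    using assms unfolding test_functions_def by blast+
  have "partial_deriv e (partial_deriv e (\<lambda>x. f x - g x)) =
      (\<lambda>x. partial_deriv e (partial_deriv e f) x - partial_deriv e (partial_deriv e g) x)" if "e \<in> Basis" for e
    using C that by (simp add: partial_deriv_diff)
  then have "laplacian (\<lambda>x. f x - g x) = (\<lambda>x. laplacian f x - laplacian g x)"
    by (simp add: laplacian_def[abs_def] sum_subtractf)
  then show ?thesis
    by (simp add: hardy_op_def fun_eq_iff right_diff_distrib)
qed

lemma l2_cinner_self: "l2_cinner u u = complex_of_real ((norm u)\<^sup>2)"
proof -
  have "Im (l2_cinner u u) = 0"
    using l2_cinner_commute[of u u] by (metis Reals_cnj_iff complex_is_Real_iff)
  then show ?thesis
    by (simp add: complex_eq_iff power2_norm_eq_inner inner_l2_def)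
qed

text \<open>Everything is read off from the sum of inner products of gradients. The form bound is
  Cauchy-Schwarz in the function space for each direction, with the factor 2 of
  \<open>cmod_l2_cinner_le\<close>, followed by Cauchy-Schwarz over the basis.\<close>

lemma bounded_symmetric_form_hardy:
  "bounded_symmetric_form (hardy_minimal (- ((real DIM('a) - 2) / 2)\<^sup>2) :: ('a::euclidean_space l2 \<times> 'a l2) set) 2"
proof -
  define c where "c = - ((real DIM('a) - 2) / 2)\<^sup>2"
  have form: "l2_cinner (abs_l2 (hardy_op c f)) (abs_l2 h) =
      (\<Sum>e\<in>Basis. l2_cinner (abs_l2 (hardy_grad e f)) (abs_l2 (hardy_grad e h)))"
    if f: "f \<in> test_functions (UNIV - {0})" and h: "h \<in> test_functions (UNIV - {0})" for f h :: "'a \<Rightarrow> complex"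
  proof -
    have "l2_cinner (abs_l2 (hardy_op c f)) (abs_l2 h) = (LINT x|lborel. hardy_op c f x * cnj (h x))"
      by (rule l2_cinner_abs_l2[OF square_integrable_hardy_op[OF f] square_integrable_test_function[OF h]])
    also have "\<dots> = (\<Sum>e\<in>Basis. LINT x|lborel. hardy_grad e f x * cnj (hardy_grad e h x))"
      unfolding c_def by (rule hardy_op_form[OF f h])
    also have "\<dots> = (\<Sum>e\<in>Basis. l2_cinner (abs_l2 (hardy_grad e f)) (abs_l2 (hardy_grad e h)))"
      by (intro sum.cong refl l2_cinner_abs_l2[symmetric] hardy_grad_square_integrable f h)
    finally show ?thesis .
  qed
  have q: "sqrt (cmod (l2_cinner (abs_l2 (hardy_op c f)) (abs_l2 f))) =
      L2_set (\<lambda>e. norm (abs_l2 (hardy_grad e f))) Basis"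
    if f: "f \<in> test_functions (UNIV - {0})" for f :: "'a \<Rightarrow> complex"
  proof -
    have "l2_cinner (abs_l2 (hardy_op c f)) (abs_l2 f) =
        complex_of_real (\<Sum>e\<in>Basis. (norm (abs_l2 (hardy_grad e f)))\<^sup>2)"
      unfolding form[OF f f] by (simp add: l2_cinner_self)
    then have "cmod (l2_cinner (abs_l2 (hardy_op c f)) (abs_l2 f)) =
        (\<Sum>e\<in>Basis. (norm (abs_l2 (hardy_grad e f)))\<^sup>2)"
      by (simp only: norm_of_real abs_of_nonneg[OF sum_nonneg] zero_le_power2)
    then show ?thesis by (simp add: L2_set_def)
  qed
  show ?thesis
    unfolding c_def[symmetric]
  proof
    fix p q :: "'a l2 \<times> 'a l2" assume "p \<in> hardy_minimal c" "q \<in> hardy_minimal c"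
    then obtain f h where f: "f \<in> test_functions (UNIV - {0})" "p = (abs_l2 f, abs_l2 (hardy_op c f))"
      and h: "h \<in> test_functions (UNIV - {0})" "q = (abs_l2 h, abs_l2 (hardy_op c h))"
      by (auto simp: hardy_minimal_def)
    have "p - q = (abs_l2 (\<lambda>x. f x - h x), abs_l2 (hardy_op c (\<lambda>x. f x - h x)))"
      unfolding f h hardy_op_diff[OF f(1) h(1)] diff_Pair
      by (simp add: abs_l2_diff square_integrable_test_function[OF f(1)] square_integrable_test_function[OF h(1)]
          square_integrable_hardy_op[OF f(1)] square_integrable_hardy_op[OF h(1)])
    then show "p - q \<in> hardy_minimal c"
      unfolding hardy_minimal_def using test_function_diff[OF f(1) h(1)] by blast
    show "l2_cinner (snd p) (fst q) = cnj (l2_cinner (snd q) (fst p))"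
      unfolding f h fst_conv snd_conv form[OF f(1) h(1)] form[OF h(1) f(1)] cnj_sum
      by (intro sum.cong refl l2_cinner_commute)
    have "cmod (l2_cinner (snd p) (fst q)) \<le>
        (\<Sum>e\<in>Basis. cmod (l2_cinner (abs_l2 (hardy_grad e f)) (abs_l2 (hardy_grad e h))))"
      unfolding f h fst_conv snd_conv form[OF f(1) h(1)] by (rule norm_sum)
    also have "\<dots> \<le> (\<Sum>e\<in>Basis. \<bar>norm (abs_l2 (hardy_grad e f))\<bar> * \<bar>norm (abs_l2 (hardy_grad e h))\<bar> * 2)"
      using cmod_l2_cinner_le by (intro sum_mono) simp
    also have "\<dots> \<le> 2 * (L2_set (\<lambda>e. norm (abs_l2 (hardy_grad e f))) Basis *
        L2_set (\<lambda>e. norm (abs_l2 (hardy_grad e h))) Basis)"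
      unfolding sum_distrib_right[symmetric]
      using L2_set_mult_ineq[of "\<lambda>e. norm (abs_l2 (hardy_grad e f))" "\<lambda>e. norm (abs_l2 (hardy_grad e h))" Basis] by simp
    finally show "cmod (l2_cinner (snd p) (fst q)) \<le>
      2 * (sqrt (cmod (l2_cinner (snd p) (fst p))) * sqrt (cmod (l2_cinner (snd q) (fst q))))"
      unfolding f h fst_conv snd_conv q[OF f(1)] q[OF h(1)] .
  qed simp
qed

section \<open>Integration of radial functions\<close>

definition sphere_area :: "nat \<Rightarrow> real" where
  "sphere_area n = real n * unit_ball_vol (real n)"

lemma sphere_area_pos: "0 < sphere_area DIM('a::euclidean_space)"
  unfolding sphere_area_def by (intro mult_pos_pos) auto

text \<open>Polar coordinates restricted to radial functions need no surface measure: the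
  distribution of the norm is determined on half-lines by the volumes of balls, and the density is
  the derivative of those volumes in the radius.\<close>

lemma distr_norm_lborel:
  "distr (lborel :: 'a::euclidean_space measure) borel norm =
    density lborel (\<lambda>r. ennreal (indicator {0..} r * (sphere_area DIM('a) * r ^ (DIM('a) - 1))))"
  (is "?M = density lborel (\<lambda>r. ennreal (?w r))")
proof (rule measure_eqI_generator_eq[of "range (\<lambda>a. {..a})" UNIV _ _ "\<lambda>n. {..real n}"])
  show "Int_stable (range (\<lambda>a::real. {..a}))"
  proof (rule Int_stableI)
    fix A B :: "real set" assume "A \<in> range (\<lambda>a. {..a})" "B \<in> range (\<lambda>a. {..a})"
    then obtain a b where "A = {..a}" "B = {..b}" by blast
    then have "A \<inter> B = {..min a b}" by auto
    then show "A \<inter> B \<in> range (\<lambda>a. {..a})" by blast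
  qed
  have fin: "emeasure ?M {..a} = (if 0 \<le> a then ennreal (unit_ball_vol (real DIM('a)) * a ^ DIM('a)) else 0)" for a
  proof -
    have "emeasure ?M {..a} = emeasure lborel (norm -` {..a} \<inter> space (lborel :: 'a measure))"
      by (rule emeasure_distr) auto
    also have "norm -` {..a} \<inter> space (lborel :: 'a measure) = cball 0 a"
      by auto
    finally show ?thesis
      using emeasure_cball[of a "0::'a"] by auto
  qed
  have [measurable]: "?w \<in> borel_measurable borel" by measurable
  show "emeasure ?M X = emeasure (density lborel (\<lambda>r. ennreal (?w r))) X" if "X \<in> range (\<lambda>a. {..a})" for X
  proof -
    from that obtain a where X: "X = {..a}" by blast
    have "emeasure (density lborel (\<lambda>r. ennreal (?w r))) X =
        (\<integral>\<^sup>+r. ennreal (?w r) * indicator {..a} r \<partial>lborel)"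
      unfolding X by (rule emeasure_density) auto
    also have "\<dots> = (\<integral>\<^sup>+r. ennreal (sphere_area DIM('a) * r ^ (DIM('a) - 1)) * indicator {0..a} r \<partial>lborel)"
      by (intro nn_integral_cong) (auto simp: indicator_def)
    also have "\<dots> = (if 0 \<le> a then ennreal (unit_ball_vol (real DIM('a)) * a ^ DIM('a)) else 0)"
    proof (cases "0 \<le> a")
      case True
      have "(\<integral>\<^sup>+r. ennreal (sphere_area DIM('a) * r ^ (DIM('a) - 1)) * indicator {0..a} r \<partial>lborel) =
          ennreal (unit_ball_vol (real DIM('a)) * a ^ DIM('a) - unit_ball_vol (real DIM('a)) * 0 ^ DIM('a))"
      proof (rule nn_integral_FTC_Icc)
        fix x :: real assume "x \<in> {0..a}"
        show "((\<lambda>r. unit_ball_vol (real DIM('a)) * r ^ DIM('a)) has_real_derivative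
            sphere_area DIM('a) * x ^ (DIM('a) - 1)) (at x)"
          by (auto intro!: derivative_eq_intros simp: sphere_area_def)
        show "0 \<le> sphere_area DIM('a) * x ^ (DIM('a) - 1)"
          using \<open>x \<in> {0..a}\<close> sphere_area_pos[where 'a='a] by simp
      qed (use True in auto)
      with True show ?thesis by simp
    qed auto
    finally show ?thesis by (simp add: X fin)
  qed
  show "sets ?M = sigma_sets UNIV (range (\<lambda>a::real. {..a}))"
    "sets (density lborel (\<lambda>r. ennreal (?w r))) = sigma_sets UNIV (range (\<lambda>a::real. {..a}))"
    by (simp_all add: borel_eq_atMost)
  show "(\<Union>i. {..real i}) = UNIV"
    using real_arch_simple by auto
  show "emeasure ?M {..real i} \<noteq> \<infinity>" for i
    by (simp add: fin)
qed auto

lemma radial_integral: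
  fixes f :: "real \<Rightarrow> 'b::{banach, second_countable_topology}"
  assumes f: "f \<in> borel_measurable borel"
  shows "integrable lborel (\<lambda>x::'a::euclidean_space. f (norm x)) \<longleftrightarrow>
      integrable lborel (\<lambda>r. (indicator {0..} r * (sphere_area DIM('a) * r ^ (DIM('a) - 1))) *\<^sub>R f r)" (is "?A \<longleftrightarrow> ?B")
    and "(LINT x|lborel. f (norm (x::'a))) =
      (LINT r|lborel. (indicator {0..} r * (sphere_area DIM('a) * r ^ (DIM('a) - 1))) *\<^sub>R f r)" (is "?C = ?D")
proof -
  let ?w = "\<lambda>r. indicator {0..} r * (sphere_area DIM('a) * r ^ (DIM('a) - 1))"
  have w: "?w \<in> borel_measurable lborel" by measurable
  have w0: "AE r in lborel. 0 \<le> ?w r"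
    using sphere_area_pos[where 'a='a] by (intro AE_I2) (auto simp: indicator_def)
  have n: "norm \<in> borel_measurable (lborel :: 'a measure)" by simp
  have "?A \<longleftrightarrow> integrable (density lborel (\<lambda>r. ennreal (?w r))) f"
    unfolding distr_norm_lborel[where 'a='a, symmetric] by (simp add: integrable_distr_eq[OF n f])
  also have "\<dots> \<longleftrightarrow> ?B"
    using f by (intro integrable_density w w0) simp
  finally show "?A \<longleftrightarrow> ?B" .
  have "?C = integral\<^sup>L (density lborel (\<lambda>r. ennreal (?w r))) f"
    unfolding distr_norm_lborel[where 'a='a, symmetric] by (simp add: integral_distr[OF n f])
  also have "\<dots> = ?D"
    using f by (intro integral_density w w0) simp
  finally show "?C = ?D" .
qed

text \<open>The square of the lifting factor times the polar Jacobian is the area weight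
  \<open>r\<close> of the plane, whatever the dimension.\<close>

lemma ground_state_weight:
  assumes "0 \<le> r"
  shows "(r powr (- ((real DIM('a::euclidean_space) - 2) / 2)))\<^sup>2 * r ^ (DIM('a) - 1) = r"
proof (cases "r = 0")
  case False
  with assms have r: "r > 0" by simp
  have "(r powr (- ((real DIM('a) - 2) / 2)))\<^sup>2 = r powr (2 - real DIM('a))"
    using r by (simp add: power2_eq_square flip: powr_add)
  moreover have "r ^ (DIM('a) - 1) = r powr (real DIM('a) - 1)"
    using r by (subst powr_realpow[symmetric]) (auto simp: of_nat_diff)
  ultimately show ?thesis
    using r by (simp flip: powr_add)
qed simp

section \<open>Inner products and norms of lifted functions\<close>

lemma hardy_lift_measurable:
  assumes [measurable]: "\<phi> \<in> borel_measurable borel"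
  shows "(hardy_lift \<phi> :: 'a::euclidean_space \<Rightarrow> complex) \<in> borel_measurable lborel"
  unfolding hardy_lift_def[abs_def] by measurable

lemma hardy_lift_integral:
  assumes [measurable]: "\<phi> \<in> borel_measurable borel" "\<xi> \<in> borel_measurable borel"
  shows "integrable lborel (\<lambda>x::'a::euclidean_space. hardy_lift \<phi> x * cnj (hardy_lift \<xi> x)) \<longleftrightarrow>
      integrable lborel (\<lambda>r. indicator {0..} r *\<^sub>R (complex_of_real r * (\<phi> r * cnj (\<xi> r))))" (is "?A \<longleftrightarrow> ?B")
    and "(LINT x|lborel. hardy_lift \<phi> (x::'a) * cnj (hardy_lift \<xi> x)) =
      complex_of_real (sphere_area DIM('a)) *
        (LINT r|lborel. indicator {0..} r *\<^sub>R (complex_of_real r * (\<phi> r * cnj (\<xi> r))))" (is "?C = ?D")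
proof -
  let ?m = "(real DIM('a) - 2) / 2"
  let ?F = "\<lambda>r. complex_of_real ((r powr (- ?m))\<^sup>2) * (\<phi> r * cnj (\<xi> r))"
  have F: "?F \<in> borel_measurable borel" by measurable
  have 1: "(\<lambda>x::'a. hardy_lift \<phi> x * cnj (hardy_lift \<xi> x)) = (\<lambda>x. ?F (norm x))"
    by (auto simp: hardy_lift_def fun_eq_iff power2_eq_square)
  have 2: "(indicator {0..} r * (sphere_area DIM('a) * r ^ (DIM('a) - 1))) *\<^sub>R ?F r =
      complex_of_real (sphere_area DIM('a)) * (indicator {0..} r *\<^sub>R (complex_of_real r * (\<phi> r * cnj (\<xi> r))))" for r
  proof (cases "0 \<le> r")
    case True
    have "(indicator {0..} r * (sphere_area DIM('a) * r ^ (DIM('a) - 1))) *\<^sub>R ?F r =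
        complex_of_real (sphere_area DIM('a) * ((r powr (- ?m))\<^sup>2 * r ^ (DIM('a) - 1))) * (\<phi> r * cnj (\<xi> r))"
      using True by (simp add: scaleR_conv_of_real mult_ac)
    also have "\<dots> = complex_of_real (sphere_area DIM('a) * r) * (\<phi> r * cnj (\<xi> r))"
      by (simp only: ground_state_weight[OF True])
    finally show ?thesis using True by simp
  qed simp
  have pos: "complex_of_real (sphere_area DIM('a)) \<noteq> 0"
    using sphere_area_pos[where 'a='a] by simp
  show "?A \<longleftrightarrow> ?B"
    unfolding 1 radial_integral(1)[OF F] 2
  proof
    let ?p = "\<lambda>r. indicator {0..} r *\<^sub>R (complex_of_real r * (\<phi> r * cnj (\<xi> r)))"
    let ?c = "complex_of_real (sphere_area DIM('a))"
    assume *: "integrable lborel (\<lambda>r. ?c * ?p r)"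
    have "integrable lborel (\<lambda>r. inverse ?c * (?c * ?p r))"
      by (rule Bochner_Integration.integrable_mult_right) (rule *)
    moreover have "inverse ?c * (?c * z) = z" for z
      using pos by (simp add: mult.assoc[symmetric])
    ultimately show "integrable lborel ?p"
      by (simp only:)
  qed (intro Bochner_Integration.integrable_mult_right)
  show "?C = ?D"
    unfolding 1 radial_integral(2)[OF F] 2 by (rule Bochner_Integration.integral_mult_right_zero)
qed

text \<open>On \<open>[0, R]\<close> the density \<open>r |\<phi>|^2\<close> is at most
  \<open>R * B^2\<close>. The resulting factor \<open>R\<close> in the norm is essential later:
  bounded errors on shrinking balls tend to zero.\<close>

lemma hardy_lift_bounded:
  assumes \<phi>: "\<phi> \<in> borel_measurable borel" and R: "0 \<le> R" and B: "0 \<le> B"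
    and le: "\<And>r. 0 < r \<Longrightarrow> r \<le> R \<Longrightarrow> cmod (\<phi> r) \<le> B" and supp: "\<And>r. R < r \<Longrightarrow> \<phi> r = 0"
  shows "square_integrable (hardy_lift \<phi> :: 'a::euclidean_space \<Rightarrow> complex)"
    and "norm (abs_l2 (hardy_lift \<phi> :: 'a \<Rightarrow> complex)) \<le> sqrt (sphere_area DIM('a)) * (R * B)"
proof -
  let ?p = "\<lambda>r. indicator {0..} r *\<^sub>R (complex_of_real r * (\<phi> r * cnj (\<phi> r)))"
  let ?b = "\<lambda>r::real. indicator {0..R} r *\<^sub>R (R * B\<^sup>2)"
  have bi: "integrable lborel ?b" by (intro borel_integrable_compact) auto
  have pb: "cmod (?p r) \<le> ?b r" for r
  proof -
    consider "r \<le> 0" | "0 < r" "r \<le> R" | "R < r" by linarith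
    then show ?thesis
    proof cases
      case 1
      then show ?thesis using R by (cases "r = 0") auto
    next
      case 2
      have "cmod (\<phi> r) * cmod (\<phi> r) \<le> B * B"
        by (intro mult_mono le 2 B) auto
      then have "r * (cmod (\<phi> r) * cmod (\<phi> r)) \<le> R * B\<^sup>2"
        using mult_mono[of r R "cmod (\<phi> r) * cmod (\<phi> r)" "B * B"] 2 R
        by (simp add: power2_eq_square)
      then show ?thesis using 2 by (simp add: norm_mult)
    next
      case 3
      then show ?thesis using supp[of r] by simp
    qed
  qed
  have [measurable]: "\<phi> \<in> borel_measurable borel" by (rule \<phi>)
  have pi: "integrable lborel ?p"
  proof (rule Bochner_Integration.integrable_bound[OF bi])
    show "AE r in lborel. norm (?p r) \<le> norm (?b r)"
      using pb by (intro AE_I2) (metis abs_ge_self order_trans real_norm_def)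
  qed measurable
  then have "integrable lborel (\<lambda>x::'a. hardy_lift \<phi> x * cnj (hardy_lift \<phi> x))"
    by (simp only: hardy_lift_integral(1)[OF \<phi> \<phi>])
  then have "integrable lborel (\<lambda>x::'a. Re (hardy_lift \<phi> x * cnj (hardy_lift \<phi> x)))"
    by (rule integrable_Re)
  then show sq: "square_integrable (hardy_lift \<phi> :: 'a \<Rightarrow> complex)"
    unfolding square_integrable_def using hardy_lift_measurable[OF \<phi>, where 'a='a]
    by (simp only: complex_norm_square[symmetric] Re_complex_of_real)
  have "(norm (abs_l2 (hardy_lift \<phi> :: 'a \<Rightarrow> complex)))\<^sup>2 = cmod (l2_cinner (abs_l2 (hardy_lift \<phi>)) (abs_l2 (hardy_lift \<phi> :: 'a \<Rightarrow> complex)))"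
    unfolding l2_cinner_self norm_of_real by simp
  also have "\<dots> = sphere_area DIM('a) * cmod (LINT r|lborel. ?p r)"
    unfolding l2_cinner_abs_l2[OF sq sq] hardy_lift_integral(2)[OF \<phi> \<phi>] norm_mult
    using sphere_area_pos[where 'a='a] by simp
  also have "cmod (LINT r|lborel. ?p r) \<le> (LINT r|lborel. ?b r)"
    by (rule Bochner_Integration.integral_norm_bound_integral[OF pi bi pb])
  also have "(LINT r|lborel. ?b r) = (R * B)\<^sup>2"
    using R by (simp add: power2_eq_square)
  finally have "(norm (abs_l2 (hardy_lift \<phi> :: 'a \<Rightarrow> complex)))\<^sup>2 \<le> sphere_area DIM('a) * (R * B)\<^sup>2"
    using sphere_area_pos[where 'a='a] by simp
  then have "norm (abs_l2 (hardy_lift \<phi> :: 'a \<Rightarrow> complex)) \<le> sqrt (sphere_area DIM('a) * (R * B)\<^sup>2)"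
    by (simp add: real_le_rsqrt)
  then show "norm (abs_l2 (hardy_lift \<phi> :: 'a \<Rightarrow> complex)) \<le> sqrt (sphere_area DIM('a)) * (R * B)"
    using R B by (simp add: real_sqrt_mult)
qed

lemma hardy_lift_cinner:
  assumes \<phi>: "\<phi> \<in> borel_measurable borel" and \<xi>: "\<xi> \<in> borel_measurable borel"
    and sq: "square_integrable (hardy_lift \<phi> :: 'a::euclidean_space \<Rightarrow> complex)"
      "square_integrable (hardy_lift \<xi> :: 'a \<Rightarrow> complex)"
    and cont: "continuous_on {0..R} (\<lambda>r. complex_of_real r * (\<phi> r * cnj (\<xi> r)))"
    and supp: "\<And>r. R < r \<Longrightarrow> \<phi> r * cnj (\<xi> r) = 0"
  shows "l2_cinner (abs_l2 (hardy_lift \<phi>)) (abs_l2 (hardy_lift \<xi> :: 'a \<Rightarrow> complex)) =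
     complex_of_real (sphere_area DIM('a)) * integral {0..R} (\<lambda>r. complex_of_real r * (\<phi> r * cnj (\<xi> r)))"
proof -
  have si: "set_integrable lborel {0..R} (\<lambda>r. complex_of_real r * (\<phi> r * cnj (\<xi> r)))"
    unfolding set_integrable_def by (rule borel_integrable_compact[OF compact_Icc cont])
  have "(LINT r|lborel. indicator {0..} r *\<^sub>R (complex_of_real r * (\<phi> r * cnj (\<xi> r)))) =
      (LINT r:{0..R}|lborel. complex_of_real r * (\<phi> r * cnj (\<xi> r)))"
    unfolding set_lebesgue_integral_def
  proof (intro Bochner_Integration.integral_cong refl)
    show "indicator {0..} r *\<^sub>R (complex_of_real r * (\<phi> r * cnj (\<xi> r))) =
        indicator {0..R} r *\<^sub>R (complex_of_real r * (\<phi> r * cnj (\<xi> r)))" for r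
    proof (cases "r \<le> R")
      case False
      then show ?thesis using supp[of r] by simp
    qed (simp add: indicator_def)
  qed
  also have "\<dots> = integral {0..R} (\<lambda>r. complex_of_real r * (\<phi> r * cnj (\<xi> r)))"
    by (rule set_borel_integral_eq_integral(2)[OF si])
  finally show ?thesis
    unfolding l2_cinner_abs_l2[OF sq] hardy_lift_integral(2)[OF \<phi> \<xi>] by simp
qed

text \<open>Integration by parts with the weight \<open>r\<close>. The boundary term at 0 is killed
  by the weight and the one at \<open>R\<close> by the support, leaving the Dirichlet integral of
  the plane.\<close>

lemma hardy_form_lift:
  assumes \<phi>: "\<phi> \<in> radial_profiles"
    and d1: "\<And>s. (\<phi> has_vector_derivative \<phi>' s) (at s)"
    and d2: "\<And>s. (\<phi>' has_vector_derivative \<phi>'' s) (at s)"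
    and c2: "continuous_on UNIV \<phi>''"
    and R: "0 \<le> R" "\<And>r. R \<le> r \<Longrightarrow> \<phi> r = 0"
  shows "l2_cinner (abs_l2 (hardy_op (- ((real DIM('a) - 2) / 2)\<^sup>2) (hardy_lift \<phi>)))
      (abs_l2 (hardy_lift \<phi> :: 'a::euclidean_space \<Rightarrow> complex)) =
    complex_of_real (sphere_area DIM('a) * integral {0..R} (\<lambda>r. r * (cmod (\<phi>' r))\<^sup>2))"
proof -
  define \<eta> where "\<eta> s = - \<phi>'' s - \<phi>' s / complex_of_real s" for s
  have c1: "continuous_on UNIV \<phi>'"
    by (intro continuous_at_imp_continuous_on ballI) (rule has_vector_derivative_continuous[OF d2])
  have c0: "continuous_on UNIV \<phi>"
    by (intro continuous_at_imp_continuous_on ballI) (rule has_vector_derivative_continuous[OF d1])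
  have m: "\<phi> \<in> borel_measurable borel" and [measurable]: "\<phi>' \<in> borel_measurable borel" "\<phi>'' \<in> borel_measurable borel"
    using c0 c1 c2 by (auto intro: borel_measurable_continuous_onI)
  have \<eta>m: "\<eta> \<in> borel_measurable borel"
    unfolding \<eta>_def[abs_def] by measurable
  have op: "hardy_op (- ((real DIM('a) - 2) / 2)\<^sup>2) (hardy_lift \<phi>) = (hardy_lift \<eta> :: 'a \<Rightarrow> complex)"
    using hardy_op_lift[OF \<phi> d1 d2] by (auto simp: fun_eq_iff \<eta>_def[abs_def])
  have sq: "square_integrable (hardy_lift \<eta> :: 'a \<Rightarrow> complex)"
    unfolding op[symmetric] by (rule square_integrable_hardy_op[OF hardy_lift_test_function[OF \<phi>]])
  have sq': "square_integrable (hardy_lift \<phi> :: 'a \<Rightarrow> complex)"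
    by (rule square_integrable_test_function[OF hardy_lift_test_function[OF \<phi>]])
  obtain a b where ab: "0 < a" "\<And>s. s \<notin> {a..b} \<Longrightarrow> \<phi> s = 0"
    using radial_profileE[OF \<phi>] by metis
  \<comment> \<open>At \<open>r = 0\<close> the quotient \<open>\<phi>' r / r\<close> is 0 by the
    division convention; the identity \<open>p\<close> holds there only because
    \<open>\<phi>'\<close> vanishes at 0.\<close>
  have "(\<phi> has_vector_derivative 0) (at 0)"
    by (rule has_vector_derivative_transform_within_open[of "\<lambda>_. 0" _ _ "{..<a}"]) (use ab in auto)
  then have \<phi>'0: "\<phi>' 0 = 0"
    using vector_derivative_unique_at[OF d1] by blast
  have p: "complex_of_real r * (\<eta> r * cnj (\<phi> r)) = - (complex_of_real r * \<phi>'' r + \<phi>' r) * cnj (\<phi> r)" for r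
    using \<phi>'0 by (cases "r = 0") (simp_all add: \<eta>_def field_simps)
  have der: "((\<lambda>r. complex_of_real r * (\<phi>' r * cnj (\<phi> r))) has_vector_derivative
      (complex_of_real r * \<phi>'' r + \<phi>' r) * cnj (\<phi> r) + complex_of_real (r * (cmod (\<phi>' r))\<^sup>2)) (at r within S)" for r S
  proof -
    have r1: "(complex_of_real has_vector_derivative 1) (at r)"
      using bounded_linear.has_vector_derivative[OF bounded_linear_of_real[where 'a = complex]
          has_vector_derivative_id[where net = "at r"]] by simp
    have "((\<lambda>r. complex_of_real r * (\<phi>' r * cnj (\<phi> r))) has_vector_derivative
        complex_of_real r * (\<phi>' r * cnj (\<phi>' r) + \<phi>'' r * cnj (\<phi> r)) + 1 * (\<phi>' r * cnj (\<phi> r))) (at r)"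
      by (intro has_vector_derivative_mult r1 d1 d2 has_vector_derivative_cnj)
    then show ?thesis
      by (rule has_vector_derivative_at_within[THEN has_vector_derivative_eq_rhs])
         (simp add: algebra_simps complex_norm_square[symmetric] del: complex_norm_square)
  qed
  have "((\<lambda>r. (complex_of_real r * \<phi>'' r + \<phi>' r) * cnj (\<phi> r) + complex_of_real (r * (cmod (\<phi>' r))\<^sup>2))
      has_integral (complex_of_real R * (\<phi>' R * cnj (\<phi> R)) - complex_of_real 0 * (\<phi>' 0 * cnj (\<phi> 0)))) {0..R}"
    by (rule fundamental_theorem_of_calculus[OF R(1) der])
  then have F: "((\<lambda>r. (complex_of_real r * \<phi>'' r + \<phi>' r) * cnj (\<phi> r) + complex_of_real (r * (cmod (\<phi>' r))\<^sup>2))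
      has_integral 0) {0..R}"
    using R(2)[of R] by simp
  have "((\<lambda>r. r * (cmod (\<phi>' r))\<^sup>2) has_integral integral {0..R} (\<lambda>r. r * (cmod (\<phi>' r))\<^sup>2)) {0..R}"
    by (intro integrable_integral integrable_continuous_real continuous_intros continuous_on_subset[OF c1]) auto
  from has_integral_diff[OF has_integral_of_real[OF this] F]
  have "((\<lambda>r. complex_of_real r * (\<eta> r * cnj (\<phi> r))) has_integral
      complex_of_real (integral {0..R} (\<lambda>r. r * (cmod (\<phi>' r))\<^sup>2))) {0..R}"
    by (simp add: p algebra_simps)
  then have I: "integral {0..R} (\<lambda>r. complex_of_real r * (\<eta> r * cnj (\<phi> r))) =
      complex_of_real (integral {0..R} (\<lambda>r. r * (cmod (\<phi>' r))\<^sup>2))"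
    by (rule integral_unique)
  have "l2_cinner (abs_l2 (hardy_lift \<eta>)) (abs_l2 (hardy_lift \<phi> :: 'a \<Rightarrow> complex)) =
     complex_of_real (sphere_area DIM('a)) * integral {0..R} (\<lambda>r. complex_of_real r * (\<eta> r * cnj (\<phi> r)))"
  proof (rule hardy_lift_cinner[OF \<eta>m m sq sq'])
    show "continuous_on {0..R} (\<lambda>r. complex_of_real r * (\<eta> r * cnj (\<phi> r)))"
      unfolding p by (intro continuous_intros continuous_on_subset[OF c0] continuous_on_subset[OF c1]
          continuous_on_subset[OF c2]) auto
  qed (simp add: R(2))
  then show ?thesis
    unfolding op I by simp
qed

section \<open>Averages over rings: radial waves in the plane\<close>

text \<open>For \<open>c = 1\<close> this is a superposition of plane waves
  \<open>f (t + r cos \<theta>)\<close> over all directions, up to reflection, and hence a radial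
  solution in the plane. The weight \<open>c\<close> makes room for the powers of \<open>cos\<close>
  produced by radial derivatives. There is no normalization, so a factor \<open>pi\<close> shows up
  in the initial velocity.\<close>

definition ring :: "(real \<Rightarrow> real) \<Rightarrow> (real \<Rightarrow> 'b::banach) \<Rightarrow> real \<Rightarrow> real \<Rightarrow> 'b" where
  "ring c f r t = integral {0..pi} (\<lambda>\<theta>. c \<theta> *\<^sub>R f (t + r * cos \<theta>))"

lemma continuous_on_ring:
  fixes f :: "real \<Rightarrow> 'b::banach"
  assumes c: "continuous_on {0..pi} c" and f: "continuous_on UNIV f"
    and g: "continuous_on S g" and h: "continuous_on S h"
  shows "continuous_on S (\<lambda>x. ring c f (g x) (h x))"
proof -
  have sub: "continuous_on (UNIV \<times> {0..pi}) (\<lambda>x. c (snd x))"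
    by (rule continuous_on_compose2[OF c continuous_on_snd[OF continuous_on_id]]) auto
  have "continuous_on UNIV (\<lambda>z. integral (cbox 0 pi) (\<lambda>\<theta>. c \<theta> *\<^sub>R f (snd z + fst z * cos \<theta>)))"
    by (rule integral_continuous_on_param)
       (auto simp: case_prod_beta intro!: continuous_intros sub continuous_on_compose2[OF f])
  then have "continuous_on UNIV (\<lambda>z. ring c f (fst z) (snd z))"
    by (simp add: ring_def)
  from continuous_on_compose2[OF this continuous_on_Pair[OF g h]] show ?thesis
    by simp
qed

lemma ring_deriv_radius:
  fixes f f' :: "real \<Rightarrow> 'b::banach"
  assumes "\<And>t. (f has_vector_derivative f' t) (at t)" "continuous_on UNIV f'" "continuous_on {0..pi} c"
  shows "((\<lambda>r. ring c f r t) has_vector_derivative ring (\<lambda>\<theta>. c \<theta> * cos \<theta>) f' r t) (at r)"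
  unfolding ring_def using assms by (intro has_vector_derivative_affine_integral continuous_intros)

lemma ring_deriv_time:
  fixes f f' :: "real \<Rightarrow> 'b::banach"
  assumes "\<And>t. (f has_vector_derivative f' t) (at t)" "continuous_on UNIV f'" "continuous_on {0..pi} c"
  shows "((\<lambda>t. ring c f r t) has_vector_derivative ring c f' r t) (at t)"
proof -
  have "((\<lambda>t. integral {0..pi} (\<lambda>\<theta>. c \<theta> *\<^sub>R f (r * cos \<theta> + t * 1))) has_vector_derivative
      integral {0..pi} (\<lambda>\<theta>. (c \<theta> * 1) *\<^sub>R f' (r * cos \<theta> + t * 1))) (at t)"
    using assms by (intro has_vector_derivative_affine_integral continuous_intros)
  then show ?thesis
    by (simp add: ring_def add.commute)
qed

text \<open>The three terms assemble to the \<open>\<theta>\<close>-derivative of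
  \<open>sin \<theta>\<close> times \<open>f (t + r cos \<theta>)\<close>, whose boundary values
  vanish at 0 and \<open>pi\<close>. When \<open>f\<close> is the first derivative of a profile,
  this is the radial wave equation multiplied by \<open>r\<close>.\<close>

lemma ring_wave_equation:
  fixes f f' :: "real \<Rightarrow> 'b::banach"
  assumes d: "\<And>t. (f has_vector_derivative f' t) (at t)" and f': "continuous_on UNIV f'"
  shows "ring cos f r t + r *\<^sub>R ring (\<lambda>\<theta>. cos \<theta> * cos \<theta>) f' r t = r *\<^sub>R ring (\<lambda>_. 1) f' r t"
proof -
  have f: "continuous_on UNIV f"
    by (intro continuous_at_imp_continuous_on ballI) (rule has_vector_derivative_continuous[OF d])
  have "((\<lambda>\<theta>. cos \<theta> *\<^sub>R f (t + r * cos \<theta>) + (cos \<theta> * cos \<theta>) *\<^sub>R (r *\<^sub>R f' (t + r * cos \<theta>))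
      - r *\<^sub>R f' (t + r * cos \<theta>)) has_integral (sin pi *\<^sub>R f (t + r * cos pi) - sin 0 *\<^sub>R f (t + r * cos 0))) {0..pi}"
  proof (rule fundamental_theorem_of_calculus)
    fix \<theta> assume "\<theta> \<in> {0..pi}"
    have "((\<lambda>\<theta>. t + r * cos \<theta>) has_vector_derivative - (r * sin \<theta>)) (at \<theta>)"
      by (auto intro!: derivative_eq_intros simp flip: has_real_derivative_iff_has_vector_derivative)
    from vector_diff_chain_at[OF this d]
    have "((\<lambda>\<theta>. f (t + r * cos \<theta>)) has_vector_derivative (- (r * sin \<theta>)) *\<^sub>R f' (t + r * cos \<theta>)) (at \<theta>)"
      by (simp add: o_def)
    from has_vector_derivative_scaleR[OF DERIV_sin this]
    have 1: "((\<lambda>\<theta>. sin \<theta> *\<^sub>R f (t + r * cos \<theta>)) has_vector_derivative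
        sin \<theta> *\<^sub>R ((- (r * sin \<theta>)) *\<^sub>R f' (t + r * cos \<theta>)) + cos \<theta> *\<^sub>R f (t + r * cos \<theta>)) (at \<theta>)" .
    have "sin \<theta> * (r * sin \<theta>) = r * (sin \<theta> * sin \<theta>)"
      by simp
    also have "sin \<theta> * sin \<theta> = 1 - cos \<theta> * cos \<theta>"
      using sin_cos_squared_add3[of \<theta>] by linarith
    finally have "sin \<theta> * (r * sin \<theta>) = r - cos \<theta> * cos \<theta> * r"
      by (simp add: right_diff_distrib mult_ac)
    then have eq: "sin \<theta> *\<^sub>R ((- (r * sin \<theta>)) *\<^sub>R f' (t + r * cos \<theta>)) + cos \<theta> *\<^sub>R f (t + r * cos \<theta>) =
        cos \<theta> *\<^sub>R f (t + r * cos \<theta>) + (cos \<theta> * cos \<theta>) *\<^sub>R (r *\<^sub>R f' (t + r * cos \<theta>)) - r *\<^sub>R f' (t + r * cos \<theta>)"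
      by (simp add: scaleR_left_diff_distrib)
    show "((\<lambda>\<theta>. sin \<theta> *\<^sub>R f (t + r * cos \<theta>)) has_vector_derivative
      cos \<theta> *\<^sub>R f (t + r * cos \<theta>) + (cos \<theta> * cos \<theta>) *\<^sub>R (r *\<^sub>R f' (t + r * cos \<theta>)) - r *\<^sub>R f' (t + r * cos \<theta>))
      (at \<theta> within {0..pi})"
      using 1 unfolding eq by (rule has_vector_derivative_at_within)
  qed simp
  then have 0: "((\<lambda>\<theta>. cos \<theta> *\<^sub>R f (t + r * cos \<theta>) + r *\<^sub>R ((cos \<theta> * cos \<theta>) *\<^sub>R f' (t + r * cos \<theta>))
      - r *\<^sub>R (1 *\<^sub>R f' (t + r * cos \<theta>))) has_integral 0) {0..pi}"
    by (simp add: mult_ac)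
  have i: "(\<lambda>\<theta>. h \<theta> *\<^sub>R g (t + r * cos \<theta>)) integrable_on {0..pi}"
    if "continuous_on {0..pi} h" "continuous_on UNIV g" for h and g :: "real \<Rightarrow> 'b"
    using that by (intro integrable_continuous_real continuous_intros continuous_on_compose2[OF that(2)]) auto
  have "((\<lambda>\<theta>. cos \<theta> *\<^sub>R f (t + r * cos \<theta>) + r *\<^sub>R ((cos \<theta> * cos \<theta>) *\<^sub>R f' (t + r * cos \<theta>))
      - r *\<^sub>R (1 *\<^sub>R f' (t + r * cos \<theta>))) has_integral
     (ring cos f r t + r *\<^sub>R ring (\<lambda>\<theta>. cos \<theta> * cos \<theta>) f' r t - r *\<^sub>R ring (\<lambda>_. 1) f' r t)) {0..pi}"
    unfolding ring_def
    by (intro has_integral_diff has_integral_add has_integral_cmul integrable_integral i f f' continuous_intros)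
  from has_integral_unique[OF this 0] show ?thesis by simp
qed

section \<open>Finite propagation speed\<close>

text \<open>Squaring the positive part makes the energy weight continuously differentiable across
  the characteristic lines, so the weighted energy can be differentiated over a fixed interval of
  radii.\<close>

lemma has_real_derivative_max_square:
  "((\<lambda>x. (max 0 x)\<^sup>2) has_real_derivative 2 * max 0 x) (at x)"
proof -
  consider "x < 0" | "x > 0" | "x = 0" by linarith
  then show ?thesis
  proof cases
    case 1
    have "((\<lambda>x. (max 0 x)\<^sup>2) has_real_derivative 0) (at x)"
      by (rule has_field_derivative_transform_within_open[of "\<lambda>_. 0" _ _ "{..<0}"]) (use 1 in auto)
    then show ?thesis using 1 by simp
  next
    case 2
    have "((\<lambda>x. x\<^sup>2) has_real_derivative 2 * x) (at x)"
      by (auto intro!: derivative_eq_intros)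
    then have "((\<lambda>x. (max 0 x)\<^sup>2) has_real_derivative 2 * x) (at x)"
      by (rule has_field_derivative_transform_within_open[of _ _ _ "{0<..}"]) (use 2 in auto)
    then show ?thesis using 2 by simp
  next
    case 3
    have "((\<lambda>h. ((max 0 (0 + h))\<^sup>2 - (max 0 0)\<^sup>2) / h) \<longlongrightarrow> (0::real)) (at 0)"
    proof (rule Lim_null_comparison)
      show "\<forall>\<^sub>F h in at 0. norm (((max 0 (0 + h))\<^sup>2 - (max 0 0)\<^sup>2) / h) \<le> \<bar>h::real\<bar>"
        by (intro always_eventually allI) (auto simp: max_def power2_eq_square)
      show "((\<lambda>h. \<bar>h::real\<bar>) \<longlongrightarrow> 0) (at 0)"
        by (rule tendsto_eq_intros | simp)+
    qed
    then show ?thesis using 3 by (simp add: DERIV_def)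
  qed
qed

text \<open>
  Finite propagation speed: the energy weighted by \<open>(r - t - a)\<^sub>+\<^sup>2 (b - r - t)\<^sub>+\<^sup>2\<close>, whose time derivative
  dominates its space derivative, does not increase.
\<close>

lemma ring_finite_propagation:
  fixes q q' q'' :: "real \<Rightarrow> complex"
  assumes d1: "\<And>t. (q has_vector_derivative q' t) (at t)" and d2: "\<And>t. (q' has_vector_derivative q'' t) (at t)"
    and c2: "continuous_on UNIV q''" and a: "0 \<le> a"
    and init: "\<And>r. a < r \<Longrightarrow> ring (\<lambda>_. 1) q r 0 = 0" "\<And>r. a < r \<Longrightarrow> ring (\<lambda>_. 1) q' r 0 = 0"
    and t: "0 \<le> t" and r: "a + t < r"
  shows "ring (\<lambda>_. 1) q r t = 0"
proof -
  let ?v = "ring (\<lambda>_. 1) q" and ?vt = "ring (\<lambda>_. 1) q'" and ?vtt = "ring (\<lambda>_. 1) q''"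
  let ?vr = "ring cos q'" and ?vrt = "ring cos q''" and ?vrr = "ring (\<lambda>\<theta>. cos \<theta> * cos \<theta>) q''"
  have c1: "continuous_on UNIV q'"
    by (intro continuous_at_imp_continuous_on ballI) (rule has_vector_derivative_continuous[OF d2])
  have c0: "continuous_on UNIV q"
    by (intro continuous_at_imp_continuous_on ballI) (rule has_vector_derivative_continuous[OF d1])
  have v_t: "((\<lambda>t. ?v r t) has_vector_derivative ?vt r t) (at t)" for r t
    by (rule ring_deriv_time[OF d1 c1]) simp
  have v_r: "((\<lambda>r. ?v r t) has_vector_derivative ?vr r t) (at r)" for r t
    using ring_deriv_radius[OF d1 c1, of "\<lambda>_. 1"] by simp
  have vt_t: "((\<lambda>t. ?vt r t) has_vector_derivative ?vtt r t) (at t)" for r t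
    by (rule ring_deriv_time[OF d2 c2]) simp
  have vr_t: "((\<lambda>t. ?vr r t) has_vector_derivative ?vrt r t) (at t)" for r t
    by (rule ring_deriv_time[OF d2 c2]) (intro continuous_intros)
  have vt_r: "((\<lambda>r. ?vt r t) has_vector_derivative ?vrt r t) (at r)" for r t
    using ring_deriv_radius[OF d2 c2, of "\<lambda>_. 1"] by simp
  have vr_r: "((\<lambda>r. ?vr r t) has_vector_derivative ?vrr r t) (at r)" for r t
    by (rule ring_deriv_radius[OF d2 c2]) (intro continuous_intros)
  have pde: "r *\<^sub>R ?vtt r t = ?vr r t + r *\<^sub>R ?vrr r t" for r t
    using ring_wave_equation[OF d2 c2] by simp
  have cr: "continuous_on S (\<lambda>x. ?v (g x) (h x))" "continuous_on S (\<lambda>x. ?vt (g x) (h x))"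
    "continuous_on S (\<lambda>x. ?vr (g x) (h x))" "continuous_on S (\<lambda>x. ?vtt (g x) (h x))"
    "continuous_on S (\<lambda>x. ?vrt (g x) (h x))" "continuous_on S (\<lambda>x. ?vrr (g x) (h x))"
    if "continuous_on S g" "continuous_on S h" for S :: "'x::topological_space set" and g h
    by (rule continuous_on_ring; intro c0 c1 c2 that continuous_intros)+
  have vr0: "?vr r 0 = 0" if "a < r" for r
  proof -
    have "((\<lambda>r. ?v r 0) has_vector_derivative 0) (at r)"
      by (rule has_vector_derivative_transform_within_open[of "\<lambda>_. 0" _ _ "{a<..}"]) (use that init in auto)
    then show ?thesis using vector_derivative_unique_at[OF v_r] by blast
  qed
  have vt0: "?vt r0 t0 = 0" if t0: "0 \<le> t0" and r0: "a + t0 < r0" for r0 t0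
  proof -
    \<comment> \<open>This choice makes the weight positive at \<open>(r0, t0)\<close>:
      \<open>b - r0 - t0 = 1\<close>, and \<open>r0 - t0 - a > 0\<close> by assumption.\<close>
    define b where "b = r0 + t0 + 1"
    define \<alpha> where "\<alpha> r t = max 0 (r - t - a)" for r t
    define \<beta> where "\<beta> r t = max 0 (b - r - t)" for r t
    define \<eta> where "\<eta> r t = (\<alpha> r t)\<^sup>2 * (\<beta> r t)\<^sup>2" for r t
    define \<eta>t where "\<eta>t r t = - 2 * \<alpha> r t * (\<beta> r t)\<^sup>2 - 2 * (\<alpha> r t)\<^sup>2 * \<beta> r t" for r t
    define \<eta>r where "\<eta>r r t = 2 * \<alpha> r t * (\<beta> r t)\<^sup>2 - 2 * (\<alpha> r t)\<^sup>2 * \<beta> r t" for r t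
    have ab: "a < b" using t0 r0 by (simp add: b_def)
    have \<alpha>_t: "((\<lambda>t. (\<alpha> r t)\<^sup>2) has_real_derivative - (2 * \<alpha> r t)) (at t)" for r t
      unfolding \<alpha>_def
      by (rule DERIV_cong[OF DERIV_chain2[OF has_real_derivative_max_square, where g = "\<lambda>t. r - t - a" and Db = "-1"]])
         (auto intro!: derivative_eq_intros)
    have \<alpha>_r: "((\<lambda>r. (\<alpha> r t)\<^sup>2) has_real_derivative 2 * \<alpha> r t) (at r)" for r t
      unfolding \<alpha>_def
      by (rule DERIV_cong[OF DERIV_chain2[OF has_real_derivative_max_square, where g = "\<lambda>r. r - t - a" and Db = 1]])
         (auto intro!: derivative_eq_intros)
    have \<beta>_t: "((\<lambda>t. (\<beta> r t)\<^sup>2) has_real_derivative - (2 * \<beta> r t)) (at t)" for r t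
      unfolding \<beta>_def
      by (rule DERIV_cong[OF DERIV_chain2[OF has_real_derivative_max_square, where g = "\<lambda>t. b - r - t" and Db = "-1"]])
         (auto intro!: derivative_eq_intros)
    have \<beta>_r: "((\<lambda>r. (\<beta> r t)\<^sup>2) has_real_derivative - (2 * \<beta> r t)) (at r)" for r t
      unfolding \<beta>_def
      by (rule DERIV_cong[OF DERIV_chain2[OF has_real_derivative_max_square, where g = "\<lambda>r. b - r - t" and Db = "-1"]])
         (auto intro!: derivative_eq_intros)
    have \<eta>_t: "((\<lambda>t. \<eta> r t) has_real_derivative \<eta>t r t) (at t)" for r t
      unfolding \<eta>_def \<eta>t_def by (rule DERIV_cong[OF DERIV_mult[OF \<alpha>_t \<beta>_t]]) (simp add: algebra_simps)
    have \<eta>_r: "((\<lambda>r. \<eta> r t) has_real_derivative \<eta>r r t) (at r)" for r t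
      unfolding \<eta>_def \<eta>r_def by (rule DERIV_cong[OF DERIV_mult[OF \<alpha>_r \<beta>_r]]) (simp add: algebra_simps)
    have dom: "\<bar>\<eta>r r t\<bar> \<le> - \<eta>t r t" for r t
    proof -
      have "0 \<le> 2 * \<alpha> r t * (\<beta> r t)\<^sup>2" "0 \<le> 2 * (\<alpha> r t)\<^sup>2 * \<beta> r t"
        by (simp_all add: \<alpha>_def \<beta>_def)
      then show ?thesis unfolding \<eta>r_def \<eta>t_def by linarith
    qed
    have \<eta>0: "0 \<le> \<eta> r t" for r t by (simp add: \<eta>_def)
    have c\<eta>: "continuous_on S (\<lambda>x. \<eta> (g x) (h x))" "continuous_on S (\<lambda>x. \<eta>t (g x) (h x))"
      "continuous_on S (\<lambda>x. \<eta>r (g x) (h x))"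
      if "continuous_on S g" "continuous_on S h" for S :: "'x::topological_space set" and g h
      unfolding \<eta>_def \<eta>t_def \<eta>r_def \<alpha>_def \<beta>_def by (intro that continuous_intros)+
    define e where "e r t = ?vt r t \<bullet> ?vt r t + ?vr r t \<bullet> ?vr r t" for r t
    define et where "et r t = 2 * (?vt r t \<bullet> ?vtt r t) + 2 * (?vr r t \<bullet> ?vrt r t)" for r t
    have inner_d: "((\<lambda>s. x s \<bullet> y s) has_real_derivative x s \<bullet> y' + x' \<bullet> y s) (at s)"
      if "(x has_vector_derivative x') (at s)" "(y has_vector_derivative y') (at s)"
      for x y :: "real \<Rightarrow> complex" and x' y' s
      using bounded_bilinear.has_vector_derivative[OF bounded_bilinear_inner that]
      by (simp add: has_real_derivative_iff_has_vector_derivative)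
    have e_t: "((\<lambda>t. e r t) has_real_derivative et r t) (at t)" for r t
      unfolding e_def et_def
      by (rule DERIV_cong[OF DERIV_add[OF inner_d[OF vt_t vt_t] inner_d[OF vr_t vr_t]]])
         (simp add: inner_commute)
    define E where "E t = integral {a..b} (\<lambda>r. \<eta> r t * r * e r t)" for t
    define Et where "Et t = integral {a..b} (\<lambda>r. \<eta>t r t * r * e r t + \<eta> r t * r * et r t)" for t
    have ce: "continuous_on S (\<lambda>x. e (g x) (h x))" "continuous_on S (\<lambda>x. et (g x) (h x))"
      if "continuous_on S g" "continuous_on S h" for S :: "'x::topological_space set" and g h
      unfolding e_def et_def by (intro that continuous_intros cr)+
    have E_d: "(E has_real_derivative Et t) (at t)" for t
    proof -
      have "((\<lambda>t. integral (cbox a b) (\<lambda>r. \<eta> r t * r * e r t)) has_vector_derivative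
          integral (cbox a b) (\<lambda>r. \<eta>t r t * r * e r t + \<eta> r t * r * et r t)) (at t within UNIV)"
      proof (rule leibniz_rule_vector_derivative)
        fix t r
        show "((\<lambda>t. \<eta> r t * r * e r t) has_vector_derivative \<eta>t r t * r * e r t + \<eta> r t * r * et r t) (at t within UNIV)"
          unfolding has_real_derivative_iff_has_vector_derivative[symmetric]
          by (rule DERIV_cong[OF DERIV_mult[OF DERIV_mult[OF \<eta>_t DERIV_const] e_t]]) simp
      next
        fix t
        have "(\<lambda>r. \<eta> r t * r * e r t) integrable_on {a..b}"
          by (intro integrable_continuous_real continuous_intros c\<eta> ce)
        then show "(\<lambda>r. \<eta> r t * r * e r t) integrable_on cbox a b" by simp
      next
        show "continuous_on (UNIV \<times> cbox a b) (\<lambda>(t, r). \<eta>t r t * r * e r t + \<eta> r t * r * et r t)"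
          unfolding case_prod_beta by (intro continuous_intros c\<eta> ce)
      qed auto
      then show ?thesis
        by (simp add: has_real_derivative_iff_has_vector_derivative E_def[abs_def] Et_def)
    qed
    have Et_le: "Et t \<le> 0" if "0 \<le> t" for t
    proof -
      \<comment> \<open>The radial derivative of the weighted flux
        \<open>2 \<eta> r (v_r . v_t)\<close>. Its integral is zero because the weight vanishes at
        \<open>r = a\<close> and \<open>r = b\<close> for nonnegative times; subtracting it removes
        all second derivatives of the wave.\<close>
      define D where "D r = 2 * \<eta>r r t * r * (?vr r t \<bullet> ?vt r t)
          + 2 * \<eta> r t * (?vr r t \<bullet> ?vt r t + r * (?vr r t \<bullet> ?vrt r t + ?vrr r t \<bullet> ?vt r t))" for r
      have "(D has_integral (2 * \<eta> b t * b * (?vr b t \<bullet> ?vt b t) - 2 * \<eta> a t * a * (?vr a t \<bullet> ?vt a t))) {a..b}"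
      proof (rule fundamental_theorem_of_calculus)
        fix r
        have "((\<lambda>r. 2 * \<eta> r t * r * (?vr r t \<bullet> ?vt r t)) has_real_derivative D r) (at r)"
          unfolding D_def
          by (rule DERIV_cong[OF DERIV_mult[OF DERIV_mult[OF DERIV_mult[OF DERIV_const \<eta>_r] DERIV_ident] inner_d[OF vr_r vt_r]]])
             (simp add: algebra_simps)
        then show "((\<lambda>r. 2 * \<eta> r t * r * (?vr r t \<bullet> ?vt r t)) has_vector_derivative D r) (at r within {a..b})"
          by (simp add: has_real_derivative_iff_has_vector_derivative has_vector_derivative_at_within)
      qed (use ab in simp)
      moreover have "\<eta> b t = 0" "\<eta> a t = 0"
        using that by (simp_all add: \<eta>_def \<alpha>_def \<beta>_def)
      ultimately have D0: "(D has_integral 0) {a..b}" by simp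
      have id: "\<eta>t r t * r * e r t + \<eta> r t * r * et r t - D r = r * (\<eta>t r t * e r t - \<eta>r r t * (2 * (?vr r t \<bullet> ?vt r t)))" for r
      proof -
        have "r * (?vt r t \<bullet> ?vtt r t) = ?vr r t \<bullet> ?vt r t + r * (?vrr r t \<bullet> ?vt r t)"
          using arg_cong[OF pde[of r t], of "\<lambda>z. ?vt r t \<bullet> z"] by (simp add: inner_add_right inner_commute)
        then have "\<eta> r t * (r * et r t) =
            \<eta> r t * (2 * (?vr r t \<bullet> ?vt r t + r * (?vrr r t \<bullet> ?vt r t)) + 2 * (r * (?vr r t \<bullet> ?vrt r t)))"
          by (simp add: et_def distrib_left mult.left_commute[of r 2])
        then show ?thesis by (simp add: D_def algebra_simps)
      qed
      have "(\<lambda>r. \<eta>t r t * r * e r t + \<eta> r t * r * et r t) integrable_on {a..b}"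
        by (intro integrable_continuous_real continuous_intros c\<eta> ce)
      from has_integral_diff[OF integrable_integral[OF this] D0]
      have I: "((\<lambda>r. r * (\<eta>t r t * e r t - \<eta>r r t * (2 * (?vr r t \<bullet> ?vt r t)))) has_integral Et t) {a..b}"
        by (simp only: id Et_def) simp
      have le: "r * (\<eta>t r t * e r t - \<eta>r r t * (2 * (?vr r t \<bullet> ?vt r t))) \<le> 0" if "r \<in> {a..b}" for r
      proof -
        have e0: "0 \<le> e r t" by (simp add: e_def)
        have "\<bar>?vr r t \<bullet> ?vt r t\<bar> \<le> norm (?vr r t) * norm (?vt r t)"
          by (rule Cauchy_Schwarz_ineq2)
        then have "\<bar>2 * (?vr r t \<bullet> ?vt r t)\<bar> \<le> e r t"
          using sum_squares_bound[of "norm (?vr r t)" "norm (?vt r t)"]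
          by (simp add: e_def power2_norm_eq_inner)
        then have "\<bar>\<eta>r r t\<bar> * \<bar>2 * (?vr r t \<bullet> ?vt r t)\<bar> \<le> - \<eta>t r t * e r t"
          using dom[of r t] by (intro mult_mono) auto
        then have "\<bar>\<eta>r r t * (2 * (?vr r t \<bullet> ?vt r t))\<bar> \<le> - \<eta>t r t * e r t"
          by (simp only: abs_mult)
        then have "\<eta>t r t * e r t - \<eta>r r t * (2 * (?vr r t \<bullet> ?vt r t)) \<le> 0"
          by linarith
        moreover have "0 \<le> r" using that a by simp
        ultimately show ?thesis by (simp add: mult_nonneg_nonpos)
      qed
      show ?thesis
        by (rule has_integral_le[OF I has_integral_0 le])
    qed
    have "E t0 \<le> E 0"
    proof (rule DERIV_nonpos_imp_nonincreasing[OF t0])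
      fix s :: real assume "0 \<le> s"
      then show "\<exists>y. (E has_real_derivative y) (at s) \<and> y \<le> 0"
        using E_d[of s] Et_le[of s] by (intro exI[of _ "Et s"]) simp
    qed
    also have "E 0 = 0"
    proof -
      have "\<eta> r 0 * r * e r 0 = 0" if "r \<in> {a..b}" for r
      proof (cases "r = a")
        case True
        then show ?thesis by (simp add: \<eta>_def \<alpha>_def)
      next
        case False
        then show ?thesis using that init(2)[of r] vr0[of r] by (simp add: e_def)
      qed
      then have "E 0 = integral {a..b} (\<lambda>_. 0)"
        unfolding E_def by (intro Henstock_Kurzweil_Integration.integral_cong)
      then show ?thesis by simp
    qed
    finally have "E t0 \<le> 0" .
    moreover have nn: "0 \<le> \<eta> r t0 * r * e r t0" if "r \<in> {a..b}" for r
      using \<eta>0[of r t0] that a by (simp add: e_def)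
    have "0 \<le> E t0"
      unfolding E_def by (rule Henstock_Kurzweil_Integration.integral_nonneg[OF _ nn])
        (intro integrable_continuous_real continuous_intros c\<eta> ce)
    ultimately have "integral {a..b} (\<lambda>r. \<eta> r t0 * r * e r t0) = 0"
      unfolding E_def by linarith
    moreover have "continuous_on {a..b} (\<lambda>r. \<eta> r t0 * r * e r t0)"
      by (intro continuous_intros c\<eta> ce)
    ultimately have "\<forall>r\<in>{a..b}. \<eta> r t0 * r * e r t0 = 0"
      using integral_eq_0_iff[OF _ ab nn] by simp
    moreover have "r0 \<in> {a..b}" using t0 r0 by (simp add: b_def)
    ultimately have "\<eta> r0 t0 * r0 * e r0 t0 = 0" by blast
    moreover have "\<eta> r0 t0 > 0"
      using r0 by (simp add: \<eta>_def \<alpha>_def \<beta>_def b_def)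
    moreover have "r0 > 0" using r0 a t0 by linarith
    ultimately have "e r0 t0 = 0" by simp
    then show ?thesis
      by (simp add: e_def add_nonneg_eq_0_iff)
  qed
  \<comment> \<open>The energy controls only first derivatives; the value itself is recovered by
    integrating in time at fixed \<open>r\<close>, along which \<open>a + s < r\<close>
    persists.\<close>
  have "((\<lambda>s. ?vt r s) has_integral (?v r t - ?v r 0)) {0..t}"
    by (rule fundamental_theorem_of_calculus[OF t has_vector_derivative_at_within[OF v_t]])
  moreover have "((\<lambda>s. ?vt r s) has_integral 0) {0..t}"
    by (rule has_integral_is_0) (use vt0 r in auto)
  ultimately have "?v r t - ?v r 0 = 0"
    by (rule has_integral_unique)
  then show ?thesis
    using init(1)[of r] r t by simp
qed

section \<open>Abel transforms and ring averages\<close>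

text \<open>A Wallis recursion, from integrating the derivative of
  \<open>cos \<theta> ^ (n + 1) * sin \<theta>\<close>.\<close>

lemma integral_cos_power:
  "real (n + 2) * integral {0..pi} (\<lambda>\<theta>. cos \<theta> ^ (n + 2)) = real (n + 1) * integral {0..pi} (\<lambda>\<theta>. cos \<theta> ^ n)"
proof -
  have A: "((\<lambda>\<theta>. real (n + 2) * cos \<theta> ^ (n + 2) - real (n + 1) * cos \<theta> ^ n) has_integral
      (cos pi ^ (n + 1) * sin pi - cos 0 ^ (n + 1) * sin 0)) {0..pi}"
  proof (rule fundamental_theorem_of_calculus)
    fix \<theta> :: real
    have s: "sin \<theta> * sin \<theta> = 1 - cos \<theta> * cos \<theta>"
      using sin_cos_squared_add3[of \<theta>] by linarith
    have "((\<lambda>\<theta>. cos \<theta> ^ (n + 1) * sin \<theta>) has_real_derivative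
        cos \<theta> ^ (n + 1) * cos \<theta> - real (n + 1) * cos \<theta> ^ n * (sin \<theta> * sin \<theta>)) (at \<theta>)"
      by (rule DERIV_cong[OF DERIV_mult[OF DERIV_power[where n = "n + 1", OF DERIV_cos] DERIV_sin]])
         (simp add: algebra_simps)
    also have "cos \<theta> ^ (n + 1) * cos \<theta> - real (n + 1) * cos \<theta> ^ n * (sin \<theta> * sin \<theta>) =
        real (n + 2) * cos \<theta> ^ (n + 2) - real (n + 1) * cos \<theta> ^ n"
      unfolding s by (simp add: algebra_simps)
    finally show "((\<lambda>\<theta>. cos \<theta> ^ (n + 1) * sin \<theta>) has_vector_derivative
        real (n + 2) * cos \<theta> ^ (n + 2) - real (n + 1) * cos \<theta> ^ n) (at \<theta> within {0..pi})"
      by (simp only: has_real_derivative_iff_has_vector_derivative has_vector_derivative_at_within)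
  qed simp
  have "((\<lambda>\<theta>. real (n + 2) * cos \<theta> ^ (n + 2) - real (n + 1) * cos \<theta> ^ n) has_integral
      (real (n + 2) * integral {0..pi} (\<lambda>\<theta>. cos \<theta> ^ (n + 2)) - real (n + 1) * integral {0..pi} (\<lambda>\<theta>. cos \<theta> ^ n))) {0..pi}"
    by (intro has_integral_diff has_integral_mult_right integrable_integral integrable_continuous_real continuous_intros)
  from has_integral_unique[OF this A] show ?thesis by simp
qed

text \<open>The companion recursion on the quarter period. The powers are one higher than in the
  cosine recursion because the area element of the sphere contributes an extra sine.\<close>

lemma integral_sin_power:
  "real (n + 3) * integral {0..pi/2} (\<lambda>\<theta>. sin \<theta> ^ (n + 3)) = real (n + 2) * integral {0..pi/2} (\<lambda>\<theta>. sin \<theta> ^ (n + 1))"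
proof -
  have A: "((\<lambda>\<theta>. real (n + 3) * sin \<theta> ^ (n + 3) - real (n + 2) * sin \<theta> ^ (n + 1)) has_integral
      (- (sin (pi/2) ^ (n + 2) * cos (pi/2)) - - (sin 0 ^ (n + 2) * cos 0))) {0..pi/2}"
  proof (rule fundamental_theorem_of_calculus)
    fix \<theta> :: real
    have s: "cos \<theta> * cos \<theta> = 1 - sin \<theta> * sin \<theta>"
      using sin_cos_squared_add3[of \<theta>] by linarith
    have "((\<lambda>\<theta>. - (sin \<theta> ^ (n + 2) * cos \<theta>)) has_real_derivative
        sin \<theta> ^ (n + 2) * sin \<theta> - real (n + 2) * sin \<theta> ^ (n + 1) * (cos \<theta> * cos \<theta>)) (at \<theta>)"
      by (rule DERIV_cong[OF DERIV_minus[OF DERIV_mult[OF DERIV_power[where n = "n + 2", OF DERIV_sin] DERIV_cos]]])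
         (simp add: algebra_simps)
    also have "sin \<theta> ^ (n + 2) * sin \<theta> - real (n + 2) * sin \<theta> ^ (n + 1) * (cos \<theta> * cos \<theta>) =
        real (n + 3) * sin \<theta> ^ (n + 3) - real (n + 2) * sin \<theta> ^ (n + 1)"
      unfolding s by (simp add: algebra_simps power3_eq_cube power2_eq_square power_add)
    finally show "((\<lambda>\<theta>. - (sin \<theta> ^ (n + 2) * cos \<theta>)) has_vector_derivative
        real (n + 3) * sin \<theta> ^ (n + 3) - real (n + 2) * sin \<theta> ^ (n + 1)) (at \<theta> within {0..pi/2})"
      by (simp only: has_real_derivative_iff_has_vector_derivative has_vector_derivative_at_within)
  qed simp
  have "((\<lambda>\<theta>. real (n + 3) * sin \<theta> ^ (n + 3) - real (n + 2) * sin \<theta> ^ (n + 1)) has_integral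
      (real (n + 3) * integral {0..pi/2} (\<lambda>\<theta>. sin \<theta> ^ (n + 3)) - real (n + 2) * integral {0..pi/2} (\<lambda>\<theta>. sin \<theta> ^ (n + 1)))) {0..pi/2}"
    by (intro has_integral_diff has_integral_mult_right integrable_integral integrable_continuous_real continuous_intros)
  from has_integral_unique[OF this A] show ?thesis by simp
qed

text \<open>The two Wallis recursions combine so that \<open>n + 1\<close> times the left-hand side
  depends only on the parity of \<open>n\<close>: it is \<open>pi\<close> for even and 0 for odd
  \<open>n\<close>.\<close>

lemma archimedes_monomial:
  "integral {0..pi} (\<lambda>\<theta>. cos \<theta> ^ n) * integral {0..pi/2} (\<lambda>\<theta>. sin \<theta> ^ (n + 1)) =
    pi / 2 * integral {-1..1} (\<lambda>x::real. x ^ n)"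
proof -
  have I: "integral {-1..1} (\<lambda>x::real. x ^ n) = (1 - (- 1) ^ (n + 1)) / real (n + 1)"
  proof (rule integral_unique)
    have "((\<lambda>x::real. x ^ n) has_integral (1 ^ (n + 1) / real (n + 1) - (- 1) ^ (n + 1) / real (n + 1))) {-1..1}"
    proof (rule fundamental_theorem_of_calculus)
      fix x :: real
      have "((\<lambda>x. x ^ (n + 1) / real (n + 1)) has_real_derivative x ^ n) (at x)"
        by (rule derivative_eq_intros refl | simp)+
      then show "((\<lambda>x. x ^ (n + 1) / real (n + 1)) has_vector_derivative x ^ n) (at x within {-1..1})"
        by (simp only: has_real_derivative_iff_has_vector_derivative has_vector_derivative_at_within)
    qed simp
    then show "((\<lambda>x::real. x ^ n) has_integral (1 - (- 1) ^ (n + 1)) / real (n + 1)) {-1..1}"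
      by (simp add: diff_divide_distrib add_divide_distrib)
  qed
  have P: "real (n + 1) * (integral {0..pi} (\<lambda>\<theta>. cos \<theta> ^ n) * integral {0..pi/2} (\<lambda>\<theta>. sin \<theta> ^ (n + 1))) =
      pi / 2 * (1 - (- 1) ^ (n + 1))"
  proof (induction n rule: induct_nat_012)
    case 0
    have "(sin has_integral (- cos (pi/2) - - cos 0)) {0..pi/2}"
    proof (rule fundamental_theorem_of_calculus)
      show "((\<lambda>x. - cos x) has_vector_derivative sin x) (at x within {0..pi/2})" for x :: real
        by (auto intro!: derivative_eq_intros simp flip: has_real_derivative_iff_has_vector_derivative)
    qed simp
    then show ?case by (simp add: integral_unique)
  next
    case 1
    have "(cos has_integral (sin pi - sin 0)) {0..pi}"
    proof (rule fundamental_theorem_of_calculus)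
      show "(sin has_vector_derivative cos x) (at x within {0..pi})" for x :: real
        by (auto intro!: derivative_eq_intros simp flip: has_real_derivative_iff_has_vector_derivative)
    qed simp
    then show ?case by (simp add: integral_unique)
  next
    case (ge2 n)
    let ?a = "\<lambda>n. integral {0..pi} (\<lambda>\<theta>. cos \<theta> ^ n)" and ?b = "\<lambda>n. integral {0..pi/2} (\<lambda>\<theta>. sin \<theta> ^ n)"
    have "real (n + 2) * (real (n + 3) * (?a (n + 2) * ?b (n + 3))) =
        (real (n + 2) * ?a (n + 2)) * (real (n + 3) * ?b (n + 3))"
      by (simp only: mult_ac)
    also have "\<dots> = real (n + 2) * (real (n + 1) * (?a n * ?b (n + 1)))"
      unfolding integral_cos_power integral_sin_power by (simp only: mult_ac)
    also have "\<dots> = real (n + 2) * (pi / 2 * (1 - (- 1) ^ (n + 1)))"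
      unfolding ge2(1) ..
    finally have "real (n + 3) * (?a (n + 2) * ?b (n + 3)) = pi / 2 * (1 - (- 1) ^ (n + 1))"
      by (simp only: mult_left_cancel)
    then show ?case by (simp add: numeral_3_eq_3)
  qed
  have "X = pi / 2 * Z" if "real (n + 1) * X = pi / 2 * Y" "Z = Y / real (n + 1)" for X Y Z
  proof -
    have c: "real (n + 1) \<noteq> 0" by simp
    have "X = real (n + 1) * X / real (n + 1)"
      by (simp only: nonzero_mult_div_cancel_left[OF c])
    also have "\<dots> = pi / 2 * Y / real (n + 1)"
      unfolding that(1) ..
    finally show ?thesis
      unfolding that(2) by (simp only: times_divide_eq_right)
  qed
  from this[OF P I] show ?thesis .
qed

lemma integral_abs_diff_le:
  fixes f g :: "real \<Rightarrow> real"
  assumes "continuous_on {a..b} f" "continuous_on {a..b} g" "a \<le> b" "\<And>x. x \<in> {a..b} \<Longrightarrow> \<bar>f x - g x\<bar> \<le> e"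
  shows "\<bar>integral {a..b} f - integral {a..b} g\<bar> \<le> e * (b - a)"
proof -
  have i: "f integrable_on {a..b}" "g integrable_on {a..b}"
    using assms by (auto intro: integrable_continuous_real)
  have "norm (integral {a..b} (\<lambda>x. f x - g x)) \<le> integral {a..b} (\<lambda>_. e)"
    using assms by (intro Henstock_Kurzweil_Integration.integral_norm_bound_integral
        Henstock_Kurzweil_Integration.integrable_diff i) auto
  then show ?thesis
    using assms(3) by (simp add: Henstock_Kurzweil_Integration.integral_diff[OF i] mult.commute)
qed

lemma integral_sum_mult:
  fixes f :: "nat \<Rightarrow> real \<Rightarrow> real"
  assumes "\<And>i. continuous_on {a..b} (f i)"
  shows "integral {a..b} (\<lambda>x. \<Sum>i\<le>n. c i * f i x) = (\<Sum>i\<le>n. c i * integral {a..b} (f i))"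
  by (intro integral_unique has_integral_sum has_integral_mult_right integrable_integral
      integrable_continuous_real assms finite_atMost)

text \<open>
  Archimedes' theorem in spherical coordinates: the projection of the area measure of the unit sphere
  to a diameter is uniform. Both sides agree on monomials.
\<close>

lemma archimedes_real:
  fixes F :: "real \<Rightarrow> real"
  assumes F: "continuous_on {-1..1} F"
  shows "integral {0..pi} (\<lambda>\<theta>. integral {0..pi/2} (\<lambda>\<phi>. sin \<phi> * F (cos \<theta> * sin \<phi>))) = pi / 2 * integral {-1..1} F"
proof -
  define L where "L F = integral {0..pi} (\<lambda>\<theta>. integral {0..pi/2} (\<lambda>\<phi>. sin \<phi> * F (cos \<theta> * sin \<phi>)))" for F :: "real \<Rightarrow> real"
  have rng: "cos \<theta> * sin \<phi> \<in> {-1..1}" for \<theta> \<phi> :: real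
  proof -
    have "\<bar>cos \<theta> * sin \<phi>\<bar> \<le> 1 * 1"
      unfolding abs_mult by (intro mult_mono) auto
    then show ?thesis by auto
  qed
  have inner_cont: "continuous_on {0..pi/2} (\<lambda>\<phi>. sin \<phi> * G (cos \<theta> * sin \<phi>))"
    if "continuous_on {-1..1} G" for G \<theta>
    using rng by (intro continuous_intros continuous_on_compose2[OF that]) auto
  have outer_cont: "continuous_on {0..pi} (\<lambda>\<theta>. integral {0..pi/2} (\<lambda>\<phi>. sin \<phi> * G (cos \<theta> * sin \<phi>)))"
    if "continuous_on {-1..1} G" for G
  proof -
    have "continuous_on {0..pi} (\<lambda>\<theta>. integral (cbox 0 (pi/2)) (\<lambda>\<phi>. sin \<phi> * G (cos \<theta> * sin \<phi>)))"
      by (rule integral_continuous_on_param)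
         (use rng in \<open>auto simp: case_prod_beta intro!: continuous_intros continuous_on_compose2[OF that]\<close>)
    then show ?thesis by simp
  qed
  have close: "\<bar>L F - L G\<bar> \<le> e * (pi/2) * pi"
    if G: "continuous_on {-1..1} G" and e: "\<And>x. x \<in> {-1..1} \<Longrightarrow> \<bar>F x - G x\<bar> \<le> e" for G e
  proof -
    have e0: "0 \<le> e" using e[of 0] by auto
    have "\<bar>integral {0..pi/2} (\<lambda>\<phi>. sin \<phi> * F (cos \<theta> * sin \<phi>)) - integral {0..pi/2} (\<lambda>\<phi>. sin \<phi> * G (cos \<theta> * sin \<phi>))\<bar>
        \<le> e * (pi/2 - 0)" for \<theta>
    proof (rule integral_abs_diff_le[OF inner_cont[OF F] inner_cont[OF G]])
      fix \<phi> :: real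
      have "\<bar>sin \<phi>\<bar> * \<bar>F (cos \<theta> * sin \<phi>) - G (cos \<theta> * sin \<phi>)\<bar> \<le> 1 * e"
        by (intro mult_mono e rng) auto
      then show "\<bar>sin \<phi> * F (cos \<theta> * sin \<phi>) - sin \<phi> * G (cos \<theta> * sin \<phi>)\<bar> \<le> e"
        by (simp add: abs_mult flip: right_diff_distrib)
    qed simp
    then have "\<bar>L F - L G\<bar> \<le> e * (pi/2) * (pi - 0)"
      unfolding L_def by (intro integral_abs_diff_le outer_cont F G) auto
    then show ?thesis by simp
  qed
  have poly: "L (\<lambda>x. \<Sum>i\<le>n. a i * x ^ i) = pi / 2 * integral {-1..1} (\<lambda>x. \<Sum>i\<le>n. a i * x ^ i)" for a :: "nat \<Rightarrow> real" and n
  proof -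
    have in1: "integral {0..pi/2} (\<lambda>\<phi>. sin \<phi> * (\<Sum>i\<le>n. a i * (cos \<theta> * sin \<phi>) ^ i)) =
        (\<Sum>i\<le>n. (a i * integral {0..pi/2} (\<lambda>\<phi>. sin \<phi> ^ (i + 1))) * cos \<theta> ^ i)" for \<theta>
    proof -
      have eq: "(\<lambda>\<phi>. sin \<phi> * (\<Sum>i\<le>n. a i * (cos \<theta> * sin \<phi>) ^ i)) = (\<lambda>\<phi>. \<Sum>i\<le>n. (a i * cos \<theta> ^ i) * sin \<phi> ^ (i + 1))"
        by (simp add: sum_distrib_left power_mult_distrib mult_ac)
      have e2: "integral {0..pi/2} (\<lambda>\<phi>. \<Sum>i\<le>n. (a i * cos \<theta> ^ i) * sin \<phi> ^ (i + 1)) = (\<Sum>i\<le>n. (a i * cos \<theta> ^ i) * integral {0..pi/2} (\<lambda>\<phi>. sin \<phi> ^ (i + 1)))"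
        by (rule integral_sum_mult) (intro continuous_intros)
      show ?thesis
        unfolding eq e2 by (simp only: mult_ac)
    qed
    have "L (\<lambda>x. \<Sum>i\<le>n. a i * x ^ i) =
        (\<Sum>i\<le>n. (a i * integral {0..pi/2} (\<lambda>\<phi>. sin \<phi> ^ (i + 1))) * integral {0..pi} (\<lambda>\<theta>. cos \<theta> ^ i))"
      unfolding L_def in1 by (rule integral_sum_mult) (intro continuous_intros)
    also have "\<dots> = (\<Sum>i\<le>n. a i * (pi / 2 * integral {-1..1} (\<lambda>x. x ^ i)))"
      unfolding archimedes_monomial[symmetric] by (simp only: mult_ac)
    also have "\<dots> = pi / 2 * (\<Sum>i\<le>n. a i * integral {-1..1} (\<lambda>x. x ^ i))"
      by (simp only: sum_distrib_left mult_ac)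
    also have "(\<Sum>i\<le>n. a i * integral {-1..1} (\<lambda>x. x ^ i)) = integral {-1..1} (\<lambda>x. \<Sum>i\<le>n. a i * x ^ i)"
      by (rule integral_sum_mult[symmetric]) (intro continuous_intros)
    finally show ?thesis .
  qed
  have "\<bar>L F - pi / 2 * integral {-1..1} F\<bar> \<le> 0 + e" if "e > 0" for e
  proof -
    \<comment> \<open>Replacing \<open>F\<close> by the polynomial costs at most
      \<open>d * (pi / 2) * pi\<close> in the double integral and \<open>(pi / 2) * (2 * d)\<close>
      on the diameter; the denominator is the sum of these two factors.\<close>
    define d where "d = e / (pi/2 * pi + pi)"
    have pp: "pi/2 * pi + pi > 0" by (intro add_pos_pos mult_pos_pos) auto
    have d: "d > 0" using that pp by (simp add: d_def)
    obtain P where P: "real_polynomial_function P" "\<And>x. x \<in> {-1..1} \<Longrightarrow> \<bar>F x - P x\<bar> < d"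
      using Stone_Weierstrass_real_polynomial_function[OF compact_Icc F d] by blast
    obtain a n where a: "P = (\<lambda>x. \<Sum>i\<le>n. a i * x ^ i)"
      using P(1) by (auto simp: real_polynomial_function_iff_sum)
    have Pc: "continuous_on {-1..1} P" unfolding a by (intro continuous_intros)
    have 1: "\<bar>L F - L P\<bar> \<le> d * (pi/2) * pi"
      by (rule close[OF Pc]) (use P(2) in \<open>simp add: less_imp_le\<close>)
    have 2: "\<bar>integral {-1..1} F - integral {-1..1} P\<bar> \<le> d * (1 - - 1)"
      by (rule integral_abs_diff_le[OF F Pc]) (use P(2) in \<open>auto simp: less_imp_le\<close>)
    then have 3: "pi / 2 * \<bar>integral {-1..1} F - integral {-1..1} P\<bar> \<le> pi / 2 * (d * 2)"
      by (intro mult_left_mono) auto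
    have ab: "pi / 2 * \<bar>x - y\<bar> = \<bar>pi / 2 * x - pi / 2 * y\<bar>" for x y
    proof -
      have "pi / 2 * x - pi / 2 * y = pi / 2 * (x - y)" by (simp only: right_diff_distrib)
      then show ?thesis by (simp only: abs_mult) simp
    qed
    have LP: "L P = pi / 2 * integral {-1..1} P"
      unfolding a by (rule poly)
    have "pi / 2 * (d * 2) = d * pi" by simp
    with 3 have 3: "\<bar>pi / 2 * integral {-1..1} F - L P\<bar> \<le> d * pi"
      unfolding ab LP by (simp only:)
    have "d * (pi/2) * pi + d * pi = e"
    proof -
      have "d * (pi/2) * pi + d * pi = d * (pi/2 * pi + pi)"
        by (simp only: distrib_left mult.assoc)
      then show ?thesis using pp by (simp add: d_def)
    qed
    then show ?thesis using 1 3 by linarith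
  qed
  then have "\<bar>L F - pi / 2 * integral {-1..1} F\<bar> \<le> 0"
    by (rule field_le_epsilon)
  then show ?thesis by (simp add: L_def)
qed

section \<open>Inversion of the Abel transform and large-time asymptotics\<close>

text \<open>At time 0 the iterated integral is a mean of \<open>H'\<close> over a sphere of radius
  \<open>r\<close>, depending on one coordinate only. The theorem of Archimedes reduces it to an
  integral along the diameter, which the fundamental theorem of calculus evaluates.\<close>

lemma ring_abel:
  fixes H H' :: "real \<Rightarrow> complex"
  assumes d: "\<And>s. (H has_vector_derivative H' s) (at s)" and c: "continuous_on UNIV H'" and r: "0 < r"
  shows "complex_of_real r * ring (\<lambda>_. 1) (\<lambda>s. integral {0..pi/2} (\<lambda>\<phi>. sin \<phi> *\<^sub>R H' (s * sin \<phi>))) r 0 =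
     complex_of_real (pi / 2) * (H r - H (- r))"
proof -
  have inner: "(\<lambda>\<phi>. sin \<phi> *\<^sub>R H' (s * sin \<phi>)) integrable_on {0..pi/2}" for s
    by (intro integrable_continuous_real continuous_intros continuous_on_compose2[OF c]) auto
  have outer: "(\<lambda>\<theta>. integral {0..pi/2} (\<lambda>\<phi>. sin \<phi> *\<^sub>R H' (r * cos \<theta> * sin \<phi>))) integrable_on {0..pi}"
  proof -
    have "continuous_on {0..pi} (\<lambda>\<theta>. integral (cbox 0 (pi/2)) (\<lambda>\<phi>. sin \<phi> *\<^sub>R H' (r * cos \<theta> * sin \<phi>)))"
      by (rule integral_continuous_on_param)
         (auto simp: case_prod_beta intro!: continuous_intros continuous_on_compose2[OF c])
    then show ?thesis by (simp add: integrable_continuous_real)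
  qed
  have int: "((\<lambda>x. r *\<^sub>R H' (r * x)) has_integral (H (r * 1) - H (r * (- 1)))) {-1..1}"
  proof (rule fundamental_theorem_of_calculus)
    fix x :: real
    have "((\<lambda>x. r * x) has_vector_derivative r) (at x)"
      by (auto intro!: derivative_eq_intros simp flip: has_real_derivative_iff_has_vector_derivative)
    from vector_diff_chain_at[OF this d]
    show "((\<lambda>x. H (r * x)) has_vector_derivative r *\<^sub>R H' (r * x)) (at x within {-1..1})"
      by (simp add: o_def has_vector_derivative_at_within)
  qed simp
  \<comment> \<open>The spherical identity is real-valued, so it is applied after a real-linear
    functional; \<open>Re\<close> and \<open>Im\<close> together determine the complex
    value.\<close>
  have part: "r * l (ring (\<lambda>_. 1) (\<lambda>s. integral {0..pi/2} (\<lambda>\<phi>. sin \<phi> *\<^sub>R H' (s * sin \<phi>))) r 0) =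
      pi / 2 * (l (H r) - l (H (- r)))" if l: "bounded_linear l" for l :: "complex \<Rightarrow> real"
  proof -
    interpret l: bounded_linear l by (rule l)
    have lc: "continuous_on UNIV (\<lambda>x. l (H' (r * x)))"
      by (intro l.continuous_on continuous_on_compose2[OF c] continuous_intros) auto
    have li: "l (integral {0..pi/2} (\<lambda>\<phi>. sin \<phi> *\<^sub>R H' (s * sin \<phi>))) =
        integral {0..pi/2} (\<lambda>\<phi>. sin \<phi> * l (H' (s * sin \<phi>)))" for s
      using integral_linear[OF inner[of s] l] by (simp add: o_def l.scaleR)
    have "l (ring (\<lambda>_. 1) (\<lambda>s. integral {0..pi/2} (\<lambda>\<phi>. sin \<phi> *\<^sub>R H' (s * sin \<phi>))) r 0) =
        integral {0..pi} (\<lambda>\<theta>. l (integral {0..pi/2} (\<lambda>\<phi>. sin \<phi> *\<^sub>R H' (r * cos \<theta> * sin \<phi>))))"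
      unfolding ring_def using integral_linear[OF outer l] by (simp add: o_def)
    also have "\<dots> = integral {0..pi} (\<lambda>\<theta>. integral {0..pi/2} (\<lambda>\<phi>. sin \<phi> * l (H' (r * (cos \<theta> * sin \<phi>)))))"
      unfolding li by (simp only: mult.assoc)
    also have "\<dots> = pi / 2 * integral {-1..1} (\<lambda>x. l (H' (r * x)))"
      by (rule archimedes_real[of "\<lambda>x. l (H' (r * x))"]) (rule continuous_on_subset[OF lc], simp)
    finally have "r * l (ring (\<lambda>_. 1) (\<lambda>s. integral {0..pi/2} (\<lambda>\<phi>. sin \<phi> *\<^sub>R H' (s * sin \<phi>))) r 0) =
        pi / 2 * (r * integral {-1..1} (\<lambda>x. l (H' (r * x))))"
      by simp
    also have "r * integral {-1..1} (\<lambda>x. l (H' (r * x))) = integral {-1..1} (\<lambda>x. r * l (H' (r * x)))"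
      by simp
    also have "\<dots> = l (H r) - l (H (- r))"
    proof (rule integral_unique)
      show "((\<lambda>x. r * l (H' (r * x))) has_integral (l (H r) - l (H (- r)))) {-1..1}"
        using has_integral_linear[OF int l] by (simp add: o_def l.scaleR l.diff)
    qed
    finally show ?thesis .
  qed
  show ?thesis
    using part[OF bounded_linear_Re] part[OF bounded_linear_Im] by (simp add: complex_eq_iff)
qed

text \<open>With a factor \<open>cos \<phi>\<close> inserted, the substitution
  \<open>s = t sin \<phi>\<close> gives exactly \<open>integral {0..R} H / t\<close>. The error
  factor \<open>1 - cos \<phi>\<close> is at most \<open>(sin \<phi>)^2\<close>, which is at most
  \<open>R^2 / t^2\<close> wherever the integrand is nonzero.\<close>

lemma abel_asymptotics:
  fixes H :: "real \<Rightarrow> complex"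
  assumes c: "continuous_on UNIV H" and B: "\<And>s. cmod (H s) \<le> B" and R: "0 \<le> R"
    and supp: "\<And>s. R < s \<Longrightarrow> H s = 0" and t: "R \<le> t" "0 < t"
  shows "cmod (integral {0..pi/2} (\<lambda>\<phi>. H (t * sin \<phi>)) - integral {0..R} H / complex_of_real t) \<le> pi / 2 * (B * R\<^sup>2 / t\<^sup>2)"
proof -
  have B0: "0 \<le> B" using B[of 0] norm_ge_zero order_trans by blast
  have i: "(\<lambda>\<phi>. h \<phi> *\<^sub>R H (t * sin \<phi>)) integrable_on {0..pi/2}" if "continuous_on {0..pi/2} h" for h
    by (intro integrable_continuous_real continuous_intros continuous_on_compose2[OF c] that) auto
  have sub: "((\<lambda>\<phi>. (t * cos \<phi>) *\<^sub>R H (t * sin \<phi>)) has_integral integral {t * sin 0..t * sin (pi/2)} H) {0..pi/2}"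
  proof (rule has_integral_substitution[where c = 0 and d = t])
    show "(\<lambda>\<phi>. t * sin \<phi>) ` {0..pi/2} \<subseteq> {0..t}"
    proof
      fix y assume "y \<in> (\<lambda>\<phi>. t * sin \<phi>) ` {0..pi/2}"
      then obtain \<phi> where \<phi>: "y = t * sin \<phi>" "\<phi> \<in> {0..pi/2}" by blast
      moreover have "0 \<le> sin \<phi>" using \<phi>(2) by (intro sin_ge_zero) auto
      ultimately show "y \<in> {0..t}"
        using t by (simp add: mult_left_le)
    qed
    show "((\<lambda>\<phi>. t * sin \<phi>) has_real_derivative t * cos \<phi>) (at \<phi> within {0..pi/2})" for \<phi>
      by (auto intro!: derivative_eq_intros)
  qed (use t continuous_on_subset[OF c] in auto)
  have "integral {0..t} H = integral {0..R} H"
  proof -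
    have "integral {0..t} H = integral {0..R} H + integral {R..t} H"
      by (intro Henstock_Kurzweil_Integration.integral_combine[symmetric] R t integrable_continuous_real
          continuous_on_subset[OF c]) auto
    moreover have "integral {R..t} H = 0"
    proof (rule integral_unique, rule has_integral_spike_finite[of "{R}"])
      show "H x = 0" if "x \<in> {R..t} - {R}" for x using that supp[of x] by auto
      show "((\<lambda>_. 0) has_integral (0::complex)) {R..t}" by simp
    qed auto
    ultimately show ?thesis by simp
  qed
  then have "((\<lambda>\<phi>. t *\<^sub>R (cos \<phi> *\<^sub>R H (t * sin \<phi>))) has_integral integral {0..R} H) {0..pi/2}"
    using sub by simp
  note sc = has_integral_cmul[OF this, of "inverse t"]
  have e1: "inverse t *\<^sub>R (t *\<^sub>R z) = z" and e2: "inverse t *\<^sub>R z = z / complex_of_real t" for z :: complex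
    using t by (simp, simp add: scaleR_conv_of_real divide_inverse)
  have main: "((\<lambda>\<phi>. cos \<phi> *\<^sub>R H (t * sin \<phi>)) has_integral (integral {0..R} H / complex_of_real t)) {0..pi/2}"
    using sc unfolding e1 unfolding e2 .
  have ic: "(\<lambda>\<phi>. H (t * sin \<phi>)) integrable_on {0..pi/2}"
    using i[of "\<lambda>_. 1"] by simp
  have "((\<lambda>\<phi>. H (t * sin \<phi>) - cos \<phi> *\<^sub>R H (t * sin \<phi>)) has_integral
      (integral {0..pi/2} (\<lambda>\<phi>. H (t * sin \<phi>)) - integral {0..R} H / complex_of_real t)) {0..pi/2}"
    by (rule has_integral_diff[OF integrable_integral[OF ic] main])
  moreover have "cmod (H (t * sin \<phi>) - cos \<phi> *\<^sub>R H (t * sin \<phi>)) \<le> B * R\<^sup>2 / t\<^sup>2" if "\<phi> \<in> {0..pi/2}" for \<phi>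
  proof (cases "t * sin \<phi> \<le> R")
    case False
    then show ?thesis using supp[of "t * sin \<phi>"] B0 by simp
  next
    case True
    have s0: "0 \<le> sin \<phi>" using that by (intro sin_ge_zero) auto
    have c0: "0 \<le> cos \<phi>" using that by (intro cos_ge_zero) auto
    have "t * sin \<phi> * (t * sin \<phi>) \<le> R * R"
      using True s0 t R by (intro mult_mono) auto
    then have s2: "(sin \<phi>)\<^sup>2 \<le> R\<^sup>2 / t\<^sup>2"
      using t by (simp add: field_simps power2_eq_square)
    have "(cos \<phi>)\<^sup>2 \<le> cos \<phi>"
      unfolding power2_eq_square using mult_left_le[OF cos_le_one c0, of \<phi>] by simp
    then have "1 - cos \<phi> \<le> (sin \<phi>)\<^sup>2"
      using sin_cos_squared_add[of \<phi>] by linarith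
    with s2 have "1 - cos \<phi> \<le> R\<^sup>2 / t\<^sup>2" by linarith
    moreover have "H (t * sin \<phi>) - cos \<phi> *\<^sub>R H (t * sin \<phi>) = (1 - cos \<phi>) *\<^sub>R H (t * sin \<phi>)"
      by (simp add: scaleR_left_diff_distrib)
    ultimately have "cmod (H (t * sin \<phi>) - cos \<phi> *\<^sub>R H (t * sin \<phi>)) \<le> R\<^sup>2 / t\<^sup>2 * B"
      using B[of "t * sin \<phi>"] B0 by (simp only: norm_scaleR) (intro mult_mono, auto)
    then show ?thesis by (simp add: mult.commute)
  qed
  ultimately have "cmod (integral {0..pi/2} (\<lambda>\<phi>. H (t * sin \<phi>)) - integral {0..R} H / complex_of_real t)
      \<le> (B * R\<^sup>2 / t\<^sup>2) * measure lborel (cbox 0 (pi/2))"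
    by (intro has_integral_bound[where f = "\<lambda>\<phi>. H (t * sin \<phi>) - cos \<phi> *\<^sub>R H (t * sin \<phi>)"]) (use B0 in auto)
  then show ?thesis by (simp add: mult.commute)
qed

text \<open>Averaging shifts the time by at most \<open>R\<close>, and
  \<open>2 * R + 1 \<le> t\<close> keeps the shifted time above both \<open>R\<close> and
  \<open>t / 2\<close>. The term \<open>4 * K\<close> comes from squaring \<open>t / 2\<close>, the
  term \<open>2 * R * cmod M\<close> from comparing the reciprocals of the two times.\<close>

lemma ring_asymptotics:
  fixes f :: "real \<Rightarrow> complex"
  assumes c: "continuous_on UNIV f" and K: "0 \<le> K" and R: "0 \<le> R"
    and f: "\<And>s. R \<le> s \<Longrightarrow> 0 < s \<Longrightarrow> cmod (f s - M / complex_of_real s) \<le> K / s\<^sup>2"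
    and r: "0 \<le> r" "r \<le> R" and t: "2 * R + 1 \<le> t"
  shows "cmod (ring (\<lambda>_. 1) f r t - complex_of_real pi * M / complex_of_real t) \<le> pi * ((4 * K + 2 * R * cmod M) / t\<^sup>2)"
proof -
  have t0: "0 < t" using t R by linarith
  have i: "(\<lambda>\<theta>. f (t + r * cos \<theta>)) integrable_on {0..pi}"
    by (intro integrable_continuous_real continuous_intros continuous_on_compose2[OF c]) auto
  have "((\<lambda>\<theta>. f (t + r * cos \<theta>) - M / complex_of_real t) has_integral
      (integral {0..pi} (\<lambda>\<theta>. f (t + r * cos \<theta>)) - (pi - 0) *\<^sub>R (M / complex_of_real t))) {0..pi}"
    using has_integral_const_real[of "M / complex_of_real t" 0 pi]
    by (intro has_integral_diff integrable_integral i) simp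
  moreover have "cmod (f (t + r * cos \<theta>) - M / complex_of_real t) \<le> (4 * K + 2 * R * cmod M) / t\<^sup>2" for \<theta>
  proof -
    define s where "s = t + r * cos \<theta>"
    have "\<bar>r * cos \<theta>\<bar> \<le> r * 1"
      unfolding abs_mult using r by (intro mult_mono) auto
    then have rc: "\<bar>r * cos \<theta>\<bar> \<le> R" using r by simp
    then have s: "t / 2 \<le> s" "R \<le> s" "0 < s"
      using t R unfolding s_def by linarith+
    have "(t / 2)\<^sup>2 \<le> s\<^sup>2"
      using s t0 by (intro power_mono) auto
    then have "K / s\<^sup>2 \<le> K / (t / 2)\<^sup>2"
      using t0 K s by (intro divide_left_mono) auto
    then have 1: "cmod (f s - M / complex_of_real s) \<le> 4 * K / t\<^sup>2"
      using f[OF s(2,3)] by (simp add: power_divide mult.commute)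
    have "M / complex_of_real s - M / complex_of_real t = M * complex_of_real ((t - s) / (s * t))"
      using s t0 by (simp add: field_simps)
    then have "cmod (M / complex_of_real s - M / complex_of_real t) = cmod M * (\<bar>t - s\<bar> / (s * t))"
      using s t0 by (simp only: norm_mult norm_of_real) (simp add: abs_mult)
    also have "\<dots> \<le> cmod M * (R / (t / 2 * t))"
      using rc s t0 R by (intro mult_left_mono frac_le mult_right_mono) (auto simp: s_def)
    also have "\<dots> = 2 * R * cmod M / t\<^sup>2"
      by (simp add: power2_eq_square)
    finally have 2: "cmod (M / complex_of_real s - M / complex_of_real t) \<le> 2 * R * cmod M / t\<^sup>2" .
    have "cmod (f s - M / complex_of_real t) \<le>
        cmod (f s - M / complex_of_real s) + cmod (M / complex_of_real s - M / complex_of_real t)"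
      using norm_triangle_ineq[of "f s - M / complex_of_real s" "M / complex_of_real s - M / complex_of_real t"] by simp
    with 1 2 show ?thesis
      by (simp add: s_def add_divide_distrib)
  qed
  ultimately have "cmod (integral {0..pi} (\<lambda>\<theta>. f (t + r * cos \<theta>)) - (pi - 0) *\<^sub>R (M / complex_of_real t))
      \<le> ((4 * K + 2 * R * cmod M) / t\<^sup>2) * measure lborel (cbox 0 pi)"
    using K R by (intro has_integral_bound[where f = "\<lambda>\<theta>. f (t + r * cos \<theta>) - M / complex_of_real t"]) auto
  then show ?thesis
    by (simp add: ring_def scaleR_conv_of_real mult.commute)
qed

section \<open>Abstract wave equations\<close>

text \<open>The quantity \<open>F s\<close> is constant: products of first derivatives cancel, and
  products with second derivatives cancel by symmetry. Comparing \<open>s = t\<close> with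
  \<open>s = 0\<close> involves only times in \<open>[0, 2 t]\<close>, so derivatives within the
  half-line are enough.\<close>

lemma wave_polarization:
  fixes w w' w'' :: "real \<Rightarrow> 'a::real_inner"
  assumes d1: "\<And>t. 0 \<le> t \<Longrightarrow> (w has_vector_derivative w' t) (at t within {0..})"
    and d2: "\<And>t. 0 \<le> t \<Longrightarrow> (w' has_vector_derivative w'' t) (at t within {0..})"
    and sym: "\<And>s t. 0 \<le> s \<Longrightarrow> 0 \<le> t \<Longrightarrow> w'' s \<bullet> w t = w s \<bullet> w'' t"
    and t: "0 \<le> t"
  shows "w (2 * t) \<bullet> w' 0 + w' (2 * t) \<bullet> w 0 = 2 * (w t \<bullet> w' t)"
proof -
  have fwd: "((\<lambda>s. f (t + s)) has_vector_derivative f' (t + s)) (at s within {0..t})"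
    if f: "\<And>t. 0 \<le> t \<Longrightarrow> (f has_vector_derivative f' t) (at t within {0..})" and s: "s \<in> {0..t}"
    for f f' :: "real \<Rightarrow> 'a" and s
  proof -
    have "((\<lambda>s. t + s) has_vector_derivative 1) (at s within {0..t})"
      by (auto intro!: derivative_eq_intros simp flip: has_real_derivative_iff_has_vector_derivative)
    moreover have "(f has_vector_derivative f' (t + s)) (at (t + s) within (\<lambda>s. t + s) ` {0..t})"
      by (rule has_vector_derivative_within_subset[OF f]) (use s t in auto)
    ultimately show ?thesis
      using vector_diff_chain_within by (force simp: o_def)
  qed
  have bwd: "((\<lambda>s. f (t - s)) has_vector_derivative - f' (t - s)) (at s within {0..t})"
    if f: "\<And>t. 0 \<le> t \<Longrightarrow> (f has_vector_derivative f' t) (at t within {0..})" and s: "s \<in> {0..t}"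
    for f f' :: "real \<Rightarrow> 'a" and s
  proof -
    have "((\<lambda>s. t - s) has_vector_derivative - 1) (at s within {0..t})"
      by (auto intro!: derivative_eq_intros simp flip: has_real_derivative_iff_has_vector_derivative)
    moreover have "(f has_vector_derivative f' (t - s)) (at (t - s) within (\<lambda>s. t - s) ` {0..t})"
      by (rule has_vector_derivative_within_subset[OF f]) (use s t in auto)
    ultimately show ?thesis
      using vector_diff_chain_within by (force simp: o_def)
  qed
  define F where "F s = w (t + s) \<bullet> w' (t - s) + w' (t + s) \<bullet> w (t - s)" for s
  have "(F has_vector_derivative 0) (at s within {0..t})" if s: "s \<in> {0..t}" for s
  proof -
    have "(F has_vector_derivative
        (w (t + s) \<bullet> - w'' (t - s) + w' (t + s) \<bullet> w' (t - s)) +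
        (w' (t + s) \<bullet> - w' (t - s) + w'' (t + s) \<bullet> w (t - s))) (at s within {0..t})"
      unfolding F_def[abs_def]
      by (intro has_vector_derivative_add bounded_bilinear.has_vector_derivative[OF bounded_bilinear_inner]
          fwd bwd d1 d2 s)
    then show ?thesis
      using sym[of "t + s" "t - s"] s t by simp
  qed
  then obtain c where "\<And>s. s \<in> {0..t} \<Longrightarrow> F s = c"
    using has_vector_derivative_zero_constant[of "{0..t}" F] by (auto simp: convex_closed_interval)
  then have "F t = F 0" using t by simp
  then show ?thesis
    by (simp add: F_def inner_commute flip: mult_2)
qed

lemma wave_norm_derivative:
  fixes w w' w'' :: "real \<Rightarrow> 'a::real_inner"
  assumes d1: "\<And>t. 0 \<le> t \<Longrightarrow> (w has_vector_derivative w' t) (at t within {0..})"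
    and d2: "\<And>t. 0 \<le> t \<Longrightarrow> (w' has_vector_derivative w'' t) (at t within {0..})"
    and sym: "\<And>s t. 0 \<le> s \<Longrightarrow> 0 \<le> t \<Longrightarrow> w'' s \<bullet> w t = w s \<bullet> w'' t"
    and w0: "w 0 = 0" and t: "0 \<le> t"
  shows "((\<lambda>t. w t \<bullet> w t) has_vector_derivative w (2 * t) \<bullet> w' 0) (at t within {0..})"
proof -
  have "((\<lambda>t. w t \<bullet> w t) has_vector_derivative w t \<bullet> w' t + w' t \<bullet> w t) (at t within {0..})"
    by (intro bounded_bilinear.has_vector_derivative[OF bounded_bilinear_inner] d1 t)
  moreover have "w t \<bullet> w' t + w' t \<bullet> w t = w (2 * t) \<bullet> w' 0"
    using wave_polarization[OF d1 d2 sym t] by (simp add: w0 inner_commute)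
  ultimately show ?thesis by simp
qed

text \<open>With zero data the polarization identity makes the derivative of the squared norm
  vanish, so uniqueness follows from symmetry without an energy estimate.\<close>

lemma wave_unique:
  fixes w w' w'' :: "real \<Rightarrow> 'a::real_inner"
  assumes d1: "\<And>t. 0 \<le> t \<Longrightarrow> (w has_vector_derivative w' t) (at t within {0..})"
    and d2: "\<And>t. 0 \<le> t \<Longrightarrow> (w' has_vector_derivative w'' t) (at t within {0..})"
    and sym: "\<And>s t. 0 \<le> s \<Longrightarrow> 0 \<le> t \<Longrightarrow> w'' s \<bullet> w t = w s \<bullet> w'' t"
    and w0: "w 0 = 0" and w'0: "w' 0 = 0" and t: "0 \<le> t"
  shows "w t = 0"
proof -
  have "((\<lambda>t. w t \<bullet> w t) has_vector_derivative 0) (at t within {0..})" if "t \<in> {0..}" for t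
    using wave_norm_derivative[OF d1 d2 sym w0] that by (simp add: w'0)
  then obtain c where "\<And>t. t \<in> {0..} \<Longrightarrow> w t \<bullet> w t = c"
    using has_vector_derivative_zero_constant[of "{0..}" "\<lambda>t. w t \<bullet> w t"] by auto
  then have "w t \<bullet> w t = w 0 \<bullet> w 0" using t by simp
  then show ?thesis by (simp add: w0)
qed

lemma wave_solution_unique:
  assumes sym: "\<And>u f v h. (u, f) \<in> S \<Longrightarrow> (v, h) \<in> S \<Longrightarrow> f \<bullet> v = u \<bullet> h"
    and w: "wave_solution S g w" and z: "wave_solution S g z" and t: "0 \<le> t"
  shows "w t = z t"
proof -
  obtain w' w'' where w: "w 0 = 0" "w' 0 = g"
    "\<And>t. 0 \<le> t \<Longrightarrow> (w has_vector_derivative w' t) (at t within {0..})"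
    "\<And>t. 0 \<le> t \<Longrightarrow> (w' has_vector_derivative w'' t) (at t within {0..})"
    "\<And>t. 0 \<le> t \<Longrightarrow> (w t, - w'' t) \<in> S"
    using w unfolding wave_solution_def by blast
  obtain z' z'' where z: "z 0 = 0" "z' 0 = g"
    "\<And>t. 0 \<le> t \<Longrightarrow> (z has_vector_derivative z' t) (at t within {0..})"
    "\<And>t. 0 \<le> t \<Longrightarrow> (z' has_vector_derivative z'' t) (at t within {0..})"
    "\<And>t. 0 \<le> t \<Longrightarrow> (z t, - z'' t) \<in> S"
    using z unfolding wave_solution_def by blast
  have "(\<lambda>t. w t - z t) t = 0"
  proof (rule wave_unique[where w' = "\<lambda>t. w' t - z' t" and w'' = "\<lambda>t. w'' t - z'' t"])
    fix s t :: real assume st: "0 \<le> s" "0 \<le> t"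
    show "(w'' s - z'' s) \<bullet> (w t - z t) = (w s - z s) \<bullet> (w'' t - z'' t)"
      using sym[OF w(5)[OF st(1)] w(5)[OF st(2)]] sym[OF w(5)[OF st(1)] z(5)[OF st(2)]]
        sym[OF z(5)[OF st(1)] w(5)[OF st(2)]] sym[OF z(5)[OF st(1)] z(5)[OF st(2)]]
      by (simp add: inner_diff_left inner_diff_right)
  qed (use w z t in \<open>auto intro: has_vector_derivative_diff\<close>)
  then show ?thesis by simp
qed

text \<open>Solutions are constrained only at nonnegative times, and there any two of them agree;
  this resolves the definite description in favour of the given one.\<close>

lemma wave_propagator_eq:
  assumes "\<And>u f v h. (u, f) \<in> S \<Longrightarrow> (v, h) \<in> S \<Longrightarrow> f \<bullet> v = u \<bullet> h"
    and "wave_solution S g w" and "0 \<le> t"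
  shows "wave_propagator S t g = w t"
  unfolding wave_propagator_def
proof (rule the_equality)
  show "\<exists>w'. wave_solution S g w' \<and> w t = w' t" using assms(2) by blast
  show "u = w t" if "\<exists>w. wave_solution S g w \<and> u = w t" for u
    using that wave_solution_unique[OF assms(1) _ assms(2) assms(3)] by blast
qed

text \<open>A zero at \<open>t > 0\<close> makes the solution odd about both \<open>0\<close> and \<open>t\<close>, hence \<open>2 t\<close>-periodic.\<close>

lemma wave_nonzero:
  fixes w w' w'' :: "real \<Rightarrow> 'a::real_inner"
  assumes d1: "\<And>t. (w has_vector_derivative w' t) (at t)"
    and d2: "\<And>t. (w' has_vector_derivative w'' t) (at t)"
    and sym: "\<And>s t. w'' s \<bullet> w t = w s \<bullet> w'' t"
    and w0: "w 0 = 0" and t: "0 < t"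
    and large: "\<And>s. T \<le> s \<Longrightarrow> w s \<noteq> 0"
  shows "w t \<noteq> 0"
proof
  assume wt: "w t = 0"
  have shift: "((\<lambda>s. f (c + s)) has_vector_derivative f' (c + s)) (at s within X)"
    "((\<lambda>s. f (c - s)) has_vector_derivative - f' (c - s)) (at s within X)"
    if f: "\<And>t. (f has_vector_derivative f' t) (at t)" for f f' :: "real \<Rightarrow> 'a" and c s X
  proof -
    have 1: "((\<lambda>s. c + s) has_vector_derivative 1) (at s)" "((\<lambda>s. c - s) has_vector_derivative - 1) (at s)"
      by (auto intro!: derivative_eq_intros simp flip: has_real_derivative_iff_has_vector_derivative)
    show "((\<lambda>s. f (c + s)) has_vector_derivative f' (c + s)) (at s within X)"
      "((\<lambda>s. f (c - s)) has_vector_derivative - f' (c - s)) (at s within X)"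
      using vector_diff_chain_at[OF 1(1) f] vector_diff_chain_at[OF 1(2) f]
      by (simp_all add: o_def has_vector_derivative_at_within)
  qed
  \<comment> \<open>The even combination \<open>w (c + s) + w (c - s)\<close> solves the same
    equation and has zero initial velocity; its initial value vanishes when \<open>w c = 0\<close>,
    so uniqueness applies.\<close>
  have odd: "w (c + s) = - w (c - s)" if c: "w c = 0" and s: "0 \<le> s" for c s
  proof -
    have "(\<lambda>s. w (c + s) + w (c - s)) s = 0"
    proof (rule wave_unique[where w = "\<lambda>s. w (c + s) + w (c - s)" and t = s and w' = "\<lambda>s. w' (c + s) + - w' (c - s)" and w'' = "\<lambda>s. w'' (c + s) + - (- w'' (c - s))"])
      show "((\<lambda>s. w (c + s) + w (c - s)) has_vector_derivative w' (c + s) + - w' (c - s)) (at s within {0..})" for s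
        by (intro has_vector_derivative_add shift d1)
      show "((\<lambda>s. w' (c + s) + - w' (c - s)) has_vector_derivative w'' (c + s) + - (- w'' (c - s))) (at s within {0..})" for s
        by (intro has_vector_derivative_add has_vector_derivative_minus shift d2)
    qed (use c s sym in \<open>simp_all add: inner_add_left inner_add_right\<close>)
    then show ?thesis by (simp add: add_eq_0_iff2)
  qed
  have per: "w (s + 2 * t) = w s" if "0 \<le> s" for s
  proof -
    have "w (s + 2 * t) = - w (- s)"
      using odd[OF wt, of "s + t"] that t by (simp add: algebra_simps)
    moreover have "w s = - w (- s)"
      using odd[OF w0 that] by simp
    ultimately show ?thesis by simp
  qed
  have "w (real k * (2 * t)) = 0" for k
  proof (induction k)
    case (Suc k)
    then show ?case
      using per[of "real k * (2 * t)"] t by (simp add: algebra_simps)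
  qed (simp add: w0)
  moreover obtain k where "T / (2 * t) \<le> real k"
    using real_arch_simple by blast
  then have "T \<le> real k * (2 * t)"
    using t by (simp add: field_simps)
  ultimately show False using large by blast
qed

section \<open>From the derivative of the squared norm to logarithmic bounds\<close>

text \<open>The function \<open>E t - c * ln t + K / t\<close> is nonincreasing and
  \<open>E t - c * ln t - K / t\<close> is nondecreasing beyond \<open>T\<close>. Hence
  \<open>E t - c * ln t\<close> stays bounded and disappears on division by
  \<open>ln t\<close>.\<close>

lemma logarithmic_growth:
  fixes E e :: "real \<Rightarrow> real"
  assumes d: "\<And>t. 0 < t \<Longrightarrow> (E has_real_derivative e t) (at t)"
    and c: "0 < c" and T: "1 \<le> T"
    and e: "\<And>t. T \<le> t \<Longrightarrow> \<bar>e t - c / t\<bar> \<le> K / t\<^sup>2"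
  shows "((\<lambda>t. E t / ln t) \<longlongrightarrow> c) at_top"
proof -
  have K: "0 \<le> K" using e[of T] T by (metis abs_ge_zero order_trans order_refl zero_le_divide_iff not_less zero_less_power less_le_trans zero_less_one linorder_not_le)
  have mono: "E t - c * ln t + K / t \<le> E T - c * ln T + K / T"
    "E T - c * ln T - K / T \<le> E t - c * ln t - K / t" if "T \<le> t" for t
  proof -
    have der: "((\<lambda>t. E t - c * ln t + k / t) has_real_derivative e t - c / t - k / t\<^sup>2) (at t)" if "T \<le> t" for t k
      using that T by (auto intro!: derivative_eq_intros d simp: power2_eq_square field_simps)
    show "E t - c * ln t + K / t \<le> E T - c * ln T + K / T"
    proof (rule DERIV_nonpos_imp_nonincreasing[OF that])
      fix x assume "T \<le> x"
      then show "\<exists>y. ((\<lambda>t. E t - c * ln t + K / t) has_real_derivative y) (at x) \<and> y \<le> 0"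
        using der[of x K] e[of x] by (intro exI[of _ "e x - c / x - K / x\<^sup>2"]) (auto simp: abs_le_iff)
    qed
    have "E T - c * ln T + (- K) / T \<le> E t - c * ln t + (- K) / t"
    proof (rule DERIV_nonneg_imp_nondecreasing[OF that])
      fix x assume "T \<le> x"
      then show "\<exists>y. ((\<lambda>t. E t - c * ln t + (- K) / t) has_real_derivative y) (at x) \<and> y \<ge> 0"
        using der[of x "- K"] e[of x] by (intro exI[of _ "e x - c / x - (- K) / x\<^sup>2"]) (auto simp: abs_le_iff)
    qed
    then show "E T - c * ln T - K / T \<le> E t - c * ln t - K / t" by simp
  qed
  define a where "a = E T - c * ln T - K / T"
  define b where "b = E T - c * ln T + K / T"
  have ln_inf: "filterlim ln at_top (at_top :: real filter)" by (rule ln_at_top)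
  have ev: "\<forall>\<^sub>F t in at_top. T \<le> t \<and> 1 < t"
    by (intro eventually_conj eventually_ge_at_top eventually_gt_at_top)
  have "((\<lambda>t. c + a / ln t) \<longlongrightarrow> c + 0) at_top" "((\<lambda>t. c + b / ln t) \<longlongrightarrow> c + 0) at_top"
    by (intro tendsto_add tendsto_const real_tendsto_divide_at_top[OF tendsto_const ln_inf])+
  then have lim: "((\<lambda>t. c + a / ln t) \<longlongrightarrow> c) at_top" "((\<lambda>t. c + b / ln t) \<longlongrightarrow> c) at_top"
    by simp_all
  show ?thesis
  proof (rule real_tendsto_sandwich[OF _ _ lim])
    have "c + a / ln t \<le> E t / ln t \<and> E t / ln t \<le> c + b / ln t" if "T \<le> t \<and> 1 < t" for t
    proof -
      have "0 \<le> K / t" using that K by simp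
      then have "c * ln t + a \<le> E t" "E t \<le> c * ln t + b"
        using mono[of t] that unfolding a_def b_def by linarith+
      moreover have "0 < ln t" using that by simp
      ultimately have "(c * ln t + a) / ln t \<le> E t / ln t \<and> E t / ln t \<le> (c * ln t + b) / ln t"
        by (intro conjI divide_right_mono) auto
      with \<open>0 < ln t\<close> show ?thesis by (simp add: add_divide_distrib)
    qed
    with ev show "\<forall>\<^sub>F t in at_top. c + a / ln t \<le> E t / ln t" "\<forall>\<^sub>F t in at_top. E t / ln t \<le> c + b / ln t"
      by (auto elim!: eventually_mono)
  qed
qed

text \<open>Beyond some \<open>T\<close> the limit gives the bounds \<open>c / 2\<close> and
  \<open>2 * c\<close>. Up to \<open>T\<close> compactness does, and pointwise positivity keeps the
  minimum away from zero.\<close>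

lemma positive_continuous_limit_bounds:
  fixes f :: "real \<Rightarrow> real"
  assumes cont: "continuous_on {a..} f" and pos: "\<And>t. a \<le> t \<Longrightarrow> 0 < f t"
    and lim: "(f \<longlongrightarrow> c) at_top" and c: "0 < c"
  obtains C where "1 \<le> C" "\<And>t. a \<le> t \<Longrightarrow> inverse C \<le> f t \<and> f t \<le> C"
proof -
  have "\<forall>\<^sub>F t in at_top. c / 2 < f t \<and> f t < 2 * c"
    using order_tendstoD(1)[OF lim, of "c / 2"] order_tendstoD(2)[OF lim, of "2 * c"] c
    by (intro eventually_conj) auto
  then obtain T0 where T0: "\<And>t. T0 \<le> t \<Longrightarrow> c / 2 < f t \<and> f t < 2 * c"
    by (auto simp: eventually_at_top_linorder)
  define T where "T = max a T0"
  have comp: "compact {a..T}" "{a..T} \<noteq> {}" "continuous_on {a..T} f"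
    using continuous_on_subset[OF cont, of "{a..T}"] by (auto simp: T_def)
  obtain x where x: "x \<in> {a..T}" "\<And>t. t \<in> {a..T} \<Longrightarrow> f x \<le> f t"
    using continuous_attains_inf[OF comp] by blast
  obtain y where y: "y \<in> {a..T}" "\<And>t. t \<in> {a..T} \<Longrightarrow> f t \<le> f y"
    using continuous_attains_sup[OF comp] by blast
  define l where "l = min (c / 2) (f x)"
  define u where "u = max (2 * c) (f y)"
  define C where "C = max 1 (max u (inverse l))"
  have l: "0 < l" using c pos[of x] x(1) by (simp add: l_def)
  have lu: "l \<le> f t \<and> f t \<le> u" if "a \<le> t" for t
  proof (cases "t \<le> T")
    case True
    then show ?thesis using x(2)[of t] y(2)[of t] that by (auto simp: l_def u_def)
  next
    case False
    then have "c / 2 < f t \<and> f t < 2 * c"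
      by (intro T0) (simp add: T_def)
    then show ?thesis
      by (auto simp: l_def u_def min_le_iff_disj le_max_iff_disj)
  qed
  have "inverse C \<le> l"
  proof -
    have "inverse C \<le> inverse (inverse l)"
      using l by (intro le_imp_inverse_le) (auto simp: C_def)
    then show ?thesis by simp
  qed
  moreover have "u \<le> C" by (simp add: C_def)
  moreover have "1 \<le> C" by (simp add: C_def)
  ultimately show thesis
    using lu by (intro that[of C]) (auto intro: order_trans)
qed

section \<open>Radial solutions of the critical wave equation\<close>

lemma smooth_add: "open U \<Longrightarrow> smooth U f \<Longrightarrow> smooth U g \<Longrightarrow> smooth U (\<lambda>t. f t + g t)"
  unfolding smooth_def using smooth_order_add by blast

lemma smooth_diff:
  assumes "open U" "smooth U f" "smooth U g"
  shows "smooth U (\<lambda>t. f t - g t)"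
proof -
  have "smooth U (\<lambda>t. f t + (- 1) * g t)"
    by (intro smooth_add smooth_mult smooth_const assms)
  then show ?thesis by simp
qed

lemma radial_profile_continuous: "\<phi> \<in> radial_profiles \<Longrightarrow> continuous_on UNIV \<phi>"
  by (intro continuous_at_imp_continuous_on ballI)
     (rule has_vector_derivative_continuous[OF radial_profile_has_vector_derivative(1)])

lemma ring_norm_le:
  fixes f :: "real \<Rightarrow> complex"
  assumes "continuous_on UNIV f" "\<And>s. cmod (f s) \<le> B"
  shows "cmod (ring (\<lambda>_. 1) f r t) \<le> pi * B"
proof -
  have "cmod (integral {0..pi} (\<lambda>\<theta>. f (t + r * cos \<theta>))) \<le> integral {0..pi} (\<lambda>_. B)"
    by (intro Henstock_Kurzweil_Integration.integral_norm_bound_integral integrable_continuous_real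
        continuous_intros continuous_on_compose2[OF assms(1)] assms(2)) auto
  then show ?thesis by (simp add: ring_def)
qed

lemma ring_linear:
  fixes f g h :: "real \<Rightarrow> complex"
  assumes "continuous_on UNIV f" "continuous_on UNIV g" "continuous_on UNIV h"
  shows "ring (\<lambda>_. 1) (\<lambda>s. f s - g s - c *\<^sub>R h s) r t =
    ring (\<lambda>_. 1) f r t - ring (\<lambda>_. 1) g r t - c *\<^sub>R ring (\<lambda>_. 1) h r t"
proof -
  have i: "(\<lambda>\<theta>. f (t + r * cos \<theta>)) integrable_on {0..pi}" if "continuous_on UNIV f" for f :: "real \<Rightarrow> complex"
    by (intro integrable_continuous_real continuous_intros continuous_on_compose2[OF that]) auto
  show ?thesis
    unfolding ring_def scaleR_one
    by (intro integral_unique has_integral_diff has_integral_cmul integrable_integral i assms)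
qed

text \<open>
  \<open>D k\<close> is the \<open>k\<close>-th derivative of a profile whose ring average is a radial wave in the plane;
  \<open>\<theta>\<close> is a smooth step, applied below to \<open>ln r\<close>.
\<close>

locale radial_wave =
  fixes D :: "nat \<Rightarrow> real \<Rightarrow> complex" and a b :: real and \<theta> :: "real \<Rightarrow> complex"
  assumes D_deriv: "\<And>k t. (D k has_vector_derivative D (Suc k) t) (at t)"
    and D_bounded: "\<And>k. \<exists>B. \<forall>t. cmod (D k t) \<le> B"
    and a_nonneg: "0 \<le> a"
    and support: "\<And>r t. a + \<bar>t\<bar> < r \<Longrightarrow> ring (\<lambda>_. 1) (D 0) r t = 0"
    and cutoff: "smooth UNIV \<theta>" "\<And>s. s \<le> 0 \<Longrightarrow> \<theta> s = 0" "\<And>s. b \<le> s \<Longrightarrow> \<theta> s = 1"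
    and b_pos: "0 < b"
begin

text \<open>The index counts time derivatives: ring averaging commutes with differentiation in time,
  so \<open>v k\<close> is the \<open>k\<close>-th time derivative of the plane wave.\<close>

definition v :: "nat \<Rightarrow> real \<Rightarrow> real \<Rightarrow> complex" where
  "v k r t = ring (\<lambda>_. 1) (D k) r t"

lemma D_cont: "continuous_on UNIV (D k)"
  by (intro continuous_at_imp_continuous_on ballI) (rule has_vector_derivative_continuous[OF D_deriv])

lemma v_time: "((\<lambda>t. v k r t) has_vector_derivative v (Suc k) r t) (at t)"
  unfolding v_def by (rule ring_deriv_time[OF D_deriv D_cont]) simp

lemma v_support: "a + \<bar>t\<bar> < r \<Longrightarrow> v k r t = 0"
proof (induction k arbitrary: t)
  case (Suc k)
  have "((\<lambda>t. v k r t) has_vector_derivative 0) (at t)"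
  proof (rule has_vector_derivative_transform_within_open[of "\<lambda>_. 0" _ _ "{s. a + \<bar>s\<bar> < r}"])
    show "open {s. a + \<bar>s\<bar> < r}"
      by (intro open_Collect_less continuous_intros)
  qed (use Suc in auto)
  then show ?case
    using vector_derivative_unique_at[OF v_time] by blast
qed (simp add: v_def support)

lemma v_cont: "continuous_on UNIV (\<lambda>r. v k r t)"
  unfolding v_def by (intro continuous_on_ring D_cont continuous_intros)

lemma v_measurable: "(\<lambda>r. v k r t) \<in> borel_measurable borel"
  by (rule borel_measurable_continuous_onI[OF v_cont])

lemma v_bounded:
  obtains B where "0 \<le> B" "\<And>r t. cmod (v k r t) \<le> B"
proof -
  obtain B where B: "\<forall>t. cmod (D k t) \<le> B" using D_bounded by blast
  then have "0 \<le> B" using norm_ge_zero order_trans by blast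
  moreover have "cmod (v k r t) \<le> pi * B" for r t
    unfolding v_def using B by (intro ring_norm_le D_cont) auto
  ultimately show thesis by (intro that[of "pi * B"]) auto
qed

text \<open>The quadratic remainder is uniform in radius and time. Together with supports that are
  bounded locally in time, this turns pointwise time derivatives into derivatives of curves in the
  Hilbert space.\<close>

lemma v_taylor:
  obtains B where "0 \<le> B" "\<And>r t h. cmod (v k r (t + h) - v k r t - h *\<^sub>R v (Suc k) r t) \<le> B * h\<^sup>2"
proof -
  obtain B where B: "\<And>t. cmod (D (Suc (Suc k)) t) \<le> B" using D_bounded by blast
  have B0: "0 \<le> B" using B[of 0] norm_ge_zero order_trans by blast
  have lip: "cmod (D (Suc k) x - D (Suc k) y) \<le> B * \<bar>x - y\<bar>" for x y
  proof -
    have "norm (D (Suc k) x - D (Suc k) y) \<le> B * norm (x - y)"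
    proof (rule differentiable_bound[OF convex_UNIV])
      show "(D (Suc k) has_derivative (\<lambda>h. h *\<^sub>R D (Suc (Suc k)) s)) (at s within UNIV)" for s
        using D_deriv[of "Suc k" s] by (simp add: has_vector_derivative_def)
      show "onorm (\<lambda>h::real. h *\<^sub>R D (Suc (Suc k)) s) \<le> B" for s
        using B onorm_scaleR_left[OF bounded_linear_ident, of "D (Suc (Suc k)) s"] by (simp add: onorm_id)
    qed auto
    then show ?thesis by simp
  qed
  have tay: "cmod (D k (s + h) - D k s - h *\<^sub>R D (Suc k) s) \<le> B * h\<^sup>2" for s h
  proof -
    have "norm (D k (s + h) - D k s - ((s + h) - s) *\<^sub>R D (Suc k) s) \<le> norm ((s + h) - s) * (B * \<bar>h\<bar>)"
    proof (rule vector_differentiable_bound_linearization[where S = "closed_segment s (s + h)"])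
      show "(D k has_vector_derivative D (Suc k) x) (at x within closed_segment s (s + h))" for x
        by (rule has_vector_derivative_at_within[OF D_deriv])
      show "cmod (D (Suc k) x - D (Suc k) s) \<le> B * \<bar>h\<bar>" if "x \<in> closed_segment s (s + h)" for x
      proof -
        have "\<bar>x - s\<bar> \<le> \<bar>h\<bar>"
          using that by (auto simp: closed_segment_eq_real_ivl split: if_splits)
        then have "B * \<bar>x - s\<bar> \<le> B * \<bar>h\<bar>" using B0 by (rule mult_left_mono)
        with lip[of x s] show ?thesis by linarith
      qed
    qed auto
    also have "norm ((s + h) - s) * (B * \<bar>h\<bar>) = B * (\<bar>h\<bar> * \<bar>h\<bar>)"
      by (simp only: add_diff_cancel_left' real_norm_def mult.left_commute)
    finally show ?thesis by (simp add: power2_eq_square)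
  qed
  have "cmod (v k r (t + h) - v k r t - h *\<^sub>R v (Suc k) r t) \<le> pi * (B * h\<^sup>2)" for r t h
  proof -
    have c: "continuous_on UNIV (\<lambda>s. D k (s + h))"
      by (intro continuous_on_compose2[OF D_cont] continuous_intros) auto
    have "v k r (t + h) = ring (\<lambda>_. 1) (\<lambda>s. D k (s + h)) r t"
      by (simp add: v_def ring_def add_ac)
    then have "v k r (t + h) - v k r t - h *\<^sub>R v (Suc k) r t =
        ring (\<lambda>_. 1) (\<lambda>s. D k (s + h) - D k s - h *\<^sub>R D (Suc k) s) r t"
      unfolding v_def by (simp only: ring_linear[OF c D_cont D_cont])
    also have "cmod \<dots> \<le> pi * (B * h\<^sup>2)"
      by (intro ring_norm_le tay continuous_intros c D_cont)
    finally show ?thesis .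
  qed
  then show thesis using B0 by (intro that[of "pi * B"]) (auto simp: mult.assoc)
qed

section \<open>The wave as a smooth curve in the Hilbert space\<close>

definition wave :: "nat \<Rightarrow> real \<Rightarrow> 'a::euclidean_space l2" where
  "wave k t = abs_l2 (hardy_lift (\<lambda>r. v k r t))"

lemma wave_square_integrable: "square_integrable (hardy_lift (\<lambda>r. v k r t) :: 'a::euclidean_space \<Rightarrow> complex)"
proof -
  obtain B where B: "0 \<le> B" "\<And>r t. cmod (v k r t) \<le> B"
    using v_bounded[of k] by blast
  show ?thesis
    by (rule hardy_lift_bounded(1)[of _ "a + \<bar>t\<bar>" B]) (use v_measurable a_nonneg B v_support in auto)
qed

lemma wave_has_vector_derivative:
  "(wave k has_vector_derivative (wave (Suc k) t :: 'a::euclidean_space l2)) (at t)"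
proof -
  obtain B where B: "0 \<le> B" "\<And>r t h. cmod (v k r (t + h) - v k r t - h *\<^sub>R v (Suc k) r t) \<le> B * h\<^sup>2"
    using v_taylor[of k] by blast
  \<comment> \<open>The radius \<open>a + \<bar>t\<bar> + 1\<close> contains the supports at all
    times \<open>t + h\<close> with \<open>\<bar>h\<bar> \<le> 1\<close>.\<close>
  define C where "C = sqrt (sphere_area DIM('a)) * ((a + \<bar>t\<bar> + 1) * B)"
  have C: "0 \<le> C"
    unfolding C_def using a_nonneg B(1) sphere_area_pos[where 'a='a] by (intro mult_nonneg_nonneg) auto
  have est: "norm (wave k (t + h) - wave k t - h *\<^sub>R (wave (Suc k) t :: 'a l2)) \<le> C * h\<^sup>2" if h: "\<bar>h\<bar> \<le> 1" for h
  proof -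
    let ?f = "\<lambda>r. v k r (t + h) - v k r t - h *\<^sub>R v (Suc k) r t"
    have s: "square_integrable (\<lambda>x. complex_of_real h * hardy_lift (\<lambda>r. v (Suc k) r t) (x::'a))"
      by (intro square_integrable_cmult wave_square_integrable)
    have d: "square_integrable (\<lambda>x. hardy_lift (\<lambda>r. v k r (t + h)) x - hardy_lift (\<lambda>r. v k r t) (x::'a))"
      using square_integrable_add[OF wave_square_integrable square_integrable_cmult[OF wave_square_integrable, where c = "-1"]]
      by simp
    have "h *\<^sub>R (wave (Suc k) t :: 'a l2) = abs_l2 (\<lambda>x. complex_of_real h * hardy_lift (\<lambda>r. v (Suc k) r t) x)"
      unfolding wave_def by (intro scaleR_l2.abs_eq) (simp add: l2_rel_def wave_square_integrable)
    then have "wave k (t + h) - wave k t - h *\<^sub>R (wave (Suc k) t :: 'a l2) =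
        abs_l2 (\<lambda>x. hardy_lift (\<lambda>r. v k r (t + h)) x - hardy_lift (\<lambda>r. v k r t) x -
          complex_of_real h * hardy_lift (\<lambda>r. v (Suc k) r t) x)"
      by (simp only: wave_def abs_l2_diff[OF wave_square_integrable wave_square_integrable] abs_l2_diff[OF d s])
    also have "(\<lambda>x. hardy_lift (\<lambda>r. v k r (t + h)) x - hardy_lift (\<lambda>r. v k r t) x -
          complex_of_real h * hardy_lift (\<lambda>r. v (Suc k) r t) x) = (hardy_lift ?f :: 'a \<Rightarrow> complex)"
      by (simp add: hardy_lift_def fun_eq_iff algebra_simps scaleR_conv_of_real)
    also have "norm (abs_l2 (hardy_lift ?f :: 'a \<Rightarrow> complex)) \<le> sqrt (sphere_area DIM('a)) * ((a + \<bar>t\<bar> + 1) * (B * h\<^sup>2))"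
    proof (rule hardy_lift_bounded(2))
      show "?f \<in> borel_measurable borel"
        by (intro borel_measurable_diff borel_measurable_scaleR v_measurable) auto
      show "?f r = 0" if "a + \<bar>t\<bar> + 1 < r" for r
        using that h by (simp add: v_support)
    qed (use a_nonneg B in auto)
    finally show ?thesis by (simp add: C_def mult_ac)
  qed
  show ?thesis
    unfolding has_vector_derivative_def has_derivative_at_alt
  proof (intro conjI allI impI)
    show "bounded_linear (\<lambda>h. h *\<^sub>R (wave (Suc k) t :: 'a l2))"
      by (rule bounded_linear_scaleR_left)
    fix e :: real assume e: "e > 0"
    show "\<exists>d>0. \<forall>y. norm (y - t) < d \<longrightarrow>
        norm (wave k y - wave k t - (y - t) *\<^sub>R (wave (Suc k) t :: 'a l2)) \<le> e * norm (y - t)"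
    proof (intro exI[of _ "min 1 (e / (C + 1))"] conjI allI impI)
      show "0 < min 1 (e / (C + 1))" using e C by simp
      fix y assume y: "norm (y - t) < min 1 (e / (C + 1))"
      then have "\<bar>y - t\<bar> * (C + 1) < e" using C by (simp add: pos_less_divide_eq)
      moreover have "C * \<bar>y - t\<bar> \<le> \<bar>y - t\<bar> * (C + 1)" by (simp add: algebra_simps)
      ultimately have "C * \<bar>y - t\<bar> \<le> e" by linarith
      then have "C * \<bar>y - t\<bar> * \<bar>y - t\<bar> \<le> e * \<bar>y - t\<bar>"
        by (intro mult_right_mono) auto
      then have "C * (y - t)\<^sup>2 \<le> e * norm (y - t)"
        by (simp add: power2_eq_square mult.assoc)
      then show "norm (wave k y - wave k t - (y - t) *\<^sub>R (wave (Suc k) t :: 'a l2)) \<le> e * norm (y - t)"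
        using est[of "y - t"] y by simp
    qed
  qed
qed

lemma D_smooth: "smooth UNIV (D k)"
  by (rule smooth_coinduct[where X = "\<lambda>f. \<exists>k. f = D k"]) (use D_deriv in auto)

lemma v_smooth: "smooth UNIV (\<lambda>r. v k r t)"
  unfolding v_def ring_def by (intro smooth_affine_integral D_smooth continuous_intros)

definition v_r :: "real \<Rightarrow> real \<Rightarrow> complex" where
  "v_r r t = ring cos (D (Suc 0)) r t"

definition v_rr :: "real \<Rightarrow> real \<Rightarrow> complex" where
  "v_rr r t = ring (\<lambda>\<theta>. cos \<theta> * cos \<theta>) (D (Suc (Suc 0))) r t"

lemma v_radius: "((\<lambda>r. v 0 r t) has_vector_derivative v_r r t) (at r)"
  using ring_deriv_radius[OF D_deriv D_cont, of "\<lambda>_. 1"] by (simp add: v_def v_r_def)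

lemma v_r_radius: "((\<lambda>r. v_r r t) has_vector_derivative v_rr r t) (at r)"
  unfolding v_r_def v_rr_def by (rule ring_deriv_radius[OF D_deriv D_cont]) (intro continuous_intros)

lemma v_wave_equation: "v_r r t + r *\<^sub>R v_rr r t = r *\<^sub>R v (Suc (Suc 0)) r t"
  unfolding v_def v_r_def v_rr_def by (rule ring_wave_equation[OF D_deriv D_cont])

section \<open>Cutoffs at the origin\<close>

text \<open>The averages \<open>v\<close> make sense for negative radii too, and a cutoff in
  \<open>ln r\<close> says nothing there; the value 0 is imposed so that the result is a radial
  profile on the whole line.\<close>

definition truncation :: "(real \<Rightarrow> complex) \<Rightarrow> real \<Rightarrow> real \<Rightarrow> complex" where
  "truncation X t r = (if 0 < r then X r * v 0 r t else 0)"

lemma truncation_profile: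
  assumes X: "smooth {0<..} X" and \<alpha>: "0 < \<alpha>" "\<And>r. 0 < r \<Longrightarrow> r < \<alpha> \<Longrightarrow> X r = 0"
  shows "truncation X t \<in> radial_profiles"
proof -
  have "smooth {0<..} (truncation X t)"
    by (rule smooth_cong[OF smooth_mult[OF _ X smooth_subset[OF v_smooth]]]) (auto simp: truncation_def)
  moreover have "truncation X t s = 0" if "s \<notin> {\<alpha>..a + \<bar>t\<bar>}" for s
    using that \<alpha>(2)[of s] v_support[of t s 0] by (auto simp: truncation_def not_le)
  ultimately show ?thesis
    unfolding radial_profiles_def using \<alpha>(1) by blast
qed

text \<open>
  Logarithmic cutoffs: the weight \<open>r dr\<close> is the one of the plane, where points have capacity zero,
  so \<open>\<integral> r |\<kappa> n'|\<^sup>2 dr\<close> is of order \<open>1 / n\<close>.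
\<close>

definition \<kappa> :: "nat \<Rightarrow> real \<Rightarrow> complex" where
  "\<kappa> n r = \<theta> (b + 1 + inverse (real (Suc n)) * ln r)"

text \<open>In \<open>\<kappa> n\<close> the argument of \<open>\<theta>\<close> runs from 0 at
  \<open>lower n\<close> to \<open>b\<close> at \<open>upper n\<close>. The shift by 1 in that
  argument forces \<open>upper n\<close> to tend to 0, so the cutoff acts on shrinking
  balls.\<close>

definition lower :: "nat \<Rightarrow> real" where "lower n = exp (- (real (Suc n) * (b + 1)))"

definition upper :: "nat \<Rightarrow> real" where "upper n = exp (- real (Suc n))"

lemma lower_upper: "0 < lower n" "lower n \<le> upper n" "0 < upper n" "upper n \<le> 1"
    "ln (upper n) - ln (lower n) = real (Suc n) * b" "upper n \<le> inverse (real (Suc n))"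
proof -
  show "lower n \<le> upper n"
    using b_pos by (simp add: lower_def upper_def algebra_simps)
  have "real (Suc n) \<le> exp (real (Suc n))"
    using exp_ge_add_one_self[of "real (Suc n)"] by linarith
  then have "inverse (exp (real (Suc n))) \<le> inverse (real (Suc n))"
    by (intro le_imp_inverse_le) auto
  then show "upper n \<le> inverse (real (Suc n))"
    unfolding upper_def exp_minus .
qed (simp_all add: lower_def upper_def algebra_simps)

lemma \<kappa>_arg:
  assumes "0 < r"
  shows "r < lower n \<Longrightarrow> b + 1 + inverse (real (Suc n)) * ln r < 0"
    and "upper n < r \<Longrightarrow> b < b + 1 + inverse (real (Suc n)) * ln r"
proof -
  assume "r < lower n"
  then have "ln r < - (real (Suc n) * (b + 1))"
    using assms ln_less_cancel_iff[of r "lower n"] lower_upper(1)[of n] by (simp add: lower_def)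
  then have "inverse (real (Suc n)) * ln r < inverse (real (Suc n)) * - (real (Suc n) * (b + 1))"
    by (intro mult_strict_left_mono) auto
  also have "inverse N * - (N * c) = - c" if "N > 0" for N c :: real
    using that by (simp add: field_simps)
  then have "inverse (real (Suc n)) * - (real (Suc n) * (b + 1)) = - (b + 1)"
    by (simp only: of_nat_0_less_iff zero_less_Suc)
  finally show "b + 1 + inverse (real (Suc n)) * ln r < 0"
    by linarith
next
  assume "upper n < r"
  then have "- real (Suc n) < ln r"
    using assms ln_less_cancel_iff[of "upper n" r] lower_upper(3)[of n] by (simp add: upper_def)
  then have "inverse (real (Suc n)) * (- real (Suc n)) < inverse (real (Suc n)) * ln r"
    by (intro mult_strict_left_mono) auto
  moreover have "inverse (real (Suc n)) * (- real (Suc n)) = - 1"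
    by (simp del: of_nat_Suc)
  ultimately show "b < b + 1 + inverse (real (Suc n)) * ln r"
    by linarith
qed

lemma \<kappa>_0: "0 < r \<Longrightarrow> r < lower n \<Longrightarrow> \<kappa> n r = 0"
  using \<kappa>_arg(1)[of r n] by (simp add: \<kappa>_def cutoff(2))

lemma \<kappa>_1: "upper n < r \<Longrightarrow> \<kappa> n r = 1"
  using \<kappa>_arg(2)[of r n] lower_upper(3)[of n] by (simp add: \<kappa>_def cutoff(3))

lemma \<kappa>_smooth: "smooth {0<..} (\<kappa> n)"
  unfolding \<kappa>_def[abs_def] by (rule smooth_comp_ln[OF cutoff(1)])

lemma truncation_\<kappa>_profile: "truncation (\<kappa> n) t \<in> radial_profiles"
  by (rule truncation_profile[OF \<kappa>_smooth lower_upper(1)[of n]]) (rule \<kappa>_0)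

lemma truncation_\<kappa>_diff_profile: "truncation (\<lambda>r. \<kappa> m r - \<kappa> n r) t \<in> radial_profiles"
proof (rule truncation_profile[of _ "min (lower m) (lower n)"])
  show "smooth {0<..} (\<lambda>r. \<kappa> m r - \<kappa> n r)"
    by (intro smooth_diff \<kappa>_smooth) auto
qed (use lower_upper \<kappa>_0 in auto)

lemma bounded_cutoff:
  assumes f: "continuous_on UNIV f" and "\<And>s. s < 0 \<Longrightarrow> cmod (f s) \<le> 1" "\<And>s. b < s \<Longrightarrow> cmod (f s) \<le> 1"
  obtains B where "0 \<le> B" "\<And>s. cmod (f s) \<le> B"
proof -
  have "bounded (f ` {0..b})"
    by (intro compact_imp_bounded compact_continuous_image continuous_on_subset[OF f]) auto
  then obtain B where B: "\<And>s. s \<in> {0..b} \<Longrightarrow> cmod (f s) \<le> B"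
    unfolding bounded_iff by blast
  have "cmod (f s) \<le> max 1 B" for s
    using B[of s] assms(2,3)[of s] by (cases "s \<in> {0..b}") (auto simp: not_le le_max_iff_disj)
  then show thesis by (intro that[of "max 1 B"]) auto
qed

lemma cutoff_bounded:
  obtains B where "0 \<le> B" "\<And>s. cmod (\<theta> s) \<le> B"
  by (rule bounded_cutoff[OF smooth_continuous_on[OF cutoff(1)]]) (auto simp: cutoff(2,3) intro: that)

definition \<theta>' :: "real \<Rightarrow> complex" where "\<theta>' s = vector_derivative \<theta> (at s)"

lemma \<theta>'_deriv: "(\<theta> has_vector_derivative \<theta>' s) (at s)"
  unfolding \<theta>'_def using smooth_has_vector_derivative[OF cutoff(1)] by simp

lemma \<theta>'_0: "s < 0 \<Longrightarrow> \<theta>' s = 0" "b < s \<Longrightarrow> \<theta>' s = 0"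
proof -
  assume "s < 0"
  then have "(\<theta> has_vector_derivative 0) (at s)"
    by - (rule has_vector_derivative_transform_within_open[of "\<lambda>_. 0" _ _ "{..<0}"], auto simp: cutoff(2))
  then show "\<theta>' s = 0" using vector_derivative_unique_at[OF \<theta>'_deriv] by blast
next
  assume "b < s"
  then have "(\<theta> has_vector_derivative 0) (at s)"
    by - (rule has_vector_derivative_transform_within_open[of "\<lambda>_. 1" _ _ "{b<..}"], auto simp: cutoff(3))
  then show "\<theta>' s = 0" using vector_derivative_unique_at[OF \<theta>'_deriv] by blast
qed

lemma \<theta>'_bounded:
  obtains B where "0 \<le> B" "\<And>s. cmod (\<theta>' s) \<le> B"
proof (rule bounded_cutoff)
  show "continuous_on UNIV \<theta>'"
    unfolding \<theta>'_def[abs_def] by (rule smooth_continuous_on[OF smooth_vector_derivative[OF cutoff(1)]])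
qed (auto simp: \<theta>'_0 intro: that)

definition \<kappa>' :: "nat \<Rightarrow> real \<Rightarrow> complex" where
  "\<kappa>' n r = (inverse (real (Suc n)) / r) *\<^sub>R \<theta>' (b + 1 + inverse (real (Suc n)) * ln r)"

lemma \<kappa>'_deriv: "0 < r \<Longrightarrow> (\<kappa> n has_vector_derivative \<kappa>' n r) (at r)"
proof -
  assume r: "0 < r"
  have "((\<lambda>r. b + 1 + c * ln r) has_real_derivative c / r) (at r)" for c
    using r by (auto intro!: derivative_eq_intros)
  then have "((\<lambda>r. b + 1 + inverse (real (Suc n)) * ln r) has_vector_derivative inverse (real (Suc n)) / r) (at r)"
    by (simp only: has_real_derivative_iff_has_vector_derivative)
  from vector_diff_chain_at[OF this \<theta>'_deriv] show ?thesis
    by (simp add: o_def \<kappa>_def[abs_def] \<kappa>'_def)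
qed

lemma truncation_deriv:
  assumes r: "0 < r" and X: "(X has_vector_derivative X') (at r)"
  shows "(truncation X t has_vector_derivative X' * v 0 r t + X r * v_r r t) (at r)"
proof (rule has_vector_derivative_transform_within_open[of "\<lambda>r. X r * v 0 r t" _ _ "{0<..}"])
  show "((\<lambda>r. X r * v 0 r t) has_vector_derivative X' * v 0 r t + X r * v_r r t) (at r)"
    using has_vector_derivative_mult[OF X v_radius] by (simp add: add.commute)
qed (use r in \<open>auto simp: truncation_def\<close>)

end

context radial_wave
begin

lemma v_r_bounded:
  obtains B where "0 \<le> B" "\<And>r t. cmod (v_r r t) \<le> B"
proof -
  obtain B where B: "\<And>t. cmod (D (Suc 0) t) \<le> B" using D_bounded by blast
  have B0: "0 \<le> B" using B[of 0] norm_ge_zero order_trans by blast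
  have "cmod (v_r r t) \<le> pi * B" for r t
  proof -
    have "cmod (integral {0..pi} (\<lambda>\<theta>. cos \<theta> *\<^sub>R D (Suc 0) (t + r * cos \<theta>))) \<le> integral {0..pi} (\<lambda>_. B)"
    proof (intro Henstock_Kurzweil_Integration.integral_norm_bound_integral integrable_continuous_real
        continuous_intros continuous_on_compose2[OF D_cont])
      fix \<phi> :: real
      have "\<bar>cos \<phi>\<bar> * cmod (D (Suc 0) (t + r * cos \<phi>)) \<le> 1 * B"
        by (intro mult_mono B) auto
      then show "cmod (cos \<phi> *\<^sub>R D (Suc 0) (t + r * cos \<phi>)) \<le> B" by simp
    qed auto
    then show ?thesis by (simp add: v_r_def ring_def)
  qed
  with B0 show thesis by (intro that[of "pi * B"]) auto
qed

lemma upper_antimono: "M \<le> n \<Longrightarrow> upper n \<le> upper M"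
  by (simp add: upper_def)

text \<open>The weight \<open>1 / r\<close> on the transition region of \<open>\<kappa> n\<close>.
  It majorizes \<open>r |\<kappa>'|^2\<close> up to a factor of order \<open>1 / (n + 1)^2\<close>,
  and its integral is only \<open>(n + 1) * b\<close>, the logarithmic length of the region.\<close>

definition shell :: "nat \<Rightarrow> real \<Rightarrow> real" where
  "shell n r = (if r \<in> {lower n..upper n} then 1 / r else 0)"

lemma shell_nonneg: "0 \<le> r \<Longrightarrow> 0 \<le> shell n r"
  by (simp add: shell_def)

lemma has_integral_shell:
  assumes "1 \<le> R"
  shows "(shell n has_integral (real (Suc n) * b)) {0..R}"
proof -
  have "((\<lambda>r. 1 / r) has_integral (ln (upper n) - ln (lower n))) {lower n..upper n}"
  proof (rule fundamental_theorem_of_calculus[OF lower_upper(2)])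
    fix x assume "x \<in> {lower n..upper n}"
    then have "0 < x" using lower_upper(1)[of n] by auto
    then have "(ln has_real_derivative 1 / x) (at x)"
      by (auto intro!: derivative_eq_intros)
    then show "(ln has_vector_derivative 1 / x) (at x within {lower n..upper n})"
      by (simp only: has_real_derivative_iff_has_vector_derivative has_vector_derivative_at_within)
  qed
  moreover have "{lower n..upper n} \<subseteq> {0..R}"
    using lower_upper(1)[of n] lower_upper(4)[of n] assms by auto
  ultimately have "((\<lambda>r. if r \<in> {lower n..upper n} then 1 / r else 0) has_integral (ln (upper n) - ln (lower n))) {0..R}"
    by (simp only: has_integral_restrict)
  then show ?thesis
    unfolding shell_def[abs_def] lower_upper(5) .
qed

lemma \<kappa>'_estimate:
  assumes T: "\<And>s. cmod (\<theta>' s) \<le> T" and r: "0 < r"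
  shows "r * (cmod (\<kappa>' n r))\<^sup>2 \<le> T\<^sup>2 * (inverse (real (Suc n)))\<^sup>2 * shell n r"
proof (cases "r \<in> {lower n..upper n}")
  case False
  then have "\<kappa>' n r = 0"
    using \<kappa>_arg[OF r, of n] \<theta>'_0 by (auto simp: \<kappa>'_def not_le)
  then show ?thesis using shell_nonneg[of r n] r by simp
next
  case True
  define x where "x = inverse (real (Suc n))"
  have x: "0 < x" by (simp add: x_def)
  have "cmod (\<kappa>' n r) = x / r * cmod (\<theta>' (b + 1 + x * ln r))"
    using r x by (simp add: \<kappa>'_def x_def)
  also have "\<dots> \<le> x / r * T"
    using r x by (intro mult_left_mono T) auto
  finally have "(cmod (\<kappa>' n r))\<^sup>2 \<le> (x / r * T)\<^sup>2"
    by (intro power_mono) auto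
  then have "r * (cmod (\<kappa>' n r))\<^sup>2 \<le> r * (x / r * T)\<^sup>2"
    using r by (intro mult_left_mono) auto
  also have "\<dots> = T\<^sup>2 * x\<^sup>2 * (1 / r)"
    using r by (simp add: power2_eq_square field_simps)
  finally show ?thesis
    using True by (simp add: shell_def x_def)
qed

section \<open>Approximation of the wave in the form norm\<close>

lemma square_norm_three: "(cmod (x - y + z))\<^sup>2 \<le> 3 * ((cmod x)\<^sup>2 + (cmod y)\<^sup>2 + (cmod z)\<^sup>2)"
proof -
  have "cmod (x - y + z) \<le> cmod x + cmod y + cmod z"
    by (meson add_mono norm_triangle_ineq norm_triangle_ineq4 order_refl order_trans)
  then have "(cmod (x - y + z))\<^sup>2 \<le> (cmod x + cmod y + cmod z)\<^sup>2"
    by (intro power_mono) auto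
  also have "\<dots> \<le> 3 * ((cmod x)\<^sup>2 + (cmod y)\<^sup>2 + (cmod z)\<^sup>2)"
    using sum_squares_bound[of "cmod x" "cmod y"] sum_squares_bound[of "cmod x" "cmod z"]
      sum_squares_bound[of "cmod y" "cmod z"]
    by (simp add: power2_eq_square algebra_simps)
  finally show ?thesis .
qed

text \<open>The derivative of \<open>(\<kappa> m - \<kappa> n) v\<close> splits into one shell term
  for each cutoff and a term containing \<open>v_r\<close>. Both shell energies are of order
  \<open>1 / (M + 1)\<close>, and the third term lives in the ball of radius \<open>upper M\<close>,
  where it is bounded.\<close>

lemma truncation_energy:
  obtains Q where "\<And>M m n. M \<le> m \<Longrightarrow> M \<le> n \<Longrightarrow>
    cmod (l2_cinner (abs_l2 (hardy_op (- ((real DIM('a) - 2) / 2)\<^sup>2) (hardy_lift (truncation (\<lambda>r. \<kappa> m r - \<kappa> n r) t))))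
      (abs_l2 (hardy_lift (truncation (\<lambda>r. \<kappa> m r - \<kappa> n r) t) :: 'a::euclidean_space \<Rightarrow> complex)))
    \<le> Q * inverse (real (Suc M))"
proof -
  obtain V where V: "0 \<le> V" "\<And>r t. cmod (v 0 r t) \<le> V" using v_bounded[of 0] by blast
  obtain W where W: "0 \<le> W" "\<And>r t. cmod (v_r r t) \<le> W" using v_r_bounded by blast
  obtain H where H: "0 \<le> H" "\<And>s. cmod (\<theta> s) \<le> H" using cutoff_bounded by blast
  obtain T where T: "0 \<le> T" "\<And>s. cmod (\<theta>' s) \<le> T" using \<theta>'_bounded by blast
  define R where "R = a + \<bar>t\<bar> + 1"
  have R: "1 \<le> R" using a_nonneg by (simp add: R_def)
  define P where "P = T\<^sup>2 * V\<^sup>2"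
  define Z where "Z = (2 * H * W)\<^sup>2"
  have PZ: "0 \<le> P" "0 \<le> Z" by (simp_all add: P_def Z_def)
  \<comment> \<open>The factor 3 comes from squaring a sum of three terms; \<open>6\<close> counts
    the two shells.\<close>
  define Q where "Q = sphere_area DIM('a) * (6 * P * b + 3 * Z)"
  have "cmod (l2_cinner (abs_l2 (hardy_op (- ((real DIM('a) - 2) / 2)\<^sup>2) (hardy_lift (truncation (\<lambda>r. \<kappa> m r - \<kappa> n r) t))))
      (abs_l2 (hardy_lift (truncation (\<lambda>r. \<kappa> m r - \<kappa> n r) t) :: 'a \<Rightarrow> complex)))
    \<le> Q * inverse (real (Suc M))" if M: "M \<le> m" "M \<le> n" for M m n
  proof -
    define \<psi> where "\<psi> = truncation (\<lambda>r. \<kappa> m r - \<kappa> n r) t"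
    have p: "\<psi> \<in> radial_profiles" unfolding \<psi>_def by (rule truncation_\<kappa>_diff_profile)
    define \<psi>' where "\<psi>' s = vector_derivative \<psi> (at s)" for s
    define \<psi>'' where "\<psi>'' s = vector_derivative \<psi>' (at s)" for s
    have d1: "(\<psi> has_vector_derivative \<psi>' s) (at s)" for s
      unfolding \<psi>'_def by (rule radial_profile_has_vector_derivative(1)[OF p])
    have p': "\<psi>' \<in> radial_profiles"
      unfolding \<psi>'_def[abs_def] by (rule radial_profile_has_vector_derivative(2)[OF p])
    have d2: "(\<psi>' has_vector_derivative \<psi>'' s) (at s)" for s
      unfolding \<psi>''_def by (rule radial_profile_has_vector_derivative(1)[OF p'])
    have c2: "continuous_on UNIV \<psi>''"
      unfolding \<psi>''_def[abs_def]
      by (rule radial_profile_continuous[OF radial_profile_has_vector_derivative(2)[OF p']])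
    have \<psi>0: "\<psi> r = 0" if "R \<le> r" for r
      using that v_support[of t r 0] by (simp add: \<psi>_def truncation_def R_def)
    have form: "l2_cinner (abs_l2 (hardy_op (- ((real DIM('a) - 2) / 2)\<^sup>2) (hardy_lift \<psi>)))
        (abs_l2 (hardy_lift \<psi> :: 'a \<Rightarrow> complex)) =
        complex_of_real (sphere_area DIM('a) * integral {0..R} (\<lambda>r. r * (cmod (\<psi>' r))\<^sup>2))"
      by (rule hardy_form_lift[OF p d1 d2 c2 _ \<psi>0]) (use R in auto)
    \<comment> \<open>A majorant with known integral: the two shells, and the ball of radius
      \<open>upper M\<close>, outside which both cutoffs equal 1.\<close>
    define G where "G r = (3 * P * (inverse (real (Suc m)))\<^sup>2) * shell m r + (3 * P * (inverse (real (Suc n)))\<^sup>2) * shell n r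
        + (3 * Z) * (if r \<in> {0..upper M} then 1 else 0)" for r
    have le: "r * (cmod (\<psi>' r))\<^sup>2 \<le> G r" if r: "r \<in> {0..R}" for r
    proof (cases "r = 0")
      case True
      then show ?thesis using PZ shell_nonneg[of 0] by (simp add: G_def)
    next
      case False
      with r have r0: "0 < r" by auto
      define x y z where "x = \<kappa>' m r * v 0 r t" and "y = \<kappa>' n r * v 0 r t" and "z = (\<kappa> m r - \<kappa> n r) * v_r r t"
      have "(\<psi> has_vector_derivative (\<kappa>' m r - \<kappa>' n r) * v 0 r t + (\<kappa> m r - \<kappa> n r) * v_r r t) (at r)"
        unfolding \<psi>_def by (intro truncation_deriv r0 has_vector_derivative_diff \<kappa>'_deriv)
      then have eq: "\<psi>' r = x - y + z"
        using vector_derivative_unique_at[OF d1] by (simp add: x_def y_def z_def left_diff_distrib)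
      have "r * (cmod (\<psi>' r))\<^sup>2 \<le> r * (3 * ((cmod x)\<^sup>2 + (cmod y)\<^sup>2 + (cmod z)\<^sup>2))"
        unfolding eq using r0 by (intro mult_left_mono square_norm_three) auto
      then have 1: "r * (cmod (\<psi>' r))\<^sup>2 \<le> 3 * (r * (cmod x)\<^sup>2 + r * (cmod y)\<^sup>2 + r * (cmod z)\<^sup>2)"
        by (simp add: algebra_simps)
      have sh: "r * (cmod (\<kappa>' n r * v 0 r t))\<^sup>2 \<le> P * (inverse (real (Suc n)))\<^sup>2 * shell n r" for n
      proof -
        have "r * (cmod (\<kappa>' n r * v 0 r t))\<^sup>2 = (r * (cmod (\<kappa>' n r))\<^sup>2) * (cmod (v 0 r t))\<^sup>2"
          by (simp add: norm_mult power_mult_distrib)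
        also have "\<dots> \<le> (T\<^sup>2 * (inverse (real (Suc n)))\<^sup>2 * shell n r) * V\<^sup>2"
          using r0 V shell_nonneg[of r n] by (intro mult_mono \<kappa>'_estimate T power_mono) auto
        finally show ?thesis by (simp add: P_def mult_ac)
      qed
      have 2: "r * (cmod z)\<^sup>2 \<le> Z * (if r \<in> {0..upper M} then 1 else 0)"
      proof (cases "r \<le> upper M")
        case True
        have "cmod (\<kappa> m r - \<kappa> n r) \<le> cmod (\<kappa> m r) + cmod (\<kappa> n r)"
          by (rule norm_triangle_ineq4)
        also have "\<dots> \<le> H + H" unfolding \<kappa>_def by (intro add_mono H)
        finally have "cmod z \<le> 2 * H * W"
          unfolding z_def norm_mult by (intro mult_mono W) (use H in auto)
        then have "(cmod z)\<^sup>2 \<le> Z"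
          unfolding Z_def by (intro power_mono) auto
        moreover have "r \<le> 1" using True lower_upper(4)[of M] by linarith
        ultimately have "r * (cmod z)\<^sup>2 \<le> 1 * Z" using r0 by (intro mult_mono) auto
        then show ?thesis using True r0 by simp
      next
        case False
        then have "upper m < r" "upper n < r"
          using upper_antimono[OF M(1)] upper_antimono[OF M(2)] by linarith+
        then have "z = 0" by (simp add: z_def \<kappa>_1)
        then show ?thesis using PZ by simp
      qed
      show ?thesis
        using 1 2 sh[of m] sh[of n] unfolding G_def x_def y_def by (simp add: algebra_simps)
    qed
    have u: "((\<lambda>r. if r \<in> {0..upper M} then 1 else 0) has_integral upper M) {0..R}"
    proof -
      have "((\<lambda>_. 1::real) has_integral upper M) {0..upper M}"
        using has_integral_const_real[of "1::real" 0 "upper M"] lower_upper(3)[of M] by simp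
      moreover have "{0..upper M} \<subseteq> {0..R}" using lower_upper(4)[of M] R by auto
      ultimately show ?thesis by (simp only: has_integral_restrict)
    qed
    have GI: "(G has_integral ((3 * P * (inverse (real (Suc m)))\<^sup>2) * (real (Suc m) * b) +
        (3 * P * (inverse (real (Suc n)))\<^sup>2) * (real (Suc n) * b) + (3 * Z) * upper M)) {0..R}"
      unfolding G_def[abs_def] by (intro has_integral_add has_integral_mult_right has_integral_shell R u)
    have c1: "continuous_on UNIV \<psi>'" by (rule radial_profile_continuous[OF p'])
    have LI: "(\<lambda>r. r * (cmod (\<psi>' r))\<^sup>2) integrable_on {0..R}"
      by (intro integrable_continuous_real continuous_intros continuous_on_subset[OF c1]) auto
    have inv: "(3 * P * (inverse (real (Suc k)))\<^sup>2) * (real (Suc k) * b) \<le> 3 * P * b * inverse (real (Suc M))"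
      if "M \<le> k" for k
    proof -
      have "(3 * P * (inverse N)\<^sup>2) * (N * b) = 3 * P * b * inverse N" if "N > 0" for N
        using that by (simp add: power2_eq_square)
      then have "(3 * P * (inverse (real (Suc k)))\<^sup>2) * (real (Suc k) * b) = 3 * P * b * inverse (real (Suc k))"
        by (simp only: of_nat_0_less_iff zero_less_Suc)
      also have "\<dots> \<le> 3 * P * b * inverse (real (Suc M))"
        using that PZ b_pos by (intro mult_left_mono le_imp_inverse_le) auto
      finally show ?thesis .
    qed
    have "(3 * Z) * upper M \<le> 3 * Z * inverse (real (Suc M))"
      using PZ lower_upper(6)[of M] by (intro mult_left_mono) auto
    moreover have "integral {0..R} (\<lambda>r. r * (cmod (\<psi>' r))\<^sup>2) \<le>
        (3 * P * (inverse (real (Suc m)))\<^sup>2) * (real (Suc m) * b) +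
        (3 * P * (inverse (real (Suc n)))\<^sup>2) * (real (Suc n) * b) + (3 * Z) * upper M"
      by (rule has_integral_le[OF integrable_integral[OF LI] GI le])
    ultimately have "integral {0..R} (\<lambda>r. r * (cmod (\<psi>' r))\<^sup>2) \<le> (6 * P * b + 3 * Z) * inverse (real (Suc M))"
      using inv[OF M(1)] inv[OF M(2)] by (simp add: distrib_right del: of_nat_Suc)
    then have "sphere_area DIM('a) * integral {0..R} (\<lambda>r. r * (cmod (\<psi>' r))\<^sup>2) \<le> Q * inverse (real (Suc M))"
      unfolding Q_def using sphere_area_pos[where 'a='a] by (simp add: mult.assoc)
    moreover have "0 \<le> sphere_area DIM('a) * integral {0..R} (\<lambda>r. r * (cmod (\<psi>' r))\<^sup>2)"
      using sphere_area_pos[where 'a='a]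
      by (intro mult_nonneg_nonneg Henstock_Kurzweil_Integration.integral_nonneg[OF LI]) auto
    ultimately show ?thesis
      unfolding \<psi>_def[symmetric] form norm_of_real by simp
  qed
  then show thesis by (rule that)
qed

text \<open>The truncation error is bounded and supported in the ball of radius
  \<open>upper n\<close>, so its norm is of order \<open>upper n\<close>.\<close>

lemma truncation_tendsto:
  "(\<lambda>n. abs_l2 (hardy_lift (truncation (\<kappa> n) t))) \<longlonglongrightarrow> (wave 0 t :: 'a::euclidean_space l2)"
proof -
  obtain V where V: "0 \<le> V" "\<And>r t. cmod (v 0 r t) \<le> V" using v_bounded[of 0] by blast
  obtain H where H: "0 \<le> H" "\<And>s. cmod (\<theta> s) \<le> H" using cutoff_bounded by blast
  define C where "C = sqrt (sphere_area DIM('a)) * ((H + 1) * V)"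
  have C: "0 \<le> C"
    unfolding C_def using H(1) V(1) sphere_area_pos[where 'a='a] by (intro mult_nonneg_nonneg) auto
  have est: "norm (abs_l2 (hardy_lift (truncation (\<kappa> n) t)) - (wave 0 t :: 'a l2)) \<le> C * inverse (real (Suc n))" for n
  proof -
    let ?f = "\<lambda>r. truncation (\<kappa> n) t r - v 0 r t"
    have "abs_l2 (hardy_lift (truncation (\<kappa> n) t)) - (wave 0 t :: 'a l2) =
        abs_l2 (\<lambda>x. hardy_lift (truncation (\<kappa> n) t) x - hardy_lift (\<lambda>r. v 0 r t) x)"
      unfolding wave_def
      by (intro abs_l2_diff wave_square_integrable
          square_integrable_test_function[OF hardy_lift_test_function[OF truncation_\<kappa>_profile]])
    also have "(\<lambda>x. hardy_lift (truncation (\<kappa> n) t) x - hardy_lift (\<lambda>r. v 0 r t) x) = (hardy_lift ?f :: 'a \<Rightarrow> complex)"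
      by (simp add: hardy_lift_def fun_eq_iff algebra_simps)
    also have "norm (abs_l2 (hardy_lift ?f :: 'a \<Rightarrow> complex)) \<le> sqrt (sphere_area DIM('a)) * (upper n * ((H + 1) * V))"
    proof (rule hardy_lift_bounded(2))
      show "?f \<in> borel_measurable borel"
        using borel_measurable_continuous_onI[OF radial_profile_continuous[OF truncation_\<kappa>_profile]] v_measurable
        by (intro borel_measurable_diff) auto
      show "cmod (?f r) \<le> (H + 1) * V" if "0 < r" for r
      proof -
        have "cmod (\<kappa> n r - 1) \<le> H + 1"
          using norm_triangle_ineq4[of "\<kappa> n r" 1] H(2) unfolding \<kappa>_def by (smt (verit) norm_one)
        then have "cmod (\<kappa> n r - 1) * cmod (v 0 r t) \<le> (H + 1) * V"
          using H(1) V by (intro mult_mono) auto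
        then show ?thesis
          using that by (simp add: truncation_def left_diff_distrib flip: norm_mult)
      qed
      show "?f r = 0" if "upper n < r" for r
        using that lower_upper(3)[of n] by (simp add: truncation_def \<kappa>_1)
    qed (use lower_upper(3)[of n] H V in auto)
    also have "\<dots> = C * upper n" by (simp add: C_def mult_ac)
    also have "\<dots> \<le> C * inverse (real (Suc n))"
      using C lower_upper(6) by (intro mult_left_mono) auto
    finally show ?thesis .
  qed
  have "(\<lambda>n. C * inverse (real (Suc n))) \<longlonglongrightarrow> C * 0"
    by (intro tendsto_mult tendsto_const LIMSEQ_inverse_real_of_nat)
  then have "(\<lambda>n. C * inverse (real (Suc n))) \<longlonglongrightarrow> 0" by simp
  then have "(\<lambda>n. abs_l2 (hardy_lift (truncation (\<kappa> n) t)) - (wave 0 t :: 'a l2)) \<longlonglongrightarrow> 0"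
    by (rule Lim_null_comparison[rotated]) (intro always_eventually allI est)
  then show ?thesis by (simp add: LIM_zero_iff)
qed

text \<open>The lift of \<open>v 0\<close> may be singular at the origin like the ground state, so
  the wave is reached through truncations: they are test functions, converge in norm, and are Cauchy
  in energy.\<close>

lemma wave_in_form_domain:
  "wave 0 t \<in> form_domain (hardy_minimal (- ((real DIM('a) - 2) / 2)\<^sup>2) :: ('a::euclidean_space l2 \<times> 'a l2) set)"
proof -
  define c where "c = - ((real DIM('a) - 2) / 2)\<^sup>2"
  define u where "u n = (hardy_lift (truncation (\<kappa> n) t) :: 'a \<Rightarrow> complex)" for n
  define s where "s n = (abs_l2 (u n), abs_l2 (hardy_op c (u n)))" for n
  have u: "u n \<in> test_functions (UNIV - {0})" for n
    unfolding u_def by (rule hardy_lift_test_function[OF truncation_\<kappa>_profile])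
  obtain Q where Q: "\<And>M m n. M \<le> m \<Longrightarrow> M \<le> n \<Longrightarrow>
    cmod (l2_cinner (abs_l2 (hardy_op c (hardy_lift (truncation (\<lambda>r. \<kappa> m r - \<kappa> n r) t))))
      (abs_l2 (hardy_lift (truncation (\<lambda>r. \<kappa> m r - \<kappa> n r) t) :: 'a \<Rightarrow> complex)))
    \<le> Q * inverse (real (Suc M))"
    unfolding c_def using truncation_energy[where 'a='a and t = t] by blast
  have diff: "(\<lambda>x. u m x - u n x) = hardy_lift (truncation (\<lambda>r. \<kappa> m r - \<kappa> n r) t)" for m n
    by (simp add: u_def hardy_lift_def truncation_def fun_eq_iff algebra_simps)
  have sd: "fst (s m) - fst (s n) = abs_l2 (hardy_lift (truncation (\<lambda>r. \<kappa> m r - \<kappa> n r) t))"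
    "snd (s m) - snd (s n) = abs_l2 (hardy_op c (hardy_lift (truncation (\<lambda>r. \<kappa> m r - \<kappa> n r) t)))" for m n
    unfolding s_def fst_conv snd_conv diff[symmetric] hardy_op_diff[OF u u]
    by (intro abs_l2_diff square_integrable_test_function[OF u] square_integrable_hardy_op[OF u])+
  have "(\<lambda>n. Q * inverse (real (Suc n))) \<longlonglongrightarrow> Q * 0"
    by (intro tendsto_mult tendsto_const LIMSEQ_inverse_real_of_nat)
  then have lim: "(\<lambda>n. Q * inverse (real (Suc n))) \<longlonglongrightarrow> 0" by simp
  have "form_approx (hardy_minimal c) s (wave 0 t)"
    unfolding form_approx_def
  proof (intro conjI allI impI)
    show "range s \<subseteq> hardy_minimal c"
      unfolding s_def hardy_minimal_def using u by blast
    show "(\<lambda>n. fst (s n)) \<longlonglongrightarrow> wave 0 t"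
      unfolding s_def fst_conv u_def by (rule truncation_tendsto)
    fix \<epsilon> :: real assume "\<epsilon> > 0"
    then obtain M where M: "Q * inverse (real (Suc M)) < \<epsilon>"
      using order_tendstoD(2)[OF lim] unfolding eventually_sequentially by blast
    have "cmod (l2_cinner (snd (s m) - snd (s n)) (fst (s m) - fst (s n))) < \<epsilon>" if "M \<le> m" "M \<le> n" for m n
      unfolding sd using Q[OF that] M by linarith
    then show "\<exists>M. \<forall>m\<ge>M. \<forall>n\<ge>M. cmod (l2_cinner (snd (s m) - snd (s n)) (fst (s m) - fst (s n))) < \<epsilon>"
      by blast
  qed
  then show ?thesis
    unfolding form_domain_def c_def by blast
qed

section \<open>The wave in the operator domain\<close>

text \<open>Beyond \<open>upper n\<close> the cutoff is locally the constant 1, so the truncation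
  has the derivatives of \<open>v 0\<close> there, and the plane wave equation turns the spatial
  operator into minus the second time derivative.\<close>

lemma hardy_op_truncation:
  fixes x :: "'a::euclidean_space"
  assumes x: "upper n < norm x"
  shows "hardy_op (- ((real DIM('a) - 2) / 2)\<^sup>2) (hardy_lift (truncation (\<kappa> n) t)) x =
    - hardy_lift (\<lambda>r. v (Suc (Suc 0)) r t) x"
proof -
  define \<psi> where "\<psi> = truncation (\<kappa> n) t"
  have p: "\<psi> \<in> radial_profiles" unfolding \<psi>_def by (rule truncation_\<kappa>_profile)
  define \<psi>' where "\<psi>' s = vector_derivative \<psi> (at s)" for s
  define \<psi>'' where "\<psi>'' s = vector_derivative \<psi>' (at s)" for s
  have d1: "(\<psi> has_vector_derivative \<psi>' s) (at s)" for s
    unfolding \<psi>'_def by (rule radial_profile_has_vector_derivative(1)[OF p])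
  have p': "\<psi>' \<in> radial_profiles"
    unfolding \<psi>'_def[abs_def] by (rule radial_profile_has_vector_derivative(2)[OF p])
  have d2: "(\<psi>' has_vector_derivative \<psi>'' s) (at s)" for s
    unfolding \<psi>''_def by (rule radial_profile_has_vector_derivative(1)[OF p'])
  have 1: "\<psi>' s = v_r s t" if "upper n < s" for s
  proof -
    have "(\<psi> has_vector_derivative v_r s t) (at s)"
      by (rule has_vector_derivative_transform_within_open[OF v_radius, of "{upper n<..}"])
         (use that lower_upper(3)[of n] in \<open>auto simp: \<psi>_def truncation_def \<kappa>_1\<close>)
    then show ?thesis by (rule vector_derivative_unique_at[OF d1])
  qed
  have 2: "\<psi>'' s = v_rr s t" if "upper n < s" for s
  proof -
    have "(\<psi>' has_vector_derivative v_rr s t) (at s)"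
      by (rule has_vector_derivative_transform_within_open[OF v_r_radius, of "{upper n<..}"])
         (use that in \<open>auto simp: 1\<close>)
    then show ?thesis by (rule vector_derivative_unique_at[OF d2])
  qed
  have r: "0 < norm x" using x lower_upper(3)[of n] by linarith
  have "- v_rr (norm x) t - v_r (norm x) t / complex_of_real (norm x) = - v (Suc (Suc 0)) (norm x) t"
    using v_wave_equation[of "norm x" t] r by (simp add: field_simps scaleR_conv_of_real)
  then show ?thesis
    unfolding \<psi>_def[symmetric] hardy_op_lift[OF p d1 d2] by (simp add: hardy_lift_def 1[OF x] 2[OF x])
qed

text \<open>A test function vanishes near the origin, so a late enough truncation agrees with the
  wave on its support. The weak equation then reduces to symmetry of the minimal operator between
  two test functions, and the singularity at the origin is never touched.\<close>

lemma wave_in_friedrichs: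
  "(wave 0 t, - wave (Suc (Suc 0)) t) \<in>
    friedrichs (hardy_minimal (- ((real DIM('a) - 2) / 2)\<^sup>2) :: ('a::euclidean_space l2 \<times> 'a l2) set)"
proof (rule bounded_symmetric_form.friedrichsI[OF bounded_symmetric_form_hardy wave_in_form_domain])
  fix w h assume "(w, h) \<in> (hardy_minimal (- ((real DIM('a) - 2) / 2)\<^sup>2) :: ('a l2 \<times> 'a l2) set)"
  then obtain f :: "'a \<Rightarrow> complex" where f: "f \<in> test_functions (UNIV - {0})"
    and w: "w = abs_l2 f" and h: "h = abs_l2 (hardy_op (- ((real DIM('a) - 2) / 2)\<^sup>2) f)"
    by (auto simp: hardy_minimal_def)
  define c where "c = - ((real DIM('a) - 2) / 2)\<^sup>2"
  define K where "K = closure {x. f x \<noteq> 0}"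
  note K = test_functionD[OF f, folded K_def]
  have "open (- K)" by (simp add: K_def open_Compl)
  moreover have "0 \<in> - K" using K(2) by simp
  ultimately obtain \<delta> where \<delta>: "0 < \<delta>" "ball 0 \<delta> \<subseteq> - K"
    using openE by blast
  have opK: "open (- K)" by (simp add: K_def open_Compl)
  have f0: "f x = 0" "hardy_op c f x = 0" if "norm x < \<delta>" for x
  proof -
    have x: "x \<in> - K" using that \<delta>(2) by auto
    then show "f x = 0" by (intro K(3)) auto
    have "laplacian f x = 0"
      unfolding laplacian_def
      by (intro sum.neutral ballI partial_deriv_eq_0[OF opK x])
         (rule partial_deriv_eq_0[OF opK], assumption, rule K(3), blast)
    then show "hardy_op c f x = 0"
      using \<open>f x = 0\<close> by (simp add: hardy_op_def)
  qed
  \<comment> \<open>The cutoff is confined to the ball of radius \<open>\<delta>\<close>, in which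
    both \<open>f\<close> and its image under the operator vanish.\<close>
  obtain n where "inverse (real (Suc n)) < \<delta>"
    using reals_Archimedean[OF \<delta>(1)] by blast
  then have n: "upper n < \<delta>" using lower_upper(6)[of n] by linarith
  define u where "u = (hardy_lift (truncation (\<kappa> n) t) :: 'a \<Rightarrow> complex)"
  have u: "u \<in> test_functions (UNIV - {0})"
    unfolding u_def by (rule hardy_lift_test_function[OF truncation_\<kappa>_profile])
  note sq = square_integrable_test_function[OF u] square_integrable_test_function[OF f]
    square_integrable_hardy_op[OF u, of c] square_integrable_hardy_op[OF f, of c]
  have "l2_cinner (wave 0 t) (abs_l2 (hardy_op c f)) = (LINT x|lborel. hardy_lift (\<lambda>r. v 0 r t) x * cnj (hardy_op c f x))"
    unfolding wave_def by (rule l2_cinner_abs_l2[OF wave_square_integrable sq(4)])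
  also have "\<dots> = (LINT x|lborel. u x * cnj (hardy_op c f x))"
  proof (rule Bochner_Integration.integral_cong[OF refl])
    show "hardy_lift (\<lambda>r. v 0 r t) x * cnj (hardy_op c f x) = u x * cnj (hardy_op c f x)" for x
    proof (cases "norm x < \<delta>")
      case False
      then have "upper n < norm x" using n by linarith
      then have "u x = hardy_lift (\<lambda>r. v 0 r t) x"
        using lower_upper(3)[of n] by (simp add: u_def hardy_lift_def truncation_def \<kappa>_1)
      then show ?thesis by simp
    qed (simp add: f0)
  qed
  also have "\<dots> = l2_cinner (abs_l2 u) (abs_l2 (hardy_op c f))"
    by (rule l2_cinner_abs_l2[OF sq(1,4), symmetric])
  also have "\<dots> = cnj (l2_cinner (abs_l2 (hardy_op c f)) (abs_l2 u))"
    by (rule l2_cinner_commute)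
  also have "\<dots> = l2_cinner (abs_l2 (hardy_op c u)) (abs_l2 f)"
  proof -
    have "(abs_l2 u, abs_l2 (hardy_op c u)) \<in> hardy_minimal c" "(abs_l2 f, abs_l2 (hardy_op c f)) \<in> hardy_minimal c"
      unfolding hardy_minimal_def using u f by blast+
    from bounded_symmetric_form.T_sym[OF bounded_symmetric_form_hardy this[unfolded c_def]] show ?thesis
      by (simp add: c_def)
  qed
  also have "\<dots> = (LINT x|lborel. hardy_op c u x * cnj (f x))"
    by (rule l2_cinner_abs_l2[OF sq(3,2)])
  also have "\<dots> = (LINT x|lborel. - hardy_lift (\<lambda>r. v (Suc (Suc 0)) r t) x * cnj (f x))"
  proof (rule Bochner_Integration.integral_cong[OF refl])
    show "hardy_op c u x * cnj (f x) = - hardy_lift (\<lambda>r. v (Suc (Suc 0)) r t) x * cnj (f x)" for x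
    proof (cases "norm x < \<delta>")
      case False
      then have "upper n < norm x" using n by linarith
      then show ?thesis unfolding c_def u_def by (simp add: hardy_op_truncation)
    qed (simp add: f0)
  qed
  also have "\<dots> = l2_cinner (- wave (Suc (Suc 0)) t) (abs_l2 f)"
  proof -
    have m: "square_integrable (\<lambda>x. - hardy_lift (\<lambda>r. v (Suc (Suc 0)) r t) (x::'a))"
      using square_integrable_cmult[OF wave_square_integrable, of "-1"] by simp
    have "- wave (Suc (Suc 0)) t = abs_l2 (\<lambda>x. - hardy_lift (\<lambda>r. v (Suc (Suc 0)) r t) (x::'a))"
      unfolding wave_def by (intro uminus_l2.abs_eq) (simp add: l2_rel_def wave_square_integrable)
    then show ?thesis
      by (simp only: l2_cinner_abs_l2[OF m sq(2)])
  qed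
  finally show "l2_cinner (wave 0 t) h = l2_cinner (- wave (Suc (Suc 0)) t) w"
    by (simp add: w h c_def)
qed

end

section \<open>Waves generated by an odd profile\<close>

lemma smooth_antiderivative:
  assumes "open U" "\<And>t. t \<in> U \<Longrightarrow> (f has_vector_derivative f' t) (at t)" "smooth U f'"
  shows "smooth U f"
  unfolding smooth_def
proof
  show "smooth_order k U f" for k
  proof (cases k)
    case (Suc n)
    then show ?thesis
      using smooth_order_SucI[OF assms(1,2)] assms(3) unfolding smooth_def by blast
  qed simp
qed

lemma smooth_of_real: "open U \<Longrightarrow> smooth U complex_of_real"
proof (rule smooth_antiderivative[where f' = "\<lambda>_. 1"])
  show "(complex_of_real has_vector_derivative 1) (at t)" for t
    using bounded_linear.has_vector_derivative[OF bounded_linear_of_real[where 'a = complex]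
        has_vector_derivative_id[where net = "at t"]] by simp
qed (auto intro: smooth_const)

text \<open>The substitution of \<open>pi - \<theta>\<close> for \<open>\<theta>\<close> reverses
  the sign of the cosine. At \<open>t = 0\<close> this yields the vanishing initial value of the
  wave.\<close>

lemma ring_odd:
  fixes f :: "real \<Rightarrow> complex"
  assumes f: "continuous_on UNIV f" and odd: "\<And>s. f (- s) = - f s"
  shows "ring (\<lambda>_. 1) f r (- t) = - ring (\<lambda>_. 1) f r t"
proof -
  have "((\<lambda>\<theta>. f (- t + r * cos \<theta>)) has_integral ring (\<lambda>_. 1) f r (- t)) (cbox 0 pi)"
    unfolding ring_def scaleR_one box_real
    by (intro integrable_integral integrable_continuous_real continuous_intros continuous_on_compose2[OF f]) auto
  from has_integral_affinity[OF this, of "- 1" pi]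
  have "((\<lambda>\<theta>. f (- t + r * cos (pi - \<theta>))) has_integral ring (\<lambda>_. 1) f r (- t)) ((\<lambda>x. pi - x) ` {0..pi})"
    by simp
  moreover have "(\<lambda>x. pi - x) ` {0..pi} = {0..pi}"
    by (simp add: image_diff_atLeastAtMost)
  moreover have "f (- t + r * cos (pi - \<theta>)) = - f (t + r * cos \<theta>)" for \<theta>
    using odd[of "t + r * cos \<theta>"] by simp
  ultimately have "((\<lambda>\<theta>. - f (t + r * cos \<theta>)) has_integral ring (\<lambda>_. 1) f r (- t)) {0..pi}"
    by simp
  then have "integral {0..pi} (\<lambda>\<theta>. - f (t + r * cos \<theta>)) = ring (\<lambda>_. 1) f r (- t)"
    by (rule integral_unique)
  then show ?thesis by (simp add: ring_def)
qed

text \<open>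
  \<open>A 0\<close> is the Abel transform of \<open>H\<close>. It is chosen so that its ring average \<open>v\<close> satisfies
  \<open>v = 0\<close> and \<open>r v\<^sub>t = \<pi> H r\<close> at time \<open>0\<close>; the normalized primitive of \<open>H\<close> serves as the cutoff.
\<close>

locale odd_profile =
  fixes H :: "real \<Rightarrow> complex" and R \<rho> :: real
  assumes H_smooth: "smooth UNIV H" and H_odd: "\<And>s. H (- s) = - H s"
    and H_support: "\<And>s. R < \<bar>s\<bar> \<Longrightarrow> H s = 0"
    and \<rho>_pos: "0 < \<rho>" and H_near_0: "\<And>s. \<bar>s\<bar> < \<rho> \<Longrightarrow> H s = 0"
    and R_pos: "0 < R" and mass: "integral {0..R} H \<noteq> 0"
begin

primrec H_deriv :: "nat \<Rightarrow> real \<Rightarrow> complex" where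
  "H_deriv 0 = H"
| "H_deriv (Suc k) = (\<lambda>s. vector_derivative (H_deriv k) (at s))"

lemma H_deriv_smooth: "smooth UNIV (H_deriv k)"
  by (induction k) (simp_all add: H_smooth smooth_vector_derivative)

lemma H_deriv_deriv: "(H_deriv k has_vector_derivative H_deriv (Suc k) s) (at s)"
  using smooth_has_vector_derivative[OF H_deriv_smooth] by simp

lemma H_deriv_cont: "continuous_on UNIV (H_deriv k)"
  by (rule smooth_continuous_on[OF H_deriv_smooth])

lemma H_deriv_support: "R < \<bar>s\<bar> \<Longrightarrow> H_deriv k s = 0"
proof (induction k arbitrary: s)
  case (Suc k)
  have "(H_deriv k has_vector_derivative 0) (at s)"
  proof (rule has_vector_derivative_transform_within_open[of "\<lambda>_. 0" _ _ "{s. R < \<bar>s\<bar>}"])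
    show "open {s. R < \<bar>s\<bar>}"
      by (intro open_Collect_less continuous_intros)
  qed (use Suc in auto)
  then show ?case
    using vector_derivative_unique_at[OF H_deriv_deriv] by blast
qed (simp add: H_support)

lemma H_deriv_bounded:
  obtains B where "0 \<le> B" "\<And>s. cmod (H_deriv k s) \<le> B"
proof (rule continuous_compact_support_bounded[OF H_deriv_cont, of "{- R..R}" k])
  show "H_deriv k s = 0" if "s \<notin> {- R..R}" for s
    using that by (intro H_deriv_support) auto
qed (auto intro: that)

definition A :: "nat \<Rightarrow> real \<Rightarrow> complex" where
  "A k t = integral {0..pi/2} (\<lambda>\<phi>. (sin \<phi> ^ k) *\<^sub>R H_deriv k (t * sin \<phi>))"

lemma A_deriv: "(A k has_vector_derivative A (Suc k) t) (at t)"
proof -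
  have "((\<lambda>t. integral {0..pi/2} (\<lambda>\<phi>. (sin \<phi> ^ k) *\<^sub>R H_deriv k (0 + t * sin \<phi>))) has_vector_derivative
      integral {0..pi/2} (\<lambda>\<phi>. (sin \<phi> ^ k * sin \<phi>) *\<^sub>R H_deriv (Suc k) (0 + t * sin \<phi>))) (at t)"
    by (intro has_vector_derivative_affine_integral H_deriv_deriv H_deriv_cont continuous_intros)
  then show ?thesis
    by (simp add: A_def[abs_def] mult.commute del: H_deriv.simps)
qed

lemma A_cont: "continuous_on UNIV (A k)"
  by (intro continuous_at_imp_continuous_on ballI) (rule has_vector_derivative_continuous[OF A_deriv])

lemma A_bounded: "\<exists>B. \<forall>t. cmod (A k t) \<le> B"
proof -
  obtain B where B: "0 \<le> B" "\<And>s. cmod (H_deriv k s) \<le> B" using H_deriv_bounded[of k] by blast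
  have "cmod (A k t) \<le> integral {0..pi/2} (\<lambda>_. B)" for t
    unfolding A_def
  proof (intro Henstock_Kurzweil_Integration.integral_norm_bound_integral integrable_continuous_real
      continuous_intros continuous_on_compose2[OF H_deriv_cont])
    fix \<phi> :: real
    have "\<bar>sin \<phi>\<bar> ^ k * cmod (H_deriv k (t * sin \<phi>)) \<le> 1 * B"
      by (intro mult_mono B power_le_one) auto
    then show "cmod ((sin \<phi> ^ k) *\<^sub>R H_deriv k (t * sin \<phi>)) \<le> B"
      by (simp add: power_abs)
  qed auto
  then show ?thesis by blast
qed

lemma A_odd: "A 0 (- t) = - A 0 t"
  by (simp add: A_def H_odd)

lemma ring_A_0: "ring (\<lambda>_. 1) (A 0) r 0 = 0"
proof -
  have "ring (\<lambda>_. 1) (A 0) r (- 0) = - ring (\<lambda>_. 1) (A 0) r 0"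
    by (rule ring_odd[OF A_cont A_odd])
  then show ?thesis by simp
qed

text \<open>Oddness turns \<open>H r - H (- r)\<close> into \<open>2 * H r\<close>, which doubles
  the factor \<open>pi / 2\<close> of \<open>ring_abel\<close>.\<close>

lemma ring_A_1:
  assumes "0 < r"
  shows "complex_of_real r * ring (\<lambda>_. 1) (A (Suc 0)) r 0 = complex_of_real pi * H r"
proof -
  have "A (Suc 0) = (\<lambda>s. integral {0..pi/2} (\<lambda>\<phi>. sin \<phi> *\<^sub>R H_deriv (Suc 0) (s * sin \<phi>)))"
    by (simp add: A_def[abs_def])
  then show ?thesis
    using ring_abel[OF H_deriv_deriv H_deriv_cont assms, of 0] by (simp add: H_odd)
qed

text \<open>The transform \<open>A 0\<close> itself is not compactly supported, but both initial
  data of its ring average vanish beyond \<open>R\<close>; finite propagation does the rest, and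
  oddness in time covers negative \<open>t\<close>.\<close>

lemma ring_A_support:
  assumes "R + \<bar>t\<bar> < r"
  shows "ring (\<lambda>_. 1) (A 0) r t = 0"
proof -
  have 1: "ring (\<lambda>_. 1) (A (Suc 0)) r 0 = 0" if "R < r" for r
    using ring_A_1[of r] H_support[of r] that R_pos by simp
  have "ring (\<lambda>_. 1) (A 0) r \<bar>t\<bar> = 0"
    by (rule ring_finite_propagation[OF A_deriv A_deriv A_cont _ ring_A_0 1]) (use R_pos assms in auto)
  then show ?thesis
    using ring_odd[OF A_cont A_odd, of r t] by (cases "0 \<le> t") auto
qed

text \<open>As \<open>H\<close> is complex, this step need be neither real nor monotone. What counts
  is smoothness, boundedness, and the values 0 below \<open>\<rho>\<close> and 1 from
  \<open>R\<close> on; the nonzero mass permits the normalization.\<close>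

definition \<Theta> :: "real \<Rightarrow> complex" where
  "\<Theta> s = (if 0 < s then integral {0..s} H else 0) / integral {0..R} H"

lemma H_cont: "continuous_on UNIV H"
  using H_deriv_cont[of 0] by simp

lemma \<Theta>_eq_0: "s < \<rho> \<Longrightarrow> \<Theta> s = 0"
proof -
  assume s: "s < \<rho>"
  have "integral {0..s} H = integral {0..s} (\<lambda>_. 0)"
    using s by (intro Henstock_Kurzweil_Integration.integral_cong H_near_0) auto
  then show ?thesis by (simp add: \<Theta>_def)
qed

lemma \<Theta>_eq_1: "R \<le> s \<Longrightarrow> \<Theta> s = 1"
proof -
  assume s: "R \<le> s"
  have "integral {0..s} H = integral {0..R} H + integral {R..s} H"
    using R_pos s by (intro Henstock_Kurzweil_Integration.integral_combine[symmetric]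
        integrable_continuous_real continuous_on_subset[OF H_cont]) auto
  moreover have "integral {R..s} H = 0"
  proof (rule integral_unique, rule has_integral_spike_finite[of "{R}"])
    show "H x = 0" if "x \<in> {R..s} - {R}" for x using that R_pos by (intro H_support) auto
    show "((\<lambda>_. 0) has_integral (0::complex)) {R..s}" by simp
  qed auto
  ultimately show ?thesis
    using s R_pos mass by (simp add: \<Theta>_def)
qed

lemma \<Theta>_smooth: "smooth UNIV \<Theta>"
proof -
  let ?M = "integral {0..R} H"
  have "smooth {0<..} \<Theta>"
  proof (rule smooth_antiderivative[where f' = "\<lambda>s. H s * inverse ?M"])
    fix s :: real assume "s \<in> {0<..}"
    then have s: "0 < s" by simp
    have "((\<lambda>s. integral {0..s} H) has_vector_derivative H s) (at s within {0..s + 1})"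
      using s by (intro integral_has_vector_derivative continuous_on_subset[OF H_cont]) auto
    then have "((\<lambda>s. integral {0..s} H) has_vector_derivative H s) (at s)"
      using s by (simp add: at_within_Icc_at)
    from has_vector_derivative_mult_left[OF this, of "inverse ?M"]
    show "(\<Theta> has_vector_derivative H s * inverse ?M) (at s)"
      by (rule has_vector_derivative_transform_within_open[of _ _ _ "{0<..}"])
         (use s in \<open>auto simp: \<Theta>_def divide_inverse\<close>)
  next
    show "smooth {0<..} (\<lambda>s. H s * inverse ?M)"
      by (intro smooth_mult smooth_const smooth_subset[OF H_smooth]) auto
  qed auto
  moreover have "smooth {..<\<rho>} \<Theta>"
    by (rule smooth_cong[OF smooth_const[of _ 0]]) (auto simp: \<Theta>_eq_0)
  ultimately have "smooth ({0<..} \<union> {..<\<rho>}) \<Theta>"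
    by (rule smooth_Un)
  moreover have "{0<..} \<union> {..<\<rho>} = UNIV"
    using \<rho>_pos by auto
  ultimately show ?thesis by simp
qed

text \<open>The number \<open>R\<close> enters twice: as the radius of the initial support, and as
  the point from which the step \<open>\<Theta>\<close> is constantly 1.\<close>

sublocale radial_wave A R R \<Theta>
proof
  show "\<Theta> s = 0" if "s \<le> 0" for s
    using that \<rho>_pos by (intro \<Theta>_eq_0) simp
qed (use A_deriv A_bounded R_pos ring_A_support \<Theta>_smooth \<Theta>_eq_1 in auto)

lemma wave_0: "wave 0 0 = 0"
proof -
  have "hardy_lift (\<lambda>r. v 0 r 0) = (\<lambda>_::'a. 0)"
    by (simp add: v_def ring_A_0 hardy_lift_def fun_eq_iff)
  then show ?thesis by (simp add: wave_def zero_l2_def)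
qed

lemma initial_velocity: "0 \<le> r \<Longrightarrow> complex_of_real r * v (Suc 0) r 0 = complex_of_real pi * H r"
  using ring_A_1[of r] H_near_0[of 0] \<rho>_pos by (cases "r = 0") (auto simp: v_def)

lemma wave_solution:
  "wave_solution (friedrichs (hardy_minimal (- ((real DIM('a) - 2) / 2)\<^sup>2) :: ('a::euclidean_space l2 \<times> 'a l2) set))
    (wave (Suc 0) 0) (wave 0)"
proof -
  have c: "continuous_on {0..} (wave (Suc (Suc 0)) :: real \<Rightarrow> 'a l2)"
    by (intro continuous_at_imp_continuous_on ballI) (rule has_vector_derivative_continuous[OF wave_has_vector_derivative])
  show ?thesis
    unfolding wave_solution_def
    by (rule conjI[OF wave_0], rule exI[of _ "wave (Suc 0)"], rule exI[of _ "wave (Suc (Suc 0))"])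
       (auto simp: c wave_in_friedrichs intro: has_vector_derivative_at_within[OF wave_has_vector_derivative])
qed

section \<open>Growth of the norm\<close>

text \<open>The weight \<open>r\<close> of the plane and the initial velocity combine to
  \<open>pi * H r\<close>, supported in \<open>[0, R]\<close>, where the ring asymptotics are
  uniform. Pairing the leading term \<open>pi M / s\<close> with it gives
  \<open>pi^2 |M|^2 / s\<close>, which is positive whatever the phase of the mass
  \<open>M\<close>.\<close>

lemma wave_cinner_asymptotics:
  obtains K where "\<And>s. 2 * R + 1 \<le> s \<Longrightarrow>
    \<bar>inner (wave 0 s) (wave (Suc 0) 0 :: 'a::euclidean_space l2) - sphere_area DIM('a) * (pi * cmod (integral {0..R} H))\<^sup>2 / s\<bar> \<le> K / s\<^sup>2"
proof -
  let ?M = "integral {0..R} H"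
  obtain B where B: "0 \<le> B" "\<And>s. cmod (H s) \<le> B" using H_deriv_bounded[of 0] by auto
  define K0 where "K0 = pi / 2 * (B * R\<^sup>2)"
  have K0: "0 \<le> K0" using B by (simp add: K0_def)
  define K1 where "K1 = pi * (4 * K0 + 2 * R * cmod ?M)"
  have K1: "0 \<le> K1" using K0 R_pos by (simp add: K1_def)
  have A0: "A 0 = (\<lambda>t. integral {0..pi/2} (\<lambda>\<phi>. H (t * sin \<phi>)))"
    by (simp add: A_def[abs_def])
  have asym: "cmod (A 0 s - ?M / complex_of_real s) \<le> K0 / s\<^sup>2" if "R \<le> s" "0 < s" for s
    using abel_asymptotics[OF H_cont B(2) _ _ that] R_pos H_support by (simp add: A0 K0_def)
  have v0: "cmod (v 0 r s - complex_of_real pi * ?M / complex_of_real s) \<le> K1 / s\<^sup>2"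
    if "0 \<le> r" "r \<le> R" "2 * R + 1 \<le> s" for r s
    using ring_asymptotics[OF A_cont K0 _ asym that] R_pos by (simp add: v_def K1_def)
  define \<sigma> where "\<sigma> = sphere_area DIM('a)"
  have \<sigma>: "0 < \<sigma>" unfolding \<sigma>_def by (rule sphere_area_pos)
  have "\<bar>inner (wave 0 s) (wave (Suc 0) 0 :: 'a l2) - \<sigma> * (pi * cmod ?M)\<^sup>2 / s\<bar> \<le> (\<sigma> * (K1 * (pi * B) * R)) / s\<^sup>2"
    if s: "2 * R + 1 \<le> s" for s
  proof -
    have s0: "0 < s" using s R_pos by linarith
    have rv: "complex_of_real r * (v 0 r s * cnj (v (Suc 0) r 0)) = v 0 r s * cnj (complex_of_real pi * H r)" if "0 \<le> r" for r
      using initial_velocity[OF that] by (metis complex_cnj_complex_of_real complex_cnj_mult mult.left_commute)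
    have "l2_cinner (wave 0 s) (wave (Suc 0) 0 :: 'a l2) =
        complex_of_real \<sigma> * integral {0..R} (\<lambda>r. complex_of_real r * (v 0 r s * cnj (v (Suc 0) r 0)))"
      unfolding wave_def \<sigma>_def
    proof (rule hardy_lift_cinner[OF v_measurable v_measurable wave_square_integrable wave_square_integrable])
      show "continuous_on {0..R} (\<lambda>r. complex_of_real r * (v 0 r s * cnj (v (Suc 0) r 0)))"
        by (intro continuous_intros continuous_on_subset[OF v_cont]) auto
      show "v 0 r s * cnj (v (Suc 0) r 0) = 0" if "R < r" for r
        using v_support[of 0 r "Suc 0"] that by simp
    qed
    also have "integral {0..R} (\<lambda>r. complex_of_real r * (v 0 r s * cnj (v (Suc 0) r 0))) =
        integral {0..R} (\<lambda>r. v 0 r s * cnj (complex_of_real pi * H r))"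
      by (intro Henstock_Kurzweil_Integration.integral_cong rv) auto
    finally have I: "l2_cinner (wave 0 s) (wave (Suc 0) 0 :: 'a l2) =
        complex_of_real \<sigma> * integral {0..R} (\<lambda>r. v 0 r s * cnj (complex_of_real pi * H r))" .
    define q where "q = complex_of_real pi * ?M / complex_of_real s"
    have cH: "continuous_on {0..R} (\<lambda>r. cnj (complex_of_real pi * H r))"
      by (intro continuous_intros continuous_on_subset[OF H_cont]) auto
    have i1: "(\<lambda>r. v 0 r s * cnj (complex_of_real pi * H r)) integrable_on {0..R}"
      by (intro integrable_continuous_real continuous_intros cH continuous_on_subset[OF v_cont]) auto
    have "(H has_integral ?M) {0..R}"
      by (intro integrable_integral integrable_continuous_real continuous_on_subset[OF H_cont]) auto
    then have "((\<lambda>r. cnj (H r)) has_integral cnj ?M) {0..R}"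
      using has_integral_linear[OF _ bounded_linear_cnj] by (simp add: o_def)
    from has_integral_mult_right[OF this, of "q * complex_of_real pi"]
    have i2: "((\<lambda>r. q * cnj (complex_of_real pi * H r)) has_integral q * (complex_of_real pi * cnj ?M)) {0..R}"
      by (simp add: mult.assoc)
    have "cmod (integral {0..R} (\<lambda>r. v 0 r s * cnj (complex_of_real pi * H r)) - q * (complex_of_real pi * cnj ?M))
        \<le> (K1 / s\<^sup>2 * (pi * B)) * measure lborel (cbox 0 R)"
    proof (rule has_integral_bound)
      show "((\<lambda>r. v 0 r s * cnj (complex_of_real pi * H r) - q * cnj (complex_of_real pi * H r)) has_integral
          (integral {0..R} (\<lambda>r. v 0 r s * cnj (complex_of_real pi * H r)) - q * (complex_of_real pi * cnj ?M))) (cbox 0 R)"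
        unfolding box_real by (rule has_integral_diff[OF integrable_integral[OF i1] i2])
      show "cmod (v 0 r s * cnj (complex_of_real pi * H r) - q * cnj (complex_of_real pi * H r)) \<le> K1 / s\<^sup>2 * (pi * B)"
        if "r \<in> cbox 0 R" for r
      proof -
        have "cmod (v 0 r s - q) * cmod (cnj (complex_of_real pi * H r)) \<le> K1 / s\<^sup>2 * (pi * B)"
          using v0[of r s] that s B K1 unfolding q_def by (intro mult_mono) (auto simp: norm_mult)
        then show ?thesis by (simp only: norm_mult[symmetric] left_diff_distrib)
      qed
    qed (use K1 B in auto)
    then have "\<sigma> * cmod (integral {0..R} (\<lambda>r. v 0 r s * cnj (complex_of_real pi * H r)) - q * (complex_of_real pi * cnj ?M))
        \<le> \<sigma> * ((K1 / s\<^sup>2 * (pi * B)) * R)"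
      using \<sigma> R_pos by (intro mult_left_mono) auto
    moreover have "\<sigma> * cmod x = cmod (complex_of_real \<sigma> * x)" for x
      using \<sigma> by (simp add: norm_mult)
    ultimately have "cmod (l2_cinner (wave 0 s) (wave (Suc 0) 0 :: 'a l2) - complex_of_real \<sigma> * (q * (complex_of_real pi * cnj ?M)))
        \<le> \<sigma> * ((K1 / s\<^sup>2 * (pi * B)) * R)"
      unfolding I by (simp only: right_diff_distrib)
    moreover have "complex_of_real \<sigma> * (q * (complex_of_real pi * cnj ?M)) = complex_of_real (\<sigma> * (pi * cmod ?M)\<^sup>2 / s)"
    proof -
      have "complex_of_real \<sigma> * (q * (complex_of_real pi * cnj ?M)) =
          complex_of_real \<sigma> * complex_of_real (pi\<^sup>2) * (?M * cnj ?M) / complex_of_real s"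
        by (simp add: q_def power2_eq_square)
      also have "?M * cnj ?M = complex_of_real ((cmod ?M)\<^sup>2)"
        by (rule complex_norm_square[symmetric])
      finally show ?thesis by (simp add: power_mult_distrib)
    qed
    ultimately have "cmod (l2_cinner (wave 0 s) (wave (Suc 0) 0 :: 'a l2) - complex_of_real (\<sigma> * (pi * cmod ?M)\<^sup>2 / s))
        \<le> \<sigma> * ((K1 / s\<^sup>2 * (pi * B)) * R)"
      by simp
    then have "\<bar>Re (l2_cinner (wave 0 s) (wave (Suc 0) 0 :: 'a l2) - complex_of_real (\<sigma> * (pi * cmod ?M)\<^sup>2 / s))\<bar>
        \<le> \<sigma> * ((K1 / s\<^sup>2 * (pi * B)) * R)"
      using abs_Re_le_cmod order_trans by blast
    then show ?thesis
      by (simp add: inner_l2_def mult_ac)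
  qed
  then show thesis
    unfolding \<sigma>_def by (rule that)
qed

lemma norm_wave_log_growth:
  "\<exists>C\<ge>1. \<forall>t\<ge>2. inverse C * (ln t) powr (1/2) \<le> norm (wave 0 t :: 'a::euclidean_space l2) \<and>
     norm (wave 0 t :: 'a l2) \<le> C * (ln t) powr (1/2)"
proof -
  let ?w = "wave :: nat \<Rightarrow> real \<Rightarrow> 'a l2"
  have sym: "?w (Suc (Suc 0)) s \<bullet> ?w 0 t = ?w 0 s \<bullet> ?w (Suc (Suc 0)) t" for s t
  proof -
    have "l2_cinner (- ?w (Suc (Suc 0)) s) (?w 0 t) = cnj (l2_cinner (- ?w (Suc (Suc 0)) t) (?w 0 s))"
      by (rule bounded_symmetric_form.friedrichs_symmetric[OF bounded_symmetric_form_hardy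
            wave_in_friedrichs wave_in_friedrichs])
    then have "(- ?w (Suc (Suc 0)) s) \<bullet> ?w 0 t = (- ?w (Suc (Suc 0)) t) \<bullet> ?w 0 s"
      by (simp add: inner_l2_def)
    then show ?thesis by (simp add: inner_commute)
  qed
  define E where "E t = ?w 0 t \<bullet> ?w 0 t" for t
  define e where "e t = ?w 0 (2 * t) \<bullet> ?w (Suc 0) 0" for t
  have E_d: "(E has_real_derivative e t) (at t)" if "0 < t" for t
  proof -
    have "((\<lambda>t. ?w 0 t \<bullet> ?w 0 t) has_vector_derivative ?w 0 (2 * t) \<bullet> ?w (Suc 0) 0) (at t within {0..})"
      by (rule wave_norm_derivative[OF has_vector_derivative_at_within[OF wave_has_vector_derivative]
            has_vector_derivative_at_within[OF wave_has_vector_derivative] sym wave_0]) (use that in simp)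
    moreover have "at t within {0..} = at t"
      using that by (intro at_within_interior) simp
    ultimately show ?thesis
      by (simp add: E_def[abs_def] e_def has_real_derivative_iff_has_vector_derivative)
  qed
  obtain K where K: "\<And>s. 2 * R + 1 \<le> s \<Longrightarrow>
    \<bar>?w 0 s \<bullet> ?w (Suc 0) 0 - sphere_area DIM('a) * (pi * cmod (integral {0..R} H))\<^sup>2 / s\<bar> \<le> K / s\<^sup>2"
    using wave_cinner_asymptotics[where 'a='a] by blast
  \<comment> \<open>The halving here, and \<open>K / 4\<close> below, arise because the derivative
    of the squared norm at \<open>t\<close> is the pairing at time \<open>2 * t\<close>.\<close>
  define c where "c = sphere_area DIM('a) * (pi * cmod (integral {0..R} H))\<^sup>2 / 2"
  have c: "0 < c"
    unfolding c_def using mass sphere_area_pos[where 'a='a] by (intro divide_pos_pos mult_pos_pos) auto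
  have lim: "((\<lambda>t. E t / ln t) \<longlongrightarrow> c) at_top"
  proof (rule logarithmic_growth[OF E_d c, where T = "2 * R + 1" and K = "K / 4"])
    show "\<bar>e t - c / t\<bar> \<le> K / 4 / t\<^sup>2" if "2 * R + 1 \<le> t" for t
    proof -
      have "2 * R + 1 \<le> 2 * t" using that R_pos by linarith
      from K[OF this] show ?thesis
        by (simp add: e_def c_def power_mult_distrib)
    qed
  qed (use R_pos in auto)
  have "\<forall>\<^sub>F t in at_top. 0 < E t / ln t"
    by (rule order_tendstoD(1)[OF lim c])
  then obtain T where T: "\<And>t. T \<le> t \<Longrightarrow> 0 < E t / ln t"
    by (auto simp: eventually_at_top_linorder)
  have large: "?w 0 t \<noteq> 0" if "T \<le> t" for t
    using T[OF that] by (auto simp: E_def)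
  have nz: "?w 0 t \<noteq> 0" if "0 < t" for t
    by (rule wave_nonzero[OF wave_has_vector_derivative wave_has_vector_derivative sym wave_0 that large])
  have "continuous_on {2..} E"
    by (intro continuous_at_imp_continuous_on ballI DERIV_isCont[OF E_d]) auto
  then have cont: "continuous_on {2..} (\<lambda>t. E t / ln t)"
    by (intro continuous_intros) auto
  have pos: "0 < E t / ln t" if "2 \<le> t" for t
    using nz[of t] that by (simp add: E_def)
  obtain C where C: "1 \<le> C" "\<And>t. 2 \<le> t \<Longrightarrow> inverse C \<le> E t / ln t \<and> E t / ln t \<le> C"
    using positive_continuous_limit_bounds[OF cont pos lim c] by blast
  show ?thesis
  \<comment> \<open>\<open>C\<close> bounds the squared norm against \<open>ln t\<close>, so its
    square root bounds the norm.\<close>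
  proof (intro exI[of _ "sqrt C"] conjI allI impI)
    show "1 \<le> sqrt C" using C(1) by simp
    fix t :: real assume t: "2 \<le> t"
    have l: "0 < ln t" using t by simp
    have nE: "norm (?w 0 t) = sqrt (E t)" by (simp add: E_def norm_eq_sqrt_inner)
    have p: "(ln t) powr (1/2) = sqrt (ln t)" using l by (simp add: powr_half_sqrt)
    have "inverse C * ln t \<le> E t" "E t \<le> C * ln t"
      using C(2)[OF t] l by (simp_all add: pos_le_divide_eq pos_divide_le_eq)
    then have "sqrt (inverse C * ln t) \<le> sqrt (E t)" "sqrt (E t) \<le> sqrt (C * ln t)"
      by (simp_all only: real_sqrt_le_iff)
    then show "inverse (sqrt C) * (ln t) powr (1/2) \<le> norm (?w 0 t)"
      "norm (?w 0 t) \<le> sqrt C * (ln t) powr (1/2)"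
      unfolding nE p by (simp_all only: real_sqrt_mult real_sqrt_inverse)
  qed
qed

end

section \<open>From radial data in space to odd profiles\<close>

lemma critical_wave_growth:
  fixes g :: "'a::euclidean_space \<Rightarrow> complex"
    and S :: "('a l2 \<times> 'a l2) set"
  assumes S: "S = friedrichs (hardy_minimal (- ((real DIM('a) - 2) / 2)\<^sup>2))"
    and g: "g \<in> test_functions (UNIV - {0})"
    and radial: "\<And>x y. norm x = norm y \<Longrightarrow> g x = g y"
    and mass: "(LINT x|lborel. g x * complex_of_real (norm x powr (- ((real DIM('a) - 2) / 2)))) \<noteq> 0"
  shows "\<exists>C\<ge>1. \<forall>t\<ge>2.
           inverse C * (ln t) powr (1/2) \<le> norm (wave_propagator S t (abs_l2 g)) \<and>
           norm (wave_propagator S t (abs_l2 g)) \<le> C * (ln t) powr (1/2)"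
proof -
  define m where "m = (real DIM('a) - 2) / 2"
  obtain e :: 'a where e: "e \<in> Basis" using nonempty_Basis by blast
  define G where "G s = g (s *\<^sub>R e)" for s
  have gG: "g x = G (norm x)" for x
    unfolding G_def using e by (intro radial) simp
  have G_even: "G (- s) = G s" for s
    unfolding G_def by (rule radial) simp
  define K where "K = closure {x. g x \<noteq> 0}"
  note K = test_functionD[OF g, folded K_def]
  have "open (- K)" by (simp add: K_def open_Compl)
  moreover have "0 \<in> - K" using K(2) by simp
  ultimately obtain \<rho> where \<rho>: "0 < \<rho>" "ball 0 \<rho> \<subseteq> - K"
    using openE by blast
  obtain R where R: "0 < R" "\<And>x. x \<in> K \<Longrightarrow> norm x \<le> R"
    using compact_imp_bounded[OF K(1)] by (meson bounded_pos)
  have G0: "G s = 0" if "\<bar>s\<bar> < \<rho> \<or> R < \<bar>s\<bar>" for s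
  proof -
    have n: "norm (s *\<^sub>R e) = \<bar>s\<bar>" using e by simp
    have "s *\<^sub>R e \<notin> K"
    proof (cases "\<bar>s\<bar> < \<rho>")
      case True
      then have "s *\<^sub>R e \<in> ball 0 \<rho>" using e by simp
      then show ?thesis using \<rho>(2) by blast
    next
      case False
      then show ?thesis using that R(2)[of "s *\<^sub>R e"] n by linarith
    qed
    then show ?thesis unfolding G_def by (rule K(3))
  qed
  have G_smooth: "smooth UNIV G"
    unfolding G_def[abs_def] by (rule smooth_ray[OF _ e]) (use g in \<open>simp add: test_functions_def\<close>)
  \<comment> \<open>For \<open>r > 0\<close> this is \<open>r\<close> times the plane profile
    \<open>r^m G r\<close>, divided by \<open>pi\<close> to compensate the unnormalized ring
    average. Writing \<open>(s^2) powr (m / 2)\<close> for \<open>|s|^m\<close> makes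
    \<open>H\<close> odd, and it is smooth across 0 because \<open>G\<close> vanishes
    nearby.\<close>
  define H where "H s = complex_of_real (1 / pi) * (complex_of_real s * (complex_of_real ((s\<^sup>2) powr (m / 2)) * G s))" for s
  have H_smooth: "smooth UNIV H"
  proof -
    have "smooth (- {0}) H"
      unfolding H_def[abs_def]
      by (intro smooth_mult smooth_const smooth_of_real smooth_powr_square smooth_subset[OF G_smooth])
         (auto simp: open_Compl)
    moreover have "smooth {- \<rho><..<\<rho>} H"
      by (rule smooth_cong[OF smooth_const[of _ 0]]) (auto simp: H_def abs_less_iff G0)
    ultimately have "smooth (- {0} \<union> {- \<rho><..<\<rho>}) H"
      by (rule smooth_Un)
    moreover have "- {0} \<union> {- \<rho><..<\<rho>} = UNIV" using \<rho>(1) by auto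
    ultimately show ?thesis by simp
  qed
  have H_pos: "complex_of_real pi * H r = complex_of_real r * (complex_of_real (r powr m) * G r)" if "0 < r" for r
  proof -
    have "(r\<^sup>2) powr (m / 2) = r powr m"
      using that by (simp add: powr_powr flip: powr_numeral)
    then show ?thesis by (simp add: H_def)
  qed
  define \<gamma> where "\<gamma> r = complex_of_real (r powr m) * G r" for r
  have g\<gamma>: "g = hardy_lift \<gamma>"
  proof
    fix x
    show "g x = hardy_lift \<gamma> x"
    proof (cases "x = 0")
      case True
      then show ?thesis using gG[of x] G0[of 0] \<rho>(1) by (simp add: hardy_lift_def)
    next
      case False
      then have "norm x powr (- m) * norm x powr m = 1"
        by (simp flip: powr_add)
      then have "complex_of_real (norm x powr (- m)) * complex_of_real (norm x powr m) = 1"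
        by (metis of_real_1 of_real_mult)
      then show ?thesis
        using gG[of x] by (simp add: hardy_lift_def \<gamma>_def m_def[symmetric] mult.assoc[symmetric])
    qed
  qed
  have Gm: "G \<in> borel_measurable borel"
    by (rule borel_measurable_continuous_onI[OF smooth_continuous_on[OF G_smooth]])
  have \<gamma>m: "\<gamma> \<in> borel_measurable borel"
    unfolding \<gamma>_def[abs_def] using Gm by measurable
  have H_cont: "continuous_on UNIV H" by (rule smooth_continuous_on[OF H_smooth])
  have H0: "H s = 0" if "\<bar>s\<bar> < \<rho> \<or> R < \<bar>s\<bar>" for s
    using G0[OF that] by (simp add: H_def)
  \<comment> \<open>The lift of the constant 1 is the ground state itself. The mass of
    \<open>g\<close> is therefore the pairing of two lifts, which in plane coordinates equals the
    sphere area times \<open>pi\<close> times the integral of \<open>H\<close>.\<close>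
  have "integral {0..R} H \<noteq> 0"
  proof
    assume 0: "integral {0..R} H = 0"
    have pw: "indicator {0..} r *\<^sub>R (complex_of_real r * (\<gamma> r * cnj 1)) = complex_of_real pi * (indicator {0..R} r *\<^sub>R H r)" for r
    proof -
      consider "r < 0" | "r = 0" | "0 < r" "r \<le> R" | "R < r" using R(1) by linarith
      then show ?thesis
      proof cases
        case 2
        then show ?thesis using H0[of 0] \<rho>(1) by simp
      next
        case 3
        then show ?thesis using H_pos[of r] by (simp add: \<gamma>_def)
      next
        case 4
        then show ?thesis using G0[of r] R(1) by (simp add: \<gamma>_def)
      qed simp
    qed
    have si: "set_integrable lborel {0..R} H"
      unfolding set_integrable_def by (rule borel_integrable_compact[OF compact_Icc continuous_on_subset[OF H_cont]]) simp
    have "(LINT x|lborel. g x * complex_of_real (norm x powr (- m))) =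
        (LINT x|lborel. hardy_lift \<gamma> (x::'a) * cnj (hardy_lift (\<lambda>_. 1) x))"
      by (simp add: g\<gamma> hardy_lift_def m_def)
    also have "\<dots> = complex_of_real (sphere_area DIM('a)) *
        (LINT r|lborel. indicator {0..} r *\<^sub>R (complex_of_real r * (\<gamma> r * cnj 1)))"
      by (rule hardy_lift_integral(2)[OF \<gamma>m]) simp
    also have "(LINT r|lborel. indicator {0..} r *\<^sub>R (complex_of_real r * (\<gamma> r * cnj 1))) =
        complex_of_real pi * (LINT r|lborel. indicator {0..R} r *\<^sub>R H r)"
      unfolding pw by (rule Bochner_Integration.integral_mult_right_zero)
    also have "(LINT r|lborel. indicator {0..R} r *\<^sub>R H r) = 0"
      using set_borel_integral_eq_integral(2)[OF si] 0 by (simp add: set_lebesgue_integral_def)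
    finally show False using mass by (simp add: m_def)
  qed
  then interpret odd_profile H R \<rho>
    by unfold_locales (use H_smooth G_even H0 \<rho>(1) R(1) in \<open>auto simp: H_def\<close>)
  \<comment> \<open>Dividing \<open>initial_velocity\<close> by the positive radius recovers the
    plane profile \<open>\<gamma>\<close> of \<open>g\<close>; at the origin both lifts are zero by
    the value of \<open>powr\<close> there.\<close>
  have "hardy_lift (\<lambda>r. v (Suc 0) r 0) = g"
  proof
    fix x
    show "hardy_lift (\<lambda>r. v (Suc 0) r 0) x = g x"
    proof (cases "x = 0")
      case False
      then have r: "0 < norm x" by simp
      then have "v (Suc 0) (norm x) 0 = \<gamma> (norm x)"
        using initial_velocity[of "norm x"] H_pos[of "norm x"] by (simp add: \<gamma>_def)
      then show ?thesis by (simp add: g\<gamma> hardy_lift_def)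
    qed (simp add: g\<gamma> hardy_lift_def)
  qed
  then have vel: "wave (Suc 0) 0 = abs_l2 g"
    by (simp add: wave_def)
  have sol: "wave_solution S (abs_l2 g) (wave 0)"
    using wave_solution[where 'a='a] unfolding vel S .
  have "f \<bullet> v' = u \<bullet> h" if "(u, f) \<in> S" "(v', h) \<in> S" for u f v' h
  proof -
    have "l2_cinner f v' = cnj (l2_cinner h u)"
      using that unfolding S by (rule bounded_symmetric_form.friedrichs_symmetric[OF bounded_symmetric_form_hardy])
    then show ?thesis by (simp add: inner_l2_def inner_commute[of u h, unfolded inner_l2_def])
  qed
  then have propagator: "wave_propagator S t (abs_l2 g) = wave 0 t" if "2 \<le> t" for t
    using wave_propagator_eq[OF _ sol, of t] that by simp
  show ?thesis
    using norm_wave_log_growth[where 'a='a] by (simp add: propagator)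
qed

theorem proposition1p7:
  fixes g :: "real ^ 'n \<Rightarrow> complex"
    and S :: "((real ^ 'n) l2 \<times> (real ^ 'n) l2) set"
  assumes "CARD('n) \<ge> 3"
    and "S = friedrichs (hardy_minimal (- ((real CARD('n) - 2) / 2)\<^sup>2))"
    and "g \<in> test_functions (UNIV - {0})"
    and "\<And>x y. norm x = norm y \<Longrightarrow> g x = g y"
    and "(LINT x|lborel. g x * complex_of_real (norm x powr (- ((real CARD('n) - 2) / 2)))) \<noteq> 0"
  shows "\<exists>C\<ge>1. \<forall>t\<ge>2.
           inverse C * (ln t) powr (1/2) \<le> norm (wave_propagator S t (abs_l2 g)) \<and>
           norm (wave_propagator S t (abs_l2 g)) \<le> C * (ln t) powr (1/2)"
proof (rule critical_wave_growth)
  have dim: "DIM(real ^ 'n) = CARD('n)" by simp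
  show "S = friedrichs (hardy_minimal (- ((real DIM(real ^ 'n) - 2) / 2)\<^sup>2))"
    unfolding dim by (rule assms(2))
  show "(LINT x|lborel. g x * complex_of_real (norm x powr (- ((real DIM(real ^ 'n) - 2) / 2)))) \<noteq> 0"
    unfolding dim by (rule assms(5))
qed (rule assms(3), rule assms(4))

end
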